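(* Let $m,n\ge 2$ be integers, $\alpha,\beta\in\mathbb{R}$, $P\in M_{m,n}$, $Q\in M_m$. Let $\Phi^{\pm}_{\alpha,P}:M_n\to M_m$ be $\Phi^{\pm}_{\alpha,P}(Y)=\alpha\,\mathrm{tr}(Y)I_m\pm PYP^*$ and let $\Phi^{+}_{\beta,Q}:M_m\to M_m$ be $\Phi^{+}_{\beta,Q}(Y)=\beta\,\mathrm{tr}(Y)I_m+QYQ^*$. Let $A,X,C\in M_n$ be such that $\begin{bmatrix} A & X \\ X^* & C \end{bmatrix}$ is positive semidefinite. Put $\alpha^+=\sigma_1(P)\sigma_2(P)$ and $\alpha^-=\sigma_1(P)^2+\sigma_2(P)^2$. For each choice of sign $\pm$ (the same throughout): if $\alpha\ge\alpha^{\pm}$ and $\beta\ge\frac12\sigma_1(Q)^2$, then for every $j\in\{1,\ldots,m\}$, \[\sigma_j\big(\Phi^{+}_{\beta,Q}(\Phi^{\pm}_{\alpha,P}(X))\big)\le\lambda_j\Big(\Phi^{+}_{\beta,Q}(\Phi^{\pm}_{\alpha,P}(A))\,\sharp\,\Phi^{+}_{\beta,Q}(\Phi^{\pm}_{\alpha,P}(C))\Big).\]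
   Context: $M_{m,n}$ is the set of $m\times n$ complex matrices, $M_n=M_{n,n}$. Singular values are listed in decreasing order $\sigma_1\ge\sigma_2\ge\cdots$, and eigenvalues of a Hermitian $H\in M_m$ are listed in decreasing order $\lambda_1(H)\ge\cdots\ge\lambda_m(H)$. The geometric mean of positive definite $S,T\in M_m$ is $S\sharp T=S^{1/2}(S^{-1/2}TS^{-1/2})^{1/2}S^{1/2}$; for positive semidefinite $S,T\in M_m$ it is $S\sharp T=\lim_{\epsilon\to0^+}(S+\epsilon I_m)\sharp(T+\epsilon I_m)$. *)

theory Defs
  imports
    "Jordan_Normal_Form.Schur_Decomposition"
    "Jordan_Normal_Form.Gauss_Jordan_Elimination"
begin

definition mat_trace :: "complex mat \<Rightarrow> complex" where
  "mat_trace A = (\<Sum>i<dim_row A. A $$ (i, i))"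

definition hermitian_mat :: "complex mat \<Rightarrow> bool" where
  "hermitian_mat A \<longleftrightarrow> square_mat A \<and> mat_adjoint A = A"

(* The number (A *\<^sub>v v) \<bullet>c v is v^* A v, which is real for Hermitian A. *)
definition psd_mat :: "complex mat \<Rightarrow> bool" where
  "psd_mat A \<longleftrightarrow> hermitian_mat A \<and>
     (\<forall>v \<in> carrier_vec (dim_row A). 0 \<le> Re ((A *\<^sub>v v) \<bullet>c v))"

(* Eigenvalues in decreasing order, repeated by algebraic multiplicity.
   Meant for Hermitian H, whose eigenvalues are real, so that Re loses nothing. *)
definition eigvals_desc :: "complex mat \<Rightarrow> real list" where
  "eigvals_desc H = rev (sorted_list_of_multiset (image_mset Re (proots (char_poly H))))"

(* Indices are 1-based: eigval 1 H is the largest eigenvalue of H. *)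
definition eigval :: "nat \<Rightarrow> complex mat \<Rightarrow> real" where
  "eigval j H = eigvals_desc H ! (j - 1)"

(* Indices are 1-based and run up to dim_col M; values beyond min (dim_row M) (dim_col M)
   are zero. *)
definition singval :: "nat \<Rightarrow> complex mat \<Rightarrow> real" where
  "singval j M = sqrt (eigval j (mat_adjoint M * M))"

(* The unique positive semidefinite square root of a positive semidefinite S. *)
definition mat_sqrt :: "complex mat \<Rightarrow> complex mat" where
  "mat_sqrt S = (THE R. psd_mat R \<and> R * R = S)"

definition geom_mean_pd :: "complex mat \<Rightarrow> complex mat \<Rightarrow> complex mat" where
  "geom_mean_pd S T =
     (let R = mat_sqrt S; R' = the (mat_inverse R)
      in R * mat_sqrt (R' * T * R') * R)"

(* The limit of matrices as eps tends to 0 from the right is taken entrywise; for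
   positive definite S and T it equals geom_mean_pd S T. *)
definition geom_mean :: "complex mat \<Rightarrow> complex mat \<Rightarrow> complex mat" where
  "geom_mean S T =
     (let m = dim_row S
      in mat m m (\<lambda>(i, j). Lim (at_right (0::real)) (\<lambda>eps.
           geom_mean_pd (S + complex_of_real eps \<cdot>\<^sub>m 1\<^sub>m m)
                        (T + complex_of_real eps \<cdot>\<^sub>m 1\<^sub>m m) $$ (i, j))))"

definition Phi_plus :: "real \<Rightarrow> complex mat \<Rightarrow> complex mat \<Rightarrow> complex mat" where
  "Phi_plus a P Y =
     (complex_of_real a * mat_trace Y) \<cdot>\<^sub>m 1\<^sub>m (dim_row P) + P * Y * mat_adjoint P"

definition Phi_minus :: "real \<Rightarrow> complex mat \<Rightarrow> complex mat \<Rightarrow> complex mat" where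
  "Phi_minus a P Y =
     (complex_of_real a * mat_trace Y) \<cdot>\<^sub>m 1\<^sub>m (dim_row P) - P * Y * mat_adjoint P"

end

theory Submission
  imports Defs "HOL-Analysis.L2_Norm"
begin

text \<open>Write \<open>B\<close>, \<open>Y\<close>, \<open>D\<close> for the images of \<open>A\<close>, \<open>X\<close>, \<open>C\<close> under the inner map. The bounds on
  \<open>\<alpha>\<close> are what is needed for both \<open>[B, Y; Y\<^sup>*, D]\<close> and \<open>[B, Y\<^sup>*; Y, D]\<close> to be positive semidefinite; on
  rank one blocks this reduces to inequalities between two pairs of vectors, involving only the two
  largest singular values of \<open>P\<close>. With \<open>G\<close> the geometric mean of \<open>B\<close> and \<open>D\<close> it follows that
  \<open>[G, Y; Y\<^sup>*, G]\<close> is positive semidefinite.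

  For the outer map put \<open>Z = \<beta> t I + Q Y Q\<^sup>*\<close> with \<open>t = tr Y\<close>, \<open>T = tr G\<close> and \<open>K = Q G Q\<^sup>*\<close>. Then
  \<open>|t| = r T\<close> with \<open>0 \<le> r \<le> 1\<close>, and \<open>K \<le> 2 \<beta> T I\<close> by the bound on \<open>\<beta>\<close>. In the polar decomposition
  \<open>Z = U |Z|\<close>, after a change of phase, \<open>|Z| \<le> \<beta> r T Re U + (K + U\<^sup>* K U) / 2\<close>. For real \<open>c\<close>, \<open>s\<close> with
  \<open>c\<^sup>2 + s\<^sup>2 = 1\<close> and \<open>2 c s = r\<close>,
  \<open>K + U\<^sup>* K U = (c + s U)\<^sup>* K (c + s U) + (s - c U)\<^sup>* K (s - c U)\<close>,
  where the last summand is at most \<open>2 \<beta> T (1 - r Re U)\<close>, and where \<open>c + s U\<close> has norm at most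
  \<open>\<surd>2\<close>. Hence the \<open>j\<close>-th singular value of \<open>Z\<close> is at most \<open>\<lambda>\<^sub>j(K) + \<beta> T\<close>, the \<open>j\<close>-th eigenvalue of the
  image of \<open>G\<close>, and by its maximality the geometric mean of the images of \<open>B\<close> and \<open>D\<close> dominates
  the image of \<open>G\<close>.\<close>


section \<open>Vectors as functions\<close>

text \<open>A vector of dimension \<open>n\<close> is a function of which only the values below \<open>n\<close> matter; this avoids
  carrier conditions on vectors.\<close>

definition cip :: "nat \<Rightarrow> (nat \<Rightarrow> complex) \<Rightarrow> (nat \<Rightarrow> complex) \<Rightarrow> complex" where
  "cip n v w = (\<Sum>i<n. v i * cnj (w i))"

definition nsq :: "nat \<Rightarrow> (nat \<Rightarrow> complex) \<Rightarrow> real" where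
  "nsq n v = (\<Sum>i<n. (cmod (v i))\<^sup>2)"

text \<open>Setting the result to 0 beyond the row dimension lets linearity and the product rule for
  \<open>app\<close> be equations between functions. \<open>app_one\<close> is the exception and
  holds below the dimension only.\<close>

definition app :: "complex mat \<Rightarrow> (nat \<Rightarrow> complex) \<Rightarrow> nat \<Rightarrow> complex" where
  "app M v i = (if i < dim_row M then \<Sum>j<dim_col M. M $$ (i, j) * v j else 0)"

section \<open>Inner products and norms\<close>

lemma cip_cong:
  "(\<And>i. i < n \<Longrightarrow> v i = v' i) \<Longrightarrow> (\<And>i. i < n \<Longrightarrow> w i = w' i) \<Longrightarrow> cip n v w = cip n v' w'"
  by (simp add: cip_def)

lemma app_cong: "(\<And>j. j < dim_col M \<Longrightarrow> v j = v' j) \<Longrightarrow> app M v = app M v'"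
  by (simp add: app_def fun_eq_iff)

lemma cip_self: "cip n v v = complex_of_real (nsq n v)"
  by (simp add: cip_def nsq_def complex_norm_square del: of_real_power)

lemma Re_cip_self [simp]: "Re (cip n v v) = nsq n v"
  by (simp add: cip_self)

lemma nsq_nonneg [simp]: "0 \<le> nsq n v"
  by (simp add: nsq_def sum_nonneg)

lemma nsq_eq_0_iff: "nsq n v = 0 \<longleftrightarrow> (\<forall>i<n. v i = 0)"
  by (auto simp: nsq_def sum_nonneg_eq_0_iff)

lemma cip_commute: "cip n w v = cnj (cip n v w)"
  by (simp add: cip_def mult.commute)

lemma Re_cip_commute: "Re (cip n w v) = Re (cip n v w)"
  by (subst cip_commute) simp

lemma cip_add_left: "cip n (\<lambda>i. v i + v' i) w = cip n v w + cip n v' w"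
  and cip_add_right: "cip n v (\<lambda>i. w i + w' i) = cip n v w + cip n v w'"
  and cip_diff_left: "cip n (\<lambda>i. v i - v' i) w = cip n v w - cip n v' w"
  and cip_diff_right: "cip n v (\<lambda>i. w i - w' i) = cip n v w - cip n v w'"
  and cip_minus_left: "cip n (\<lambda>i. - v i) w = - cip n v w"
  and cip_minus_right: "cip n v (\<lambda>i. - w i) = - cip n v w"
  and cip_scale_left: "cip n (\<lambda>i. c * v i) w = c * cip n v w"
  and cip_scale_right: "cip n v (\<lambda>i. c * w i) = cnj c * cip n v w"
  and cip_zero_left: "cip n (\<lambda>i. 0) w = 0"
  and cip_zero_right: "cip n v (\<lambda>i. 0) = 0"
  by (simp_all add: cip_def algebra_simps sum.distrib sum_subtractf sum_distrib_left sum_negf)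

lemmas cip_simps = cip_add_left cip_add_right cip_diff_left cip_diff_right cip_minus_left
  cip_minus_right cip_scale_left cip_scale_right cip_zero_left cip_zero_right

lemma cip_sum_left: "cip n (\<lambda>i. \<Sum>k\<in>K. v k i) w = (\<Sum>k\<in>K. cip n (v k) w)"
  unfolding cip_def by (simp add: sum_distrib_right) (rule sum.swap)

lemma cip_sum_right: "cip n v (\<lambda>i. \<Sum>k\<in>K. w k i) = (\<Sum>k\<in>K. cip n v (w k))"
  unfolding cip_def by (simp add: sum_distrib_left) (rule sum.swap)

lemma nsq_scale: "nsq n (\<lambda>i. c * v i) = (cmod c)\<^sup>2 * nsq n v"
  by (simp add: nsq_def norm_mult power_mult_distrib sum_distrib_left)

lemma nsq_add: "nsq n (\<lambda>i. v i + w i) = nsq n v + 2 * Re (cip n v w) + nsq n w"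
proof -
  have "nsq n (\<lambda>i. v i + w i) = Re (cip n (\<lambda>i. v i + w i) (\<lambda>i. v i + w i))" by simp
  also have "\<dots> = nsq n v + 2 * Re (cip n v w) + nsq n w"
    by (simp add: cip_simps Re_cip_commute[of n w v] del: Re_cip_self) simp
  finally show ?thesis .
qed

text \<open>The index set is arbitrary because the inequality is applied to vectors and also to sums
  over pairs of indices.\<close>

lemma Cauchy_Schwarz_sum:
  fixes f g :: "'a \<Rightarrow> complex"
  shows "(cmod (\<Sum>i\<in>I. f i * cnj (g i)))\<^sup>2 \<le> (\<Sum>i\<in>I. (cmod (f i))\<^sup>2) * (\<Sum>i\<in>I. (cmod (g i))\<^sup>2)"
proof -
  have "cmod (\<Sum>i\<in>I. f i * cnj (g i)) \<le> (\<Sum>i\<in>I. cmod (f i) * cmod (g i))"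
    by (rule order_trans[OF norm_sum]) (simp add: norm_mult)
  also have "\<dots> \<le> L2_set (\<lambda>i. cmod (f i)) I * L2_set (\<lambda>i. cmod (g i)) I"
    using L2_set_mult_ineq[of "\<lambda>i. cmod (f i)" "\<lambda>i. cmod (g i)" I] by simp
  finally have "(cmod (\<Sum>i\<in>I. f i * cnj (g i)))\<^sup>2
      \<le> (L2_set (\<lambda>i. cmod (f i)) I * L2_set (\<lambda>i. cmod (g i)) I)\<^sup>2"
    by (simp add: power_mono)
  also have "\<dots> = (\<Sum>i\<in>I. (cmod (f i))\<^sup>2) * (\<Sum>i\<in>I. (cmod (g i))\<^sup>2)"
    by (simp add: L2_set_def power_mult_distrib sum_nonneg)
  finally show ?thesis .
qed

lemma cip_Cauchy_Schwarz: "(cmod (cip n v w))\<^sup>2 \<le> nsq n v * nsq n w"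
  unfolding cip_def nsq_def by (rule Cauchy_Schwarz_sum)

section \<open>Matrices acting on functions\<close>

lemma app_add: "app M (\<lambda>i. v i + w i) = (\<lambda>i. app M v i + app M w i)"
  and app_diff: "app M (\<lambda>i. v i - w i) = (\<lambda>i. app M v i - app M w i)"
  and app_minus: "app M (\<lambda>i. - v i) = (\<lambda>i. - app M v i)"
  and app_scale: "app M (\<lambda>i. c * v i) = (\<lambda>i. c * app M v i)"
  and app_zero: "app M (\<lambda>i. 0) = (\<lambda>i. 0)"
  by (simp_all add: app_def fun_eq_iff algebra_simps sum.distrib sum_subtractf sum_negf sum_distrib_left)

lemmas app_simps = app_add app_diff app_minus app_scale app_zero

lemma app_sum: "app M (\<lambda>i. \<Sum>k\<in>K. v k i) = (\<lambda>i. \<Sum>k\<in>K. app M (v k) i)"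
proof
  fix i
  show "app M (\<lambda>i. \<Sum>k\<in>K. v k i) i = (\<Sum>k\<in>K. app M (v k) i)"
    unfolding app_def by (simp add: sum_distrib_left) (rule impI, rule sum.swap)
qed

lemma app_mult:
  assumes "A \<in> carrier_mat m n" "B \<in> carrier_mat n k"
  shows "app (A * B) v = app A (app B v)"
proof
  fix i
  show "app (A * B) v i = app A (app B v) i"
  proof (cases "i < m")
    case True
    have "app (A * B) v i = (\<Sum>j<k. (\<Sum>l<n. A $$ (i, l) * B $$ (l, j)) * v j)"
      using assms True by (auto simp: app_def scalar_prod_def atLeast0LessThan intro!: sum.cong)
    also have "\<dots> = (\<Sum>l<n. A $$ (i, l) * (\<Sum>j<k. B $$ (l, j) * v j))"
      by (simp add: sum_distrib_left sum_distrib_right mult.assoc) (rule sum.swap)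
    also have "\<dots> = app A (app B v) i"
      using assms True by (auto simp: app_def intro!: sum.cong)
    finally show ?thesis .
  qed (use assms in \<open>auto simp: app_def\<close>)
qed

lemma app_mat_add:
  assumes "A \<in> carrier_mat m n" "B \<in> carrier_mat m n"
  shows "app (A + B) v = (\<lambda>i. app A v i + app B v i)"
  using assms by (auto simp: app_def fun_eq_iff algebra_simps sum.distrib)

lemma app_mat_diff:
  assumes "A \<in> carrier_mat m n" "B \<in> carrier_mat m n"
  shows "app (A - B) v = (\<lambda>i. app A v i - app B v i)"
  using assms by (auto simp: app_def fun_eq_iff algebra_simps sum_subtractf)

lemma app_smult_mat: "app (c \<cdot>\<^sub>m A) v = (\<lambda>i. c * app A v i)"
  by (auto simp: app_def fun_eq_iff sum_distrib_left mult.assoc)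

lemma app_one: "i < n \<Longrightarrow> app (1\<^sub>m n) v i = v i"
proof -
  assume "i < n"
  then have "app (1\<^sub>m n) v i = (\<Sum>j<n. 1\<^sub>m n $$ (i, j) * v j)"
    by (simp add: app_def)
  also have "\<dots> = (\<Sum>j<n. if j = i then v j else 0)"
    by (rule sum.cong) (use \<open>i < n\<close> in auto)
  finally show ?thesis using \<open>i < n\<close> by simp
qed

lemma app_unit:
  assumes "k < dim_col M" "i < dim_row M"
  shows "app M (\<lambda>j. if j = k then 1 else 0) i = M $$ (i, k)"
proof -
  have "app M (\<lambda>j. if j = k then 1 else 0) i = (\<Sum>j<dim_col M. M $$ (i, j) * (if j = k then 1 else 0))"
    using assms by (simp add: app_def)
  also have "\<dots> = (\<Sum>j<dim_col M. if j = k then M $$ (i, j) else 0)"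
    by (rule sum.cong) auto
  finally show ?thesis using assms by simp
qed

lemma cip_unit_right: "k < n \<Longrightarrow> cip n v (\<lambda>j. if j = k then 1 else 0) = v k"
proof -
  assume "k < n"
  have "cip n v (\<lambda>j. if j = k then 1 else 0) = (\<Sum>i<n. if i = k then v i else 0)"
    unfolding cip_def by (intro sum.cong) auto
  then show ?thesis using \<open>k < n\<close> by simp
qed

lemma entry_eq_cip:
  assumes "M \<in> carrier_mat m n" "i < m" "j < n"
  shows "M $$ (i, j) = cip m (app M (\<lambda>l. if l = j then 1 else 0)) (\<lambda>l. if l = i then 1 else 0)"
  using assms by (simp add: cip_unit_right app_unit)

text \<open>Unit vectors for v and w recover the entries, so matrix identities reduce to identities
  of sesquilinear forms.\<close>

lemma mat_eqI_cip:
  assumes "M \<in> carrier_mat m n" "N \<in> carrier_mat m n"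
    and "\<And>v w. cip m (app M v) w = cip m (app N v) w"
  shows "M = N"
  by (rule eq_matI) (use assms in \<open>auto simp: entry_eq_cip[OF assms(1)] entry_eq_cip[OF assms(2)]\<close>)

section \<open>Adjoint, Hermitian and positive semidefinite matrices\<close>

lemma adjoint_carrier [simp]: "A \<in> carrier_mat m n \<Longrightarrow> mat_adjoint A \<in> carrier_mat n m"
  by (auto simp: mat_adjoint_def)

lemma dim_mat_adjoint [simp]:
  "dim_row (mat_adjoint A) = dim_col A" "dim_col (mat_adjoint A) = dim_row A"
  by (auto simp: mat_adjoint_def)

lemma adjoint_index:
  "i < dim_col A \<Longrightarrow> j < dim_row A \<Longrightarrow> mat_adjoint A $$ (i, j) = cnj (A $$ (j, i))"
  by (simp add: mat_adjoint_def mat_of_rows_def)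

lemma adjoint_adjoint [simp]: "mat_adjoint (mat_adjoint A) = (A :: complex mat)"
  by (rule eq_matI) (simp_all add: adjoint_index)

lemma cip_app:
  assumes "A \<in> carrier_mat m n"
  shows "cip m (app A v) w = (\<Sum>i<m. \<Sum>j<n. A $$ (i, j) * v j * cnj (w i))"
  using assms by (auto simp: cip_def app_def sum_distrib_right intro!: sum.cong)

lemma cip_app_adjoint:
  assumes "A \<in> carrier_mat m n"
  shows "cip m (app A v) w = cip n v (app (mat_adjoint A) w)"
proof -
  have "cip n v (app (mat_adjoint A) w) = (\<Sum>j<n. \<Sum>i<m. A $$ (i, j) * v j * cnj (w i))"
    using assms by (auto simp: cip_def app_def adjoint_index sum_distrib_left algebra_simps intro!: sum.cong)
  then show ?thesis by (simp add: cip_app[OF assms]) (rule sum.swap)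
qed

lemma cip_adjoint_app:
  assumes "A \<in> carrier_mat m n"
  shows "cip n (app (mat_adjoint A) v) w = cip m v (app A w)"
  using cip_app_adjoint[of "mat_adjoint A" n m] assms by simp

lemma adjoint_eqI:
  assumes "A \<in> carrier_mat m n" "B \<in> carrier_mat n m"
    and "\<And>v w. cip n (app B v) w = cip m v (app A w)"
  shows "mat_adjoint A = B"
  by (rule mat_eqI_cip[of _ n m]) (use assms in \<open>auto simp: cip_adjoint_app\<close>)

lemma adjoint_mult:
  fixes A B :: "complex mat"
  assumes A: "A \<in> carrier_mat m n" and B: "B \<in> carrier_mat n k"
  shows "mat_adjoint (A * B) = mat_adjoint B * mat_adjoint A"
proof (rule adjoint_eqI[of _ m k])
  fix v w
  have "cip k (app (mat_adjoint B * mat_adjoint A) v) w = cip k (app (mat_adjoint B) (app (mat_adjoint A) v)) w"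
    using A B by (simp add: app_mult[of _ k n _ m])
  then show "cip k (app (mat_adjoint B * mat_adjoint A) v) w = cip m v (app (A * B) w)"
    by (simp add: cip_adjoint_app[OF A] cip_adjoint_app[OF B] app_mult[OF A B])
qed (use A B in auto)

lemma hermitian_cip:
  assumes "hermitian_mat H" "H \<in> carrier_mat n n"
  shows "cip n (app H v) w = cip n v (app H w)"
  using cip_app_adjoint[OF assms(2)] assms(1) by (simp add: hermitian_mat_def)

lemma hermitianI:
  assumes "H \<in> carrier_mat n n" "\<And>v w. cip n (app H v) w = cip n v (app H w)"
  shows "hermitian_mat H"
  unfolding hermitian_mat_def using adjoint_eqI[OF assms(1,1)] assms by auto

lemma hermitian_cip_real:
  assumes "hermitian_mat H" "H \<in> carrier_mat n n"
  shows "cip n (app H v) v = complex_of_real (Re (cip n (app H v) v))"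
proof -
  have "cnj (cip n (app H v) v) = cip n (app H v) v"
    using hermitian_cip[OF assms, of v v] cip_commute[of n v "app H v"] by simp
  then show ?thesis by (simp add: complex_eq_iff)
qed

lemma cscalar_prod_eq_cip:
  assumes "A \<in> carrier_mat n n"
  shows "(A *\<^sub>v vec n v) \<bullet>c vec n v = cip n (app A v) v"
  using assms by (auto simp: cip_def app_def scalar_prod_def atLeast0LessThan intro!: sum.cong)

text \<open>\<open>vec n v\<close> runs through \<open>carrier_vec n\<close> as v runs through all
  functions, which carries the definition over to \<open>cip\<close>.\<close>

lemma psd_mat_iff:
  assumes "A \<in> carrier_mat n n"
  shows "psd_mat A \<longleftrightarrow> hermitian_mat A \<and> (\<forall>v. 0 \<le> Re (cip n (app A v) v))"
proof -
  have "(\<forall>v \<in> carrier_vec n. 0 \<le> Re ((A *\<^sub>v v) \<bullet>c v)) \<longleftrightarrow> (\<forall>v. 0 \<le> Re (cip n (app A v) v))"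
  proof safe
    fix v assume *: "\<forall>v \<in> carrier_vec n. 0 \<le> Re ((A *\<^sub>v v) \<bullet>c v)"
    show "0 \<le> Re (cip n (app A v) v)"
      using *[rule_format, of "vec n v"] by (simp add: cscalar_prod_eq_cip[OF assms])
  next
    fix v :: "complex vec"
    assume *: "\<forall>v. 0 \<le> Re (cip n (app A v) v)" and v: "v \<in> carrier_vec n"
    have "vec n (\<lambda>i. v $ i) = v" using v by auto
    then show "0 \<le> Re ((A *\<^sub>v v) \<bullet>c v)"
      using *[rule_format, of "\<lambda>i. v $ i"] cscalar_prod_eq_cip[OF assms, of "\<lambda>i. v $ i"] by simp
  qed
  then show ?thesis using assms by (simp add: psd_mat_def)
qed

section \<open>The spectral theorem\<close>

lemma cip_orthonormal_sum:
  fixes k :: nat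
  assumes "\<And>i. i < k \<Longrightarrow> cip n (e i) (e j) = (if i = j then 1 else 0)" "j < k"
  shows "cip n (\<lambda>l. \<Sum>i<k. c i * e i l) (e j) = c j"
proof -
  have "cip n (\<lambda>l. \<Sum>i<k. c i * e i l) (e j) = (\<Sum>i<k. c i * cip n (e i) (e j))"
    by (simp add: cip_sum_left cip_scale_left)
  also have "\<dots> = (\<Sum>i<k. if i = j then c i else 0)"
    by (rule sum.cong) (use assms in auto)
  finally show ?thesis using assms(2) by simp
qed

text \<open>Orthonormalising the columns of a Schur basis of a Hermitian matrix turns them into
  eigenvectors, and keeps the prescribed order of the eigenvalues.\<close>

lemma hermitian_orthonormal_eigenvectors:
  assumes H: "H \<in> carrier_mat n n" and herm: "hermitian_mat H"
    and cp: "char_poly H = (\<Prod>a\<leftarrow>es. [:- a, 1:])"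
  shows "\<exists>e. (\<forall>i<n. \<forall>j<n. cip n (e i) (e j) = (if i = j then 1 else 0)) \<and>
             (\<forall>i<n. app H (e i) = (\<lambda>l. es ! i * e i l))"
proof -
  obtain B P Q where schur: "schur_decomposition H es = (B, P, Q)"
    by (cases "schur_decomposition H es") auto
  from schur_decomposition[OF H cp schur]
  have sim: "similar_mat_wit H B P Q" and ut: "upper_triangular B" and diag: "diag_mat B = es"
    by auto
  note wit = similar_mat_witD2[OF H sim]
  have B: "B \<in> carrier_mat n n" and P: "P \<in> carrier_mat n n" and Q: "Q \<in> carrier_mat n n"
    and QP: "Q * P = 1\<^sub>m n" and HPBQ: "H = P * B * Q" using wit by auto
  have HP: "H * P = P * B"
  proof -
    have "H * P = P * B * (Q * P)" unfolding HPBQ using B P Q by (simp add: assoc_mult_mat[of _ n n _ n _ n])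
    then show ?thesis using B P QP by simp
  qed
  have Bdiag: "B $$ (i, i) = es ! i" if "i < n" for i
    using that B unfolding diag[symmetric] by (simp add: diag_mat_def)
  have QPv: "app Q (app P v) i = v i" if "i < n" for v i
    using app_mult[OF Q P, of v] app_one[OF that, of v] by (simp add: QP)
  \<comment> \<open>Gram-Schmidt on the columns of \<open>P\<close>, by induction on k. The
    \<open>d i\<close> are the coordinates of \<open>e i\<close> in these columns and vanish from k
    on; the last clause says that the \<open>e i\<close> span the first k columns.\<close>
  have "\<exists>e d. (\<forall>i<k. \<forall>j<k. cip n (e i) (e j) = (if i = j then 1 else 0)) \<and>
             (\<forall>i<k. app H (e i) = (\<lambda>l. es ! i * e i l)) \<and>
             (\<forall>i<k. e i = app P (d i) \<and> (\<forall>l\<ge>k. d i l = 0)) \<and>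
             (\<forall>g. (\<forall>l\<ge>k. g l = 0) \<longrightarrow> (\<exists>c. app P g = (\<lambda>l. \<Sum>i<k. c i * e i l)))"
    if "k \<le> n" for k
    using that
  proof (induction k)
    case 0
    have "app P g = (\<lambda>l. 0)" if "\<forall>l\<ge>0. g l = 0" for g
      using that by (simp add: app_def fun_eq_iff)
    then show ?case by simp
  next
    case (Suc k)
    then have k: "k < n" by simp
    from Suc.IH[OF less_imp_le[OF k]] obtain e d where IH:
      "\<forall>i<k. \<forall>j<k. cip n (e i) (e j) = (if i = j then 1 else 0)"
      "\<forall>i<k. app H (e i) = (\<lambda>l. es ! i * e i l)"
      "\<forall>i<k. e i = app P (d i) \<and> (\<forall>l\<ge>k. d i l = 0)"
      "\<forall>g. (\<forall>l\<ge>k. g l = 0) \<longrightarrow> (\<exists>c. app P g = (\<lambda>l. \<Sum>i<k. c i * e i l))"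
      by (elim exE conjE)
    have on: "cip n (e i) (e j) = (if i = j then 1 else 0)" if "i < k" "j < k" for i j
      using IH(1) that by simp
    have ev: "app H (e i) = (\<lambda>l. es ! i * e i l)" if "i < k" for i
      using IH(2) that by simp
    have ed: "e i = app P (d i)" if "i < k" for i
      using IH(3) that by simp
    have d0: "d i l = 0" if "i < k" "l \<ge> k" for i l
      using IH(3) that by simp
    have sp: "\<exists>c. app P g = (\<lambda>l. \<Sum>i<k. c i * e i l)" if "\<forall>l\<ge>k. g l = 0" for g
      using IH(4) that by simp
    define u :: "nat \<Rightarrow> complex" where "u = (\<lambda>j. if j = k then 1 else 0)"
    define c where "c i = cip n (app P u) (e i)" for i
    \<comment> \<open>Coordinates of column k of \<open>P\<close> minus its projection onto the
      earlier \<open>e i\<close>. The coordinate at k stays 1, so \<open>q\<close> below is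
      nonzero.\<close>
    define \<delta> where "\<delta> = (\<lambda>l. u l - (\<Sum>i<k. c i * d i l))"
    define q where "q = app P \<delta>"
    have \<delta>k: "\<delta> k = 1" by (simp add: \<delta>_def u_def d0)
    have \<delta>0: "\<delta> l = 0" if "l > k" for l using that by (simp add: \<delta>_def u_def d0)
    have q: "q = (\<lambda>l. app P u l - (\<Sum>i<k. c i * e i l))"
      by (simp add: q_def \<delta>_def app_diff app_sum app_scale ed)
    have qe: "cip n q (e j) = 0" if "j < k" for j
      using cip_orthonormal_sum[of k n e j c] on that
      by (simp add: q cip_diff_left c_def)
    have eq0: "cip n (e j) q = 0" if "j < k" for j
      using qe[OF that] cip_commute[of n "e j" q] by simp
    have Nne: "nsq n q \<noteq> 0"
    proof
      assume "nsq n q = 0"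
      then have "app Q q k = 0" using Q k by (simp add: nsq_eq_0_iff app_def)
      then show False using QPv[OF k, of \<delta>] \<delta>k by (simp add: q_def)
    qed
    define N where "N = complex_of_real (sqrt (nsq n q))"
    have N0: "N \<noteq> 0" using Nne by (simp add: N_def)
    have N2: "N * N = complex_of_real (nsq n q)" and cN: "cnj N = N"
      by (simp_all add: N_def flip: of_real_mult)
    \<comment> \<open>Coordinates of (H - es ! k) q, because H P = P B. As \<open>B\<close> is
      triangular they vanish from k on, so this vector lies in the span of the earlier
      \<open>e i\<close>.\<close>
    define g where "g = (\<lambda>l. if l < n then app B \<delta> l - es ! k * \<delta> l else 0)"
    have B\<delta>: "app B \<delta> l = (if l = k then es ! k else 0)" if "l \<ge> k" for l
    proof (cases "l < n")
      case True
      have "app B \<delta> l = (\<Sum>j<n. if j = k then B $$ (l, j) else 0)"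
      proof -
        have "B $$ (l, j) * \<delta> j = (if j = k then B $$ (l, j) else 0)" if "j < n" for j
          using ut \<open>l \<ge> k\<close> True B that \<delta>0[of j] \<delta>k
          by (cases j k rule: linorder_cases) (auto simp: upper_triangular_def)
        then show ?thesis using True B by (simp add: app_def)
      qed
      also have "\<dots> = B $$ (l, k)" using k by simp
      also have "\<dots> = (if l = k then es ! k else 0)"
        using ut \<open>l \<ge> k\<close> True B Bdiag by (auto simp: upper_triangular_def)
      finally show ?thesis .
    qed (use B k in \<open>auto simp: app_def\<close>)
    have g0: "g l = 0" if "l \<ge> k" for l
      using that B\<delta>[OF that] \<delta>k \<delta>0[of l] by (auto simp: g_def)
    have Hq: "app H q = app P (app B \<delta>)"
      using app_mult[OF H P, of \<delta>] app_mult[OF P B, of \<delta>] by (simp add: q_def HP)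
    have Pg: "app P g = (\<lambda>l. app H q l - es ! k * q l)"
    proof -
      have "app P g = app P (\<lambda>l. app B \<delta> l - es ! k * \<delta> l)"
        using P by (intro app_cong) (simp add: g_def)
      then show ?thesis unfolding Hq by (simp add: app_diff app_scale q_def)
    qed
    obtain c' where c': "app P g = (\<lambda>l. \<Sum>i<k. c' i * e i l)" using sp[of g] g0 by blast
    \<comment> \<open>The vector is also orthogonal to each earlier \<open>e j\<close>, since
      \<open>H\<close> is Hermitian and \<open>q\<close> is orthogonal to the eigenvector
      \<open>e j\<close>. Hence it is zero and \<open>q\<close> is an eigenvector.\<close>
    have "c' j = 0" if j: "j < k" for j
    proof -
      have "c' j = cip n (app P g) (e j)"
        unfolding c' using cip_orthonormal_sum[of k n e j c'] on j by simp
      also have "\<dots> = cip n (app H q) (e j)"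
        by (simp add: Pg cip_diff_left cip_scale_left qe[OF j])
      also have "\<dots> = 0"
        by (simp add: hermitian_cip[OF herm H] ev[OF j] cip_scale_right qe[OF j])
      finally show ?thesis .
    qed
    then have evq: "app H q = (\<lambda>l. es ! k * q l)"
      using Pg by (simp add: c' fun_eq_iff)
    define e' where "e' = e(k := (\<lambda>l. inverse N * q l))"
    define d' where "d' = d(k := (\<lambda>l. inverse N * \<delta> l))"
    have "\<forall>i<Suc k. \<forall>j<Suc k. cip n (e' i) (e' j) = (if i = j then 1 else 0)"
    proof -
      have "inverse N * (inverse N * cip n q q) = 1"
        using N0 by (simp add: cip_self field_simps flip: N2)
      moreover have "cip n (e' k) (e' k) = inverse N * (inverse N * cip n q q)"
        unfolding e'_def fun_upd_same cip_scale_left cip_scale_right complex_cnj_inverse cN ..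
      ultimately have "cip n (e' k) (e' k) = 1" by simp
      moreover have "cip n (e' k) (e i) = 0" "cip n (e i) (e' k) = 0" "e' i = e i" if "i < k" for i
        using that by (simp_all add: e'_def cip_scale_left cip_scale_right qe eq0)
      ultimately show ?thesis
        by (auto simp: less_Suc_eq on)
    qed
    moreover have "\<forall>i<Suc k. app H (e' i) = (\<lambda>l. es ! i * e' i l)"
      by (auto simp: e'_def less_Suc_eq ev evq app_scale)
    moreover have "\<forall>i<Suc k. e' i = app P (d' i) \<and> (\<forall>l\<ge>Suc k. d' i l = 0)"
      using \<delta>0 d0 by (auto simp: e'_def d'_def less_Suc_eq ed q_def app_scale)
    moreover have "\<exists>c. app P g = (\<lambda>l. \<Sum>i<Suc k. c i * e' i l)" if g: "\<forall>l\<ge>Suc k. g l = 0" for g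
    proof -
      \<comment> \<open>Subtracting the multiple \<open>g k\<close> of \<delta> clears coordinate k,
        so that the spanning clause for k applies.\<close>
      have "\<forall>l\<ge>k. g l - g k * \<delta> l = 0"
        using g \<delta>0 \<delta>k by (metis Suc_leI diff_self le_neq_implies_less mult.right_neutral mult_zero_right)
      from sp[of "\<lambda>l. g l - g k * \<delta> l", OF this] obtain c
        where c: "app P (\<lambda>l. g l - g k * \<delta> l) = (\<lambda>l. \<Sum>i<k. c i * e i l)" by blast
      have "app P g = (\<lambda>l. app P (\<lambda>l. g l - g k * \<delta> l) l + g k * q l)"
        by (simp add: app_diff app_scale q_def)
      also have "\<dots> = (\<lambda>l. \<Sum>i<Suc k. (c(k := g k * N)) i * e' i l)"
        using N0 by (auto simp: c e'_def fun_eq_iff)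
      finally show ?thesis by blast
    qed
    ultimately show ?case by blast
  qed
  from this[of n] show ?thesis by blast
qed

lemma hermitian_eigenvalue_real:
  assumes H: "H \<in> carrier_mat n n" and herm: "hermitian_mat H" and ev: "eigenvalue H a"
  shows "a \<in> \<real>"
proof -
  from ev obtain v where v: "v \<in> carrier_vec n" "v \<noteq> 0\<^sub>v n" "H *\<^sub>v v = a \<cdot>\<^sub>v v"
    using H by (auto simp: eigenvalue_def eigenvector_def)
  define w where "w = (\<lambda>i. v $ i)"
  have "app H w i = a * w i" if "i < n" for i
  proof -
    have "(H *\<^sub>v v) $ i = a * v $ i" using v that by simp
    then show ?thesis using v(1) H that
      by (simp add: app_def w_def scalar_prod_def atLeast0LessThan)
  qed
  then have "cip n (app H w) w = a * cip n w w"
    by (subst cip_scale_left[symmetric], intro cip_cong) auto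
  moreover have "nsq n w \<noteq> 0"
    using v by (auto simp: nsq_eq_0_iff w_def)
  ultimately have "a = complex_of_real (Re (cip n (app H w) w) / nsq n w)"
    using hermitian_cip_real[OF herm H, of w] by (simp add: cip_self field_simps)
  then show ?thesis by (metis Reals_of_real)
qed

text \<open>Indices start at 0, whereas \<open>eigval\<close> starts at 1; hence the
  \<open>Suc i\<close> in \<open>spectral_theorem\<close>. Being n orthonormal vectors in dimension
  n, the \<open>e i\<close> form a basis, as \<open>eigenframe_expand\<close> derives.\<close>

definition eigenframe :: "nat \<Rightarrow> complex mat \<Rightarrow> (nat \<Rightarrow> nat \<Rightarrow> complex) \<Rightarrow> (nat \<Rightarrow> real) \<Rightarrow> bool" where
  "eigenframe n H e ev \<longleftrightarrow>
     (\<forall>i<n. \<forall>j<n. cip n (e i) (e j) = (if i = j then 1 else 0)) \<and>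
     (\<forall>i<n. app H (e i) = (\<lambda>l. complex_of_real (ev i) * e i l)) \<and>
     (\<forall>i j. i \<le> j \<and> j < n \<longrightarrow> ev j \<le> ev i)"

lemma proots_linear_factors: "proots (\<Prod>a\<leftarrow>as. [:- a, 1 :: complex:]) = mset as"
proof (induction as)
  case (Cons a as)
  have "proots ([:- a, 1:] * (\<Prod>a\<leftarrow>as. [:- a, 1:])) = proots [:- a, 1:] + proots (\<Prod>a\<leftarrow>as. [:- a, 1:])"
    by (rule proots_mult) (auto simp: prod_list_zero_iff)
  also have "\<dots> = mset (a # as)"
    unfolding Cons.IH proots_linear_factor by simp
  finally show ?case by simp
qed simp

text \<open>The Schur basis is available for every ordering of the roots of the characteristic
  polynomial, in particular for the decreasing list behind \<open>eigval\<close>. The roots are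
  real, so that list is a permutation of them.\<close>

theorem spectral_theorem:
  assumes H: "H \<in> carrier_mat n n" and herm: "hermitian_mat H"
  shows "\<exists>e. eigenframe n H e (\<lambda>i. eigval (Suc i) H)"
proof -
  obtain as where as: "char_poly H = (\<Prod>a\<leftarrow>as. [:- a, 1:])" "length as = n"
    using char_poly_factorized[OF H] by blast
  have real: "a \<in> \<real>" if "a \<in> set as" for a
  proof -
    have "poly (char_poly H) a = 0"
      using that unfolding as by (simp add: poly_prod_list prod_list_zero_iff image_iff)
    then show ?thesis
      using hermitian_eigenvalue_real[OF H herm] eigenvalue_root_char_poly[OF H] by blast
  qed
  define rs where "rs = eigvals_desc H"
  have rs: "rs = rev (sort (map Re as))"
    unfolding rs_def eigvals_desc_def as(1) proots_linear_factors
    by (subst mset_map[symmetric]) (simp only: sorted_list_of_multiset_mset)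
  have "map complex_of_real (map Re as) = as"
    by (simp add: map_idI of_real_Re real)
  then have "image_mset complex_of_real (image_mset Re (mset as)) = mset as"
    by (metis mset_map)
  then have "mset (map complex_of_real rs) = mset as"
    by (simp only: rs mset_map mset_rev mset_sort)
  moreover have "(\<Prod>a\<leftarrow>xs. [:- a, 1:]) = (\<Prod>a\<leftarrow>ys. [:- a, 1:])"
    if "mset xs = mset ys" for xs ys :: "complex list"
    using that by (simp only: prod_mset_prod_list[symmetric] mset_map)
  ultimately have cp: "char_poly H = (\<Prod>a\<leftarrow>map complex_of_real rs. [:- a, 1:])"
    by (metis as(1))
  have len: "length rs = n" by (simp add: rs as(2))
  have "rs ! i = eigval (Suc i) H" for i by (simp add: rs_def eigval_def)
  moreover have "rs ! j \<le> rs ! i" if "i \<le> j" "j < n" for i j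
    using sorted_rev_nth_mono[of rs i j] that len by (simp add: rs)
  ultimately show ?thesis
    using hermitian_orthonormal_eigenvectors[OF H herm cp] len
    by (auto simp: eigenframe_def)
qed

section \<open>Expansion in an eigenbasis\<close>

lemma eigenframeD:
  assumes "eigenframe n H e ev"
  shows "i < n \<Longrightarrow> j < n \<Longrightarrow> cip n (e i) (e j) = (if i = j then 1 else 0)"
    and "i < n \<Longrightarrow> app H (e i) = (\<lambda>l. complex_of_real (ev i) * e i l)"
    and "i \<le> j \<Longrightarrow> j < n \<Longrightarrow> ev j \<le> ev i"
  using assms by (auto simp: eigenframe_def)

text \<open>The matrix U with columns \<open>e i\<close> satisfies U^* U = 1 by orthonormality, and
  a one-sided inverse of a square matrix is two-sided. The expansion is U U^* v = v.\<close>

lemma eigenframe_expand: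
  assumes E: "eigenframe n H e ev" and l: "l < n"
  shows "v l = (\<Sum>i<n. cip n v (e i) * e i l)"
proof -
  define U where "U = mat n n (\<lambda>(l, i). e i l)"
  have U: "U \<in> carrier_mat n n" by (simp add: U_def)
  have appU: "app U w l = (\<Sum>i<n. w i * e i l)" if "l < n" for w l
    using that by (simp add: app_def U_def mult.commute)
  have appV: "app (mat_adjoint U) w i = cip n w (e i)" if "i < n" for w i
    using that by (simp add: app_def U_def adjoint_index cip_def mult.commute)
  have "mat_adjoint U * U = 1\<^sub>m n"
  proof (rule mat_eqI_cip[of _ n n])
    fix v w
    have "app (mat_adjoint U * U) v i = app (1\<^sub>m n) v i" if i: "i < n" for i
    proof -
      have "app (mat_adjoint U * U) v i = cip n (app U v) (e i)"
        using U appV[OF i] app_mult[of "mat_adjoint U" n n U n v] by simp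
      also have "\<dots> = cip n (\<lambda>l. \<Sum>i<n. v i * e i l) (e i)"
        by (rule cip_cong) (simp_all add: appU)
      also have "\<dots> = v i"
        by (rule cip_orthonormal_sum) (use eigenframeD(1)[OF E] i in auto)
      finally show ?thesis using app_one[OF i, of v] by simp
    qed
    then show "cip n (app (mat_adjoint U * U) v) w = cip n (app (1\<^sub>m n) v) w"
      by (intro cip_cong) auto
  qed (use U in auto)
  then have UU: "U * mat_adjoint U = 1\<^sub>m n"
    using mat_mult_left_right_inverse[of "mat_adjoint U" n U] U by simp
  have "v l = app U (app (mat_adjoint U) v) l"
    using app_mult[of U n n "mat_adjoint U" n v] U UU app_one[OF l, of v] by simp
  also have "\<dots> = (\<Sum>i<n. cip n v (e i) * e i l)"
    using l by (simp add: appU appV)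
  finally show ?thesis .
qed

lemma eigenframe_cip:
  assumes E: "eigenframe n H e ev"
  shows "cip n v w = (\<Sum>i<n. cip n v (e i) * cnj (cip n w (e i)))"
proof -
  have "cip n v w = cip n (\<lambda>l. \<Sum>i<n. cip n v (e i) * e i l) w"
    by (rule cip_cong) (simp_all add: eigenframe_expand[OF E, of _ v, symmetric])
  also have "\<dots> = (\<Sum>i<n. cip n v (e i) * cip n (e i) w)"
    by (simp add: cip_sum_left cip_scale_left)
  also have "\<dots> = (\<Sum>i<n. cip n v (e i) * cnj (cip n w (e i)))"
    by (simp add: cip_commute[of n "e _" w])
  finally show ?thesis .
qed

lemma eigenframe_nsq:
  assumes E: "eigenframe n H e ev"
  shows "nsq n v = (\<Sum>i<n. (cmod (cip n v (e i)))\<^sup>2)"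
proof -
  have "complex_of_real (nsq n v) = complex_of_real (\<Sum>i<n. (cmod (cip n v (e i)))\<^sup>2)"
    using eigenframe_cip[OF E, of v v] by (simp add: cip_self complex_norm_square del: of_real_power)
  then show ?thesis by (simp only: of_real_eq_iff)
qed

lemma eigenframe_cip_app:
  assumes E: "eigenframe n H e ev" and H: "H \<in> carrier_mat n n" "hermitian_mat H" and i: "i < n"
  shows "cip n (app H v) (e i) = complex_of_real (ev i) * cip n v (e i)"
  by (simp add: hermitian_cip[OF H(2,1)] eigenframeD(2)[OF E i] cip_scale_right)

lemma eigenframe_form:
  assumes E: "eigenframe n H e ev" and H: "H \<in> carrier_mat n n" "hermitian_mat H"
  shows "cip n (app H v) w = (\<Sum>i<n. complex_of_real (ev i) * (cip n v (e i) * cnj (cip n w (e i))))"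
  by (subst eigenframe_cip[OF E], rule sum.cong) (simp_all add: eigenframe_cip_app[OF E H])

lemma eigenframe_quadratic:
  assumes E: "eigenframe n H e ev" and H: "H \<in> carrier_mat n n" "hermitian_mat H"
  shows "Re (cip n (app H v) v) = (\<Sum>i<n. ev i * (cmod (cip n v (e i)))\<^sup>2)"
proof -
  have "cip n (app H v) v = complex_of_real (\<Sum>i<n. ev i * (cmod (cip n v (e i)))\<^sup>2)"
    by (simp add: eigenframe_form[OF E H] complex_norm_square del: of_real_power)
  then show ?thesis by (simp only: Re_complex_of_real)
qed

lemma eigenframe_value:
  assumes E: "eigenframe n H e ev" and i: "i < n"
  shows "Re (cip n (app H (e i)) (e i)) = ev i"
  using eigenframeD(1)[OF E i i] by (simp add: eigenframeD(2)[OF E i] cip_scale_left)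

lemma eigenframe_nsq_vector:
  assumes "eigenframe n H e ev" and "i < n"
  shows "nsq n (e i) = 1"
  using eigenframeD(1)[OF assms(1) assms(2) assms(2)] by (simp add: cip_self)

text \<open>In an eigenbasis the form is a sum of eigenvalues with nonnegative weights, so a
  negative value forces a negative eigenvalue.\<close>

lemma negative_eigenvector:
  assumes H: "H \<in> carrier_mat n n" "hermitian_mat H" and v: "Re (cip n (app H v) v) < 0"
  obtains e \<mu> where "\<mu> < 0" "app H e = (\<lambda>l. complex_of_real \<mu> * e l)" "nsq n e = 1"
proof -
  obtain e where E: "eigenframe n H e (\<lambda>i. eigval (Suc i) H)" using spectral_theorem[OF H] by blast
  have "\<exists>i<n. eigval (Suc i) H < 0"
  proof (rule ccontr)
    assume neg: "\<not> ?thesis"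
    have "0 \<le> eigval (Suc i) H" if "i < n" for i
      using neg that not_less by blast
    then have "0 \<le> Re (cip n (app H v) v)"
      unfolding eigenframe_quadratic[OF E H] by (auto intro!: sum_nonneg mult_nonneg_nonneg)
    then show False using v by simp
  qed
  then show thesis
    using that eigenframeD(2)[OF E] eigenframe_nsq_vector[OF E] by blast
qed

lemma psd_hermitian: "psd_mat S \<Longrightarrow> hermitian_mat S"
  by (simp add: psd_mat_def)

lemma psd_nonneg:
  assumes "psd_mat S" "S \<in> carrier_mat n n"
  shows "0 \<le> Re (cip n (app S v) v)"
  using assms psd_mat_iff by blast

section \<open>Square roots\<close>

lemma psd_sqrt_exists:
  assumes S: "S \<in> carrier_mat n n" "psd_mat S"
  shows "\<exists>R. psd_mat R \<and> R * R = S"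
proof -
  note herm = psd_hermitian[OF S(2)]
  obtain e where E: "eigenframe n S e (\<lambda>i. eigval (Suc i) S)"
    using spectral_theorem[OF S(1) herm] by blast
  define s where "s i = sqrt (eigval (Suc i) S)" for i
  have s2: "s i * s i = eigval (Suc i) S" if "i < n" for i
    using psd_nonneg[OF S(2,1), of "e i"] eigenframe_value[OF E that] by (simp add: s_def)
  \<comment> \<open>The sum of s_i e_i e_i^*: the eigenvectors of \<open>S\<close> with the square
    roots of its eigenvalues.\<close>
  define R where "R = mat n n (\<lambda>(k, l). \<Sum>i<n. complex_of_real (s i) * e i k * cnj (e i l))"
  have R: "R \<in> carrier_mat n n" by (simp add: R_def)
  have appR: "app R v k = (\<Sum>i<n. complex_of_real (s i) * cip n v (e i) * e i k)" if "k < n" for v k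
  proof -
    have "app R v k = (\<Sum>l<n. \<Sum>i<n. complex_of_real (s i) * e i k * cnj (e i l) * v l)"
      using that by (simp add: app_def R_def sum_distrib_right)
    also have "\<dots> = (\<Sum>i<n. \<Sum>l<n. complex_of_real (s i) * e i k * cnj (e i l) * v l)"
      by (rule sum.swap)
    also have "\<dots> = (\<Sum>i<n. complex_of_real (s i) * cip n v (e i) * e i k)"
      by (rule sum.cong) (simp_all add: cip_def sum_distrib_left sum_distrib_right algebra_simps)
    finally show ?thesis .
  qed
  have cR: "cip n (app R v) (e i) = complex_of_real (s i) * cip n v (e i)" if "i < n" for v i
  proof -
    have "cip n (app R v) (e i) = cip n (\<lambda>k. \<Sum>i<n. complex_of_real (s i) * cip n v (e i) * e i k) (e i)"
      by (rule cip_cong) (simp_all add: appR)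
    also have "\<dots> = complex_of_real (s i) * cip n v (e i)"
      by (rule cip_orthonormal_sum) (use eigenframeD(1)[OF E] that in auto)
    finally show ?thesis .
  qed
  have form: "cip n (app R v) w = (\<Sum>i<n. complex_of_real (s i) * (cip n v (e i) * cnj (cip n w (e i))))" for v w
    by (subst eigenframe_cip[OF E], rule sum.cong) (simp_all add: cR)
  have "R * R = S"
  proof (rule mat_eqI_cip[of _ n n])
    fix v w
    have "cip n (app R (app R v)) w
      = (\<Sum>i<n. complex_of_real (eigval (Suc i) S) * (cip n v (e i) * cnj (cip n w (e i))))"
      unfolding form[of "app R v" w] by (rule sum.cong) (simp_all add: cR flip: s2)
    then show "cip n (app (R * R) v) w = cip n (app S v) w"
      by (simp add: app_mult[OF R R] eigenframe_form[OF E S(1) herm])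
  qed (use R S in auto)
  moreover have "hermitian_mat R"
  proof (rule hermitianI[OF R])
    fix v w
    show "cip n (app R v) w = cip n v (app R w)"
      by (subst cip_commute[of n v "app R w"]) (simp add: form algebra_simps)
  qed
  moreover have "0 \<le> Re (cip n (app R v) v)" for v
  proof -
    have "cip n (app R v) v = complex_of_real (\<Sum>i<n. s i * (cmod (cip n v (e i)))\<^sup>2)"
      by (simp add: form complex_norm_square del: of_real_power)
    then have "Re (cip n (app R v) v) = (\<Sum>i<n. s i * (cmod (cip n v (e i)))\<^sup>2)"
      by (simp only: Re_complex_of_real)
    moreover have "0 \<le> s i" if "i < n" for i
      using psd_nonneg[OF S(2,1), of "e i"] eigenframe_value[OF E that] by (simp add: s_def)
    ultimately show ?thesis by (auto intro!: sum_nonneg mult_nonneg_nonneg)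
  qed
  ultimately show ?thesis using psd_mat_iff[OF R] by blast
qed

text \<open>Let e be a unit eigenvector of D = R - R' with eigenvalue d. From R R = R' R' one gets d
  times the sum of the forms of \<open>R\<close> and \<open>R'\<close> at e equal to 0, while their
  difference is d. Both forms are nonnegative, so d = 0, and a Hermitian matrix with all eigenvalues
  0 vanishes.\<close>

lemma psd_sqrt_unique:
  assumes R: "R \<in> carrier_mat n n" "psd_mat R" and R': "R' \<in> carrier_mat n n" "psd_mat R'"
    and eq: "R * R = R' * R'"
  shows "R = R'"
proof -
  define D where "D = R - R'"
  have D: "D \<in> carrier_mat n n" unfolding D_def by (rule minus_carrier_mat[OF R'(1)])
  have appD: "app D v = (\<lambda>i. app R v i - app R' v i)" for v
    unfolding D_def by (rule app_mat_diff) (use R R' in auto)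
  note hR = hermitian_cip[OF psd_hermitian[OF R(2)] R(1)]
  note hR' = hermitian_cip[OF psd_hermitian[OF R'(2)] R'(1)]
  have hD: "hermitian_mat D"
    by (rule hermitianI[OF D]) (simp add: appD cip_simps hR hR')
  obtain e where E: "eigenframe n D e (\<lambda>i. eigval (Suc i) D)" using spectral_theorem[OF D hD] by blast
  have zero: "eigval (Suc i) D = 0" if i: "i < n" for i
  proof -
    define d where "d = complex_of_real (eigval (Suc i) D)"
    have De: "app R (e i) = (\<lambda>l. app R' (e i) l + d * e i l)"
      using eigenframeD(2)[OF E i] by (simp add: appD fun_eq_iff d_def diff_eq_eq add.commute)
    have "cip n (app R (e i)) (app R (e i)) = cip n (app R' (e i)) (app R' (e i))"
      using arg_cong[OF eq, of "\<lambda>M. cip n (app M (e i)) (e i)"]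
      by (simp add: app_mult[OF R(1) R(1)] app_mult[OF R'(1) R'(1)] hR hR')
    moreover have "cip n (app R (e i)) (app R (e i))
       = cip n (app R' (e i)) (app R' (e i)) + d * cip n (e i) (app R' (e i)) + cnj d * cip n (app R (e i)) (e i)"
      unfolding De by (simp add: cip_simps algebra_simps)
    ultimately have "d * (cip n (app R' (e i)) (e i) + cip n (app R (e i)) (e i)) = 0"
      by (simp add: d_def hR' algebra_simps)
    moreover have "cip n (app R (e i)) (e i) - cip n (app R' (e i)) (e i) = d"
      using eigenframeD(1)[OF E i i] by (simp add: De cip_simps)
    ultimately have "d = 0 \<or> (cip n (app R' (e i)) (e i) + cip n (app R (e i)) (e i) = 0
       \<and> cip n (app R (e i)) (e i) - cip n (app R' (e i)) (e i) = d)" by simp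
    moreover have "Re d = 0" if "cip n (app R' (e i)) (e i) + cip n (app R (e i)) (e i) = 0"
       "cip n (app R (e i)) (e i) - cip n (app R' (e i)) (e i) = d"
      using that psd_nonneg[OF R(2,1), of "e i"] psd_nonneg[OF R'(2,1), of "e i"]
      by (auto simp: complex_eq_iff)
    ultimately show ?thesis by (auto simp: d_def)
  qed
  show ?thesis
  proof (rule mat_eqI_cip[OF R(1) R'(1)])
    fix v w
    have "cip n (app D v) w = 0"
      by (simp add: eigenframe_form[OF E D hD] zero)
    then show "cip n (app R v) w = cip n (app R' v) w" by (simp add: appD cip_simps)
  qed
qed

lemma mat_sqrt:
  assumes S: "S \<in> carrier_mat n n" "psd_mat S"
  shows "mat_sqrt S \<in> carrier_mat n n" "psd_mat (mat_sqrt S)" "mat_sqrt S * mat_sqrt S = S"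
proof -
  have car: "R \<in> carrier_mat n n" if "psd_mat R" "R * R = S" for R
    using that S(1) by (intro carrier_matI) (auto simp: psd_mat_def hermitian_mat_def)
  obtain R where R: "psd_mat R" "R * R = S" using psd_sqrt_exists[OF S] by blast
  have "\<exists>!R. psd_mat R \<and> R * R = S"
    by (rule ex1I[of _ R]) (use R psd_sqrt_unique car in blast)+
  then have "psd_mat (mat_sqrt S) \<and> mat_sqrt S * mat_sqrt S = S"
    unfolding mat_sqrt_def by (rule theI')
  then show "psd_mat (mat_sqrt S)" "mat_sqrt S * mat_sqrt S = S" "mat_sqrt S \<in> carrier_mat n n"
    using car by auto
qed

lemma mat_inverse_injective:
  assumes R: "R \<in> carrier_mat n n" and inj: "\<And>v. (\<And>i. i < n \<Longrightarrow> app R v i = 0) \<Longrightarrow> nsq n v = 0"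
  shows "the (mat_inverse R) \<in> carrier_mat n n" "R * the (mat_inverse R) = 1\<^sub>m n"
    "the (mat_inverse R) * R = 1\<^sub>m n"
proof -
  have "det R \<noteq> 0"
  proof
    assume "det R = 0"
    then obtain v where v: "v \<in> carrier_vec n" "v \<noteq> 0\<^sub>v n" "R *\<^sub>v v = 0\<^sub>v n"
      using det_0_iff_vec_prod_zero[OF R] by blast
    have "app R (\<lambda>i. v $ i) i = 0" if "i < n" for i
    proof -
      have "(R *\<^sub>v v) $ i = 0" using v that by simp
      then show ?thesis using v(1) R that by (simp add: app_def scalar_prod_def atLeast0LessThan)
    qed
    from inj[OF this] have "v = 0\<^sub>v n" using v(1) by (auto simp: nsq_eq_0_iff)
    then show False using v by simp
  qed
  then have "R \<in> Units (ring_mat TYPE(complex) n ())" by (rule det_non_zero_imp_unit[OF R])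
  then obtain R' where "mat_inverse R = Some R'"
    using mat_inverse(1)[OF R, of "()"] by (cases "mat_inverse R") auto
  then show "the (mat_inverse R) \<in> carrier_mat n n" "R * the (mat_inverse R) = 1\<^sub>m n"
    "the (mat_inverse R) * R = 1\<^sub>m n"
    using mat_inverse(2)[OF R] by auto
qed

section \<open>Positive semidefinite block matrices\<close>

text \<open>The quadratic form of \<open>four_block_mat A X (mat_adjoint X) C\<close> at the stacked
  vector (v, w), written out so that later arguments stay in dimension n.\<close>

definition block_psd :: "nat \<Rightarrow> complex mat \<Rightarrow> complex mat \<Rightarrow> complex mat \<Rightarrow> bool" where
  "block_psd n A X C \<longleftrightarrow>
     (\<forall>v w. 0 \<le> Re (cip n (app A v) v) + 2 * Re (cip n (app X w) v) + Re (cip n (app C w) w))"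

lemma block_psdD:
  "block_psd n A X C \<Longrightarrow>
     0 \<le> Re (cip n (app A v) v) + 2 * Re (cip n (app X w) v) + Re (cip n (app C w) w)"
  by (simp add: block_psd_def)

lemma block_psd_diag:
  assumes "block_psd n A X C"
  shows "0 \<le> Re (cip n (app A v) v)" "0 \<le> Re (cip n (app C v) v)"
  using block_psdD[OF assms, of v "\<lambda>i. 0"] block_psdD[OF assms, of "\<lambda>i. 0" v]
  by (simp_all add: app_simps cip_simps)

lemma nsq_diff: "nsq n (\<lambda>i. v i - w i) = nsq n v - 2 * Re (cip n v w) + nsq n w"
  using nsq_add[of n v "\<lambda>i. - w i"] nsq_scale[of n "-1" w] by (simp add: cip_simps)

lemma sum_lessThan_add: "(\<Sum>i<n + k. f i) = (\<Sum>i<n. f i) + (\<Sum>i<k. f (n + i))"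
  for f :: "nat \<Rightarrow> 'a::comm_monoid_add"
  by (induction k) (simp_all add: add.assoc)

lemma cip_split: "cip (n + k) e f = cip n e f + cip k (\<lambda>i. e (n + i)) (\<lambda>i. f (n + i))"
  by (simp add: cip_def sum_lessThan_add)

lemma nsq_split: "nsq (n + k) e = nsq n e + nsq k (\<lambda>i. e (n + i))"
  by (simp add: nsq_def sum_lessThan_add)

lemma app_four_block:
  assumes "A \<in> carrier_mat n n" "X \<in> carrier_mat n n" "Y \<in> carrier_mat n n" "C \<in> carrier_mat n n"
  shows "i < n \<Longrightarrow> app (four_block_mat A X Y C) e i = app A e i + app X (\<lambda>j. e (n + j)) i"
    and "i < n \<Longrightarrow> app (four_block_mat A X Y C) e (n + i) = app Y e i + app C (\<lambda>j. e (n + j)) i"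
  using assms by (simp_all add: app_def sum_lessThan_add)

lemma four_block_form:
  assumes "A \<in> carrier_mat n n" "X \<in> carrier_mat n n" "Y \<in> carrier_mat n n" "C \<in> carrier_mat n n"
  shows "cip (n + n) (app (four_block_mat A X Y C) e) f =
    cip n (app A e) f + cip n (app X (\<lambda>j. e (n + j))) f
    + cip n (app Y e) (\<lambda>j. f (n + j)) + cip n (app C (\<lambda>j. e (n + j))) (\<lambda>j. f (n + j))"
proof -
  let ?M = "four_block_mat A X Y C"
  have "cip n (app ?M e) f = cip n (\<lambda>i. app A e i + app X (\<lambda>j. e (n + j)) i) f"
    by (rule cip_cong) (simp_all add: app_four_block[OF assms])
  moreover have "cip n (\<lambda>i. app ?M e (n + i)) (\<lambda>i. f (n + i))
    = cip n (\<lambda>i. app Y e i + app C (\<lambda>j. e (n + j)) i) (\<lambda>i. f (n + i))"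
    by (rule cip_cong) (simp_all add: app_four_block[OF assms])
  ultimately show ?thesis by (simp add: cip_split cip_add_left)
qed

lemma four_block_quadratic:
  assumes "A \<in> carrier_mat n n" "X \<in> carrier_mat n n" "C \<in> carrier_mat n n"
  shows "Re (cip (n + n) (app (four_block_mat A X (mat_adjoint X) C) e) e) =
    Re (cip n (app A e) e) + 2 * Re (cip n (app X (\<lambda>j. e (n + j))) e)
    + Re (cip n (app C (\<lambda>j. e (n + j))) (\<lambda>j. e (n + j)))"
  using assms
  by (simp add: four_block_form[where n = n] cip_adjoint_app[where m = n] Re_cip_commute[of n e])

lemma four_block_hermitian:
  assumes "A \<in> carrier_mat n n" "X \<in> carrier_mat n n" "C \<in> carrier_mat n n"
    and "hermitian_mat A" "hermitian_mat C"
  shows "hermitian_mat (four_block_mat A X (mat_adjoint X) C)"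
proof (rule hermitianI[of _ "n + n"])
  fix v w
  let ?M = "four_block_mat A X (mat_adjoint X) C"
  have "cip (n + n) v (app ?M w) = cnj (cip (n + n) (app ?M w) v)" by (rule cip_commute)
  also have "\<dots> = cip n v (app A w) + cip n v (app X (\<lambda>j. w (n + j)))
    + cip n (\<lambda>j. v (n + j)) (app (mat_adjoint X) w) + cip n (\<lambda>j. v (n + j)) (app C (\<lambda>j. w (n + j)))"
    using assms by (simp add: four_block_form[where n = n] cip_commute[symmetric])
  also have "\<dots> = cip (n + n) (app ?M v) w"
    using assms by (simp add: four_block_form[where n = n] hermitian_cip[where n = n]
        cip_app_adjoint[OF assms(2)] cip_adjoint_app[OF assms(2)])
  finally show "cip (n + n) (app ?M v) w = cip (n + n) v (app ?M w)" by simp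
qed (use assms in auto)

lemma psd_four_blockD:
  assumes car: "A \<in> carrier_mat n n" "X \<in> carrier_mat n n" "C \<in> carrier_mat n n"
    and psd: "psd_mat (four_block_mat A X (mat_adjoint X) C)"
  shows "hermitian_mat A" "hermitian_mat C" "block_psd n A X C"
proof -
  let ?M = "four_block_mat A X (mat_adjoint X) C"
  have M: "?M \<in> carrier_mat (n + n) (n + n)" using car by auto
  note form = four_block_form[OF car(1,2) adjoint_carrier[OF car(2)] car(3)]
  have herm: "cip (n + n) (app ?M v) w = cip (n + n) v (app ?M w)" for v w
    by (rule hermitian_cip[OF psd_hermitian[OF psd] M])
  have herm': "cip (n + n) (app ?M v) w = cnj (cip (n + n) (app ?M w) v)" for v w
    by (simp add: herm[of v w] cip_commute[of "n + n" v])
  \<comment> \<open>The stacked vectors (v, 0) and (0, v); testing the large matrix on them isolates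
    its diagonal blocks.\<close>
  define lo :: "(nat \<Rightarrow> complex) \<Rightarrow> nat \<Rightarrow> complex" where "lo v i = (if i < n then v i else 0)" for v i
  define hi :: "(nat \<Rightarrow> complex) \<Rightarrow> nat \<Rightarrow> complex" where "hi v i = (if i < n then 0 else v (i - n))" for v i
  have app_lo: "app N (lo v) = app N v" "app N (hi v) = (\<lambda>i. 0)" if "N \<in> carrier_mat n n" for N v
    using that app_zero[of N] by (auto simp: app_def lo_def hi_def fun_eq_iff)
  have cip_lo: "cip n u (lo v) = cip n u v" "cip n u (hi v) = 0" for u v
    by (simp_all add: cip_def lo_def hi_def)
  have shift: "(\<lambda>j. lo v (n + j)) = (\<lambda>j. 0)" "(\<lambda>j. hi v (n + j)) = v" for v
    by (simp_all add: lo_def hi_def fun_eq_iff)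
  note [simp] = form app_lo cip_lo shift app_zero cip_zero_left cip_zero_right
  show "hermitian_mat A"
  proof (rule hermitianI[OF car(1)])
    fix v w
    show "cip n (app A v) w = cip n v (app A w)"
      using herm'[of "lo v" "lo w"] car by (simp add: cip_commute[symmetric])
  qed
  show "hermitian_mat C"
  proof (rule hermitianI[OF car(3)])
    fix v w
    show "cip n (app C v) w = cip n v (app C w)"
      using herm'[of "hi v" "hi w"] car by (simp add: cip_commute[symmetric])
  qed
  show "block_psd n A X C"
    unfolding block_psd_def
  proof (intro allI)
    fix v w
    define e where "e = (\<lambda>i. lo v i + hi w i)"
    have e: "app N e = app N v" if "N \<in> carrier_mat n n" for N
      using that by (auto simp: app_def e_def lo_def hi_def fun_eq_iff)
    have e2: "cip n u e = cip n u v" for u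
      by (auto simp: cip_def e_def lo_def hi_def)
    have e3: "(\<lambda>j. e (n + j)) = w" by (simp add: e_def lo_def hi_def fun_eq_iff)
    show "0 \<le> Re (cip n (app A v) v) + 2 * Re (cip n (app X w) v) + Re (cip n (app C w) w)"
      using psd_nonneg[OF psd M, of e] car by (simp only: four_block_quadratic[OF car] e e2 e3)
  qed
qed

section \<open>The geometric mean of positive definite matrices\<close>

text \<open>The operator-theoretic core: an eigenvector of the block matrix for a negative eigenvalue
  would contradict the two domination hypotheses.\<close>

lemma dominated_block_psd:
  assumes D: "D \<in> carrier_mat n n" "psd_mat D" and Y: "Y \<in> carrier_mat n n"
    and dom: "\<And>w. nsq n (app Y w) \<le> nsq n (app D w)"
      "\<And>w. nsq n (app (mat_adjoint Y) w) \<le> nsq n (app D w)"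
  shows "block_psd n D Y D"
proof (rule ccontr)
  let ?K = "four_block_mat D Y (mat_adjoint Y) D"
  have K: "?K \<in> carrier_mat (n + n) (n + n)" "hermitian_mat ?K"
    using D Y four_block_hermitian[OF D(1) Y D(1)] psd_hermitian[OF D(2)] by auto
  assume "\<not> block_psd n D Y D"
  then have "\<not> psd_mat ?K" using psd_four_blockD(3)[OF D(1) Y D(1)] by blast
  then obtain v where "Re (cip (n + n) (app ?K v) v) < 0"
    using psd_mat_iff[OF K(1)] K(2) not_less by blast
  from negative_eigenvector[OF K this] obtain e \<mu> where \<mu>: "\<mu> < 0"
    and e: "app ?K e = (\<lambda>l. complex_of_real \<mu> * e l)" and e1: "nsq (n + n) e = 1" .
  define f where "f = (\<lambda>j. e (n + j))"
  note blk = app_four_block[OF D(1) Y adjoint_carrier[OF Y] D(1), of _ e, folded f_def, unfolded e]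
  \<comment> \<open>The two rows of the eigenvalue equation for the stacked vector (e, f).\<close>
  have Yf: "app Y f i = complex_of_real \<mu> * e i - app D e i" if "i < n" for i
    using blk(1)[OF that] by simp
  have Ye: "app (mat_adjoint Y) e i = complex_of_real \<mu> * f i - app D f i" if "i < n" for i
    using blk(2)[OF that] by (simp add: f_def)
  have expand: "nsq n (\<lambda>i. complex_of_real \<mu> * v i - app D v i)
      = \<mu>\<^sup>2 * nsq n v - 2 * \<mu> * Re (cip n (app D v) v) + nsq n (app D v)" for v
    by (simp add: nsq_diff nsq_scale cip_simps Re_cip_commute[of n v])
  have "nsq n (app Y f) = nsq n (\<lambda>i. complex_of_real \<mu> * e i - app D e i)"
    using Yf by (simp add: nsq_def)
  moreover have "nsq n (app (mat_adjoint Y) e) = nsq n (\<lambda>i. complex_of_real \<mu> * f i - app D f i)"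
    using Ye by (simp add: nsq_def)
  \<comment> \<open>The domination at f bounds the first row and the one at e the second, so the
    squared norms of D e and D f cancel in the sum. The remaining mixed terms are nonnegative
    because \<mu> < 0, which leaves \<mu> squared at most 0.\<close>
  ultimately have "\<mu>\<^sup>2 * nsq n e - 2 * \<mu> * Re (cip n (app D e) e) + \<mu>\<^sup>2 * nsq n f
      - 2 * \<mu> * Re (cip n (app D f) f) \<le> 0"
    using dom(1)[of f] dom(2)[of e] unfolding expand by linarith
  moreover have "nsq n e + nsq n f = 1" using e1 by (simp add: nsq_split f_def)
  then have "\<mu>\<^sup>2 * nsq n e + \<mu>\<^sup>2 * nsq n f = \<mu>\<^sup>2"
    by (metis distrib_left mult.right_neutral)
  moreover have "0 \<le> - \<mu> * Re (cip n (app D v) v)" for v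
    using psd_nonneg[OF D(2,1)] \<mu> by (intro mult_nonneg_nonneg) auto
  from this[of e] this[of f] have "0 \<le> - (\<mu> * Re (cip n (app D e) e))" "0 \<le> - (\<mu> * Re (cip n (app D f) f))"
    by auto
  moreover have "0 < \<mu>\<^sup>2" using \<mu> by simp
  ultimately show False by (simp add: algebra_simps)
qed

text \<open>The lower bound \<delta> expresses positive definiteness of \<open>S\<close> in the form
  that adding a positive multiple of the identity supplies. It makes the square root of
  \<open>S\<close> invertible.\<close>

locale pos_def_pair =
  fixes n :: nat and S T :: "complex mat" and \<delta> :: real
  assumes S: "S \<in> carrier_mat n n" "psd_mat S" and T: "T \<in> carrier_mat n n" "psd_mat T"
    and \<delta>: "0 < \<delta>" "\<And>v. \<delta> * nsq n v \<le> Re (cip n (app S v) v)"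
begin

definition "R = mat_sqrt S"
definition "R' = the (mat_inverse R)"
definition "D = mat_sqrt (R' * T * R')"

abbreviation "G \<equiv> geom_mean_pd S T"

lemma R: "R \<in> carrier_mat n n" "psd_mat R" "R * R = S"
  using mat_sqrt[OF S] by (simp_all add: R_def)

lemmas R_herm = hermitian_cip[OF psd_hermitian[OF R(2)] R(1)]

lemma app_S: "app S v = app R (app R v)"
  using app_mult[OF R(1) R(1), of v] by (simp add: R(3))

lemma R': "R' \<in> carrier_mat n n" "R * R' = 1\<^sub>m n" "R' * R = 1\<^sub>m n"
proof -
  have "nsq n v = 0" if "\<And>i. i < n \<Longrightarrow> app R v i = 0" for v
  proof -
    have "cip n (app S v) v = cip n (app R v) (app R v)" by (simp add: app_S R_herm)
    also have "\<dots> = 0" by (simp add: cip_def that)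
    finally have "\<delta> * nsq n v \<le> 0" using \<delta>(2)[of v] by simp
    then show ?thesis using \<delta>(1) nsq_nonneg[of n v] by (simp add: mult_le_0_iff)
  qed
  from mat_inverse_injective[OF R(1) this]
  show "R' \<in> carrier_mat n n" "R * R' = 1\<^sub>m n" "R' * R = 1\<^sub>m n" by (simp_all add: R'_def)
qed

lemma RR': "i < n \<Longrightarrow> app R (app R' v) i = v i" and R'R: "i < n \<Longrightarrow> app R' (app R v) i = v i"
  using app_mult[OF R(1) R'(1), of v] app_mult[OF R'(1) R(1), of v] app_one[of i n v]
  by (simp_all add: R'(2,3))

lemma cip_RR': "cip n (app R (app R' v)) w = cip n v w" "cip n w (app R (app R' v)) = cip n w v"
  by (rule cip_cong; simp add: RR')+

lemma R'_herm: "cip n (app R' v) w = cip n v (app R' w)"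
proof -
  have "cip n (app R' v) w = cip n (app R' v) (app R (app R' w))" by (simp add: cip_RR')
  also have "\<dots> = cip n v (app R' w)" by (simp add: R_herm[symmetric] cip_RR')
  finally show ?thesis .
qed

lemmas T_herm = hermitian_cip[OF psd_hermitian[OF T(2)] T(1)]

lemma D: "D \<in> carrier_mat n n" "psd_mat D" "D * D = R' * T * R'"
proof -
  have M: "R' * T * R' \<in> carrier_mat n n" using R' T by auto
  have app_M: "app (R' * T * R') v = app R' (app T (app R' v))" for v
    using app_mult[of "R' * T" n n R' n v] app_mult[of R' n n T n] R' T by simp
  have "hermitian_mat (R' * T * R')"
    by (rule hermitianI[OF M]) (simp add: app_M R'_herm T_herm)
  then have "psd_mat (R' * T * R')"
    using psd_nonneg[OF T(2,1)] by (simp add: psd_mat_iff[OF M] app_M R'_herm)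
  then show "D \<in> carrier_mat n n" "psd_mat D" "D * D = R' * T * R'"
    using mat_sqrt[OF M] by (simp_all add: D_def)
qed

lemmas D_herm = hermitian_cip[OF psd_hermitian[OF D(2)] D(1)]

lemma nsq_D: "nsq n (app D w) = Re (cip n (app T (app R' w)) (app R' w))"
proof -
  have "nsq n (app D w) = Re (cip n (app D (app D w)) w)" by (simp add: D_herm[of "app D w"])
  also have "app D (app D w) = app R' (app T (app R' w))"
    using app_mult[OF D(1) D(1), of w] app_mult[of "R' * T" n n R' n w] app_mult[of R' n n T n] R' T
    by (simp add: D(3))
  finally show ?thesis by (simp add: R'_herm)
qed

lemma G_eq: "G = R * D * R"
  by (simp add: geom_mean_pd_def Let_def R_def R'_def D_def)

lemma G_carrier: "G \<in> carrier_mat n n"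
  using R D by (simp add: G_eq)

lemma app_G: "app G v = app R (app D (app R v))"
  using app_mult[of "R * D" n n R n v] app_mult[OF R(1) D(1)] R D by (simp add: G_eq)

lemma G_psd: "psd_mat G"
proof -
  have "hermitian_mat G"
    by (rule hermitianI[OF G_carrier]) (simp add: app_G R_herm D_herm)
  then show ?thesis
    using psd_nonneg[OF D(2,1)] by (simp add: psd_mat_iff[OF G_carrier] app_G R_herm)
qed

lemma nsq_D_R: "nsq n (app D (app R w)) = Re (cip n (app T w) w)"
proof -
  have "app T (app R' (app R w)) = app T w" using T by (intro app_cong) (simp add: R'R)
  moreover have "cip n (app T w) (app R' (app R w)) = cip n (app T w) w" by (rule cip_cong) (simp_all add: R'R)
  ultimately show ?thesis by (simp add: nsq_D)
qed

text \<open>The block form at (v, w) is the squared norm of R v + D R w.\<close>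

lemma block_psd_geom_mean: "block_psd n S G T"
  unfolding block_psd_def
proof (intro allI)
  fix v w
  have "Re (cip n (app S v) v) = nsq n (app R v)" by (simp add: app_S R_herm[of "app R v"])
  moreover have "Re (cip n (app G w) v) = Re (cip n (app R v) (app D (app R w)))"
    by (simp add: app_G R_herm Re_cip_commute)
  moreover have "0 \<le> nsq n (\<lambda>i. app R v i + app D (app R w) i)" by simp
  ultimately show "0 \<le> Re (cip n (app S v) v) + 2 * Re (cip n (app G w) v) + Re (cip n (app T w) w)"
    by (simp add: nsq_add nsq_D_R)
qed

text \<open>With y = R' Y R' w, the block form at (- R' y, R' w) has the three terms |y|^2, - 2
  |y|^2 and |D w|^2.\<close>

lemma block_psd_dominated:
  assumes Y: "Y \<in> carrier_mat n n" and blk: "block_psd n S Y T"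
  shows "nsq n (app R' (app Y (app R' w))) \<le> nsq n (app D w)"
proof -
  define y where "y = app R' (app Y (app R' w))"
  have "0 \<le> Re (cip n (app S (\<lambda>i. - app R' y i)) (\<lambda>i. - app R' y i))
      + 2 * Re (cip n (app Y (app R' w)) (\<lambda>i. - app R' y i)) + Re (cip n (app T (app R' w)) (app R' w))"
    by (rule block_psdD[OF blk])
  moreover have "cip n (app S (app R' y)) (app R' y) = cip n y y"
    by (simp only: app_S R_herm[of "app R (app R' y)"] cip_RR')
  moreover have "cip n (app Y (app R' w)) (app R' y) = cip n y y"
    by (simp add: y_def R'_herm)
  ultimately show ?thesis by (simp add: app_minus cip_simps nsq_D flip: y_def)
qed

text \<open>Congruence by \<open>R'\<close> replaces \<open>S\<close> by the identity and turns the
  two hypotheses into the domination of R' Y R' and of its adjoint by \<open>D\<close>.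
  \<open>dominated_block_psd\<close> then applies, and congruence by \<open>R\<close> leads back to
  \<open>G\<close> and \<open>Y\<close>.\<close>

lemma block_psd_geom_mean_of_ppt:
  assumes Y: "Y \<in> carrier_mat n n" and blk: "block_psd n S Y T" "block_psd n S (mat_adjoint Y) T"
  shows "block_psd n G Y G"
proof -
  define Y' where "Y' = R' * Y * R'"
  have Y': "Y' \<in> carrier_mat n n" using R' Y by (simp add: Y'_def)
  have app_Y': "app Y' v = app R' (app Y (app R' v))" for v
    using app_mult[of "R' * Y" n n R' n v] app_mult[of R' n n Y n] R' Y by (simp add: Y'_def)
  have app_adj: "app (mat_adjoint Y') v i = app R' (app (mat_adjoint Y) (app R' v)) i" for v i
  proof -
    have "mat_adjoint R' = R'" by (rule adjoint_eqI[OF R'(1,1)]) (rule R'_herm)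
    then have "mat_adjoint Y' = R' * (mat_adjoint Y * R')"
      using R' Y adjoint_mult[of "R' * Y" n n R' n] adjoint_mult[of R' n n Y n] by (simp add: Y'_def)
    then show ?thesis
      using mult_carrier_mat[OF adjoint_carrier[OF Y] R'(1)]
        app_mult[of R' n n "mat_adjoint Y * R'" n v] app_mult[of "mat_adjoint Y" n n R' n] R' Y by simp
  qed
  have core: "block_psd n D Y' D"
  proof (rule dominated_block_psd[OF D(1,2) Y'])
    show "nsq n (app Y' w) \<le> nsq n (app D w)" for w
      using block_psd_dominated[OF Y blk(1)] by (simp add: app_Y')
    show "nsq n (app (mat_adjoint Y') w) \<le> nsq n (app D w)" for w
      using block_psd_dominated[OF adjoint_carrier[OF Y] blk(2), of w]
      by (simp add: nsq_def app_adj)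
  qed
  show ?thesis
    unfolding block_psd_def
  proof (intro allI)
    fix v w
    have "app Y (app R' (app R w)) = app Y w" using Y by (intro app_cong) (simp add: R'R)
    then have "cip n (app Y' (app R w)) (app R v) = cip n (app Y w) (app R' (app R v))"
      by (simp add: app_Y' R'_herm)
    also have "\<dots> = cip n (app Y w) v" by (rule cip_cong) (simp_all add: R'R)
    finally show "0 \<le> Re (cip n (app G v) v) + 2 * Re (cip n (app Y w) v) + Re (cip n (app G w) w)"
      using block_psdD[OF core, of "app R v" "app R w"] by (simp add: app_G R_herm)
  qed
qed

end

section \<open>The geometric mean of positive semidefinite matrices\<close>

text \<open>The limit is the infimum of the values at positive arguments.\<close>

lemma mono_at_right_0_converges:
  fixes f :: "real \<Rightarrow> real"
  assumes mono: "\<And>x y. 0 < x \<Longrightarrow> x \<le> y \<Longrightarrow> f x \<le> f y" and bdd: "\<And>x. 0 < x \<Longrightarrow> B \<le> f x"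
  shows "\<exists>L. (f \<longlongrightarrow> L) (at_right 0)"
proof
  let ?L = "Inf (f ` {0<..})"
  have bd: "bdd_below (f ` {0<..})" using bdd by (auto intro!: bdd_belowI[of _ B])
  show "(f \<longlongrightarrow> ?L) (at_right 0)"
  proof (rule order_tendstoI)
    fix a assume a: "a < ?L"
    have lb: "?L \<le> f x" if "0 < x" for x
      using cInf_lower[OF _ bd, of "f x"] that by simp
    have "a < f x" if "0 < x" for x
      using a lb[OF that] by linarith
    then show "\<forall>\<^sub>F x in at_right 0. a < f x"
      by (rule eventually_mono[OF eventually_at_right_less[of 0]])
  next
    fix a assume "?L < a"
    then obtain y where y: "0 < y" "f y < a"
      using cInf_lessD[of "f ` {0<..}" a] by auto
    then have "f x < a" if "0 < x" "x < y" for x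
      using mono[of x y] that by linarith
    then show "\<forall>\<^sub>F x in at_right 0. f x < a"
      unfolding eventually_at_right_field using y(1) by blast
  qed
qed

text \<open>Polarization carries convergence of the real quadratic form, where monotonicity is
  available, over to all entries.\<close>

lemma hermitian_polarization:
  assumes G: "G \<in> carrier_mat n n" "hermitian_mat G"
  defines "q v \<equiv> Re (cip n (app G v) v)"
  shows "cip n (app G w) v = Complex ((q (\<lambda>i. v i + w i) - q v - q w) / 2)
    (- (q (\<lambda>i. v i + \<i> * w i) - q v - q w) / 2)"
proof -
  let ?c = "cip n (app G w) v"
  have c: "cip n (app G v) w = cnj ?c"
    using hermitian_cip[OF G(2,1), of v w] cip_commute[of n v "app G w"] by simp
  have "q (\<lambda>i. v i + w i) = q v + q w + 2 * Re ?c"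
    by (simp add: q_def app_simps cip_add_left cip_add_right c)
  moreover have "q (\<lambda>i. v i + \<i> * w i) = q v + q w - 2 * Im ?c"
    by (simp add: q_def app_simps cip_add_left cip_add_right cip_scale_left cip_scale_right c)
  ultimately show ?thesis by (simp add: complex_eq_iff)
qed

lemma tendsto_polarized:
  assumes "(a \<longlongrightarrow> A) F" "(b \<longlongrightarrow> B) F" "(c \<longlongrightarrow> C) F" "(d \<longlongrightarrow> D) F"
  shows "((\<lambda>x. Complex ((a x - b x - c x) / 2) (- (d x - b x - c x) / 2)) \<longlongrightarrow>
    Complex ((A - B - C) / 2) (- (D - B - C) / 2)) F"
  by (intro tendsto_intros assms) simp_all

locale psd_pair =
  fixes n :: nat and S T :: "complex mat"
  assumes S: "S \<in> carrier_mat n n" "psd_mat S" and T: "T \<in> carrier_mat n n" "psd_mat T"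
begin

abbreviation shift :: "complex mat \<Rightarrow> real \<Rightarrow> complex mat" where
  "shift M \<epsilon> \<equiv> M + complex_of_real \<epsilon> \<cdot>\<^sub>m 1\<^sub>m n"

abbreviation G\<^sub>\<epsilon> :: "real \<Rightarrow> complex mat" where
  "G\<^sub>\<epsilon> \<epsilon> \<equiv> geom_mean_pd (shift S \<epsilon>) (shift T \<epsilon>)"

abbreviation "G \<equiv> geom_mean S T"

lemma cip_shift:
  assumes "M \<in> carrier_mat n n"
  shows "cip n (app (shift M \<epsilon>) v) w = cip n (app M v) w + complex_of_real \<epsilon> * cip n v w"
proof -
  have "app (shift M \<epsilon>) v i = app M v i + complex_of_real \<epsilon> * v i" if "i < n" for i
    using app_mat_add[of M n n "complex_of_real \<epsilon> \<cdot>\<^sub>m 1\<^sub>m n" v] assms app_one[OF that, of v]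
    by (simp add: app_smult_mat)
  then have "cip n (app (shift M \<epsilon>) v) w = cip n (\<lambda>i. app M v i + complex_of_real \<epsilon> * v i) w"
    by (intro cip_cong) auto
  then show ?thesis by (simp add: cip_simps)
qed

lemma shift_psd:
  assumes M: "M \<in> carrier_mat n n" "psd_mat M" and "0 < \<epsilon>"
  shows "shift M \<epsilon> \<in> carrier_mat n n" "psd_mat (shift M \<epsilon>)"
    "\<epsilon> * nsq n v \<le> Re (cip n (app (shift M \<epsilon>) v) v)"
proof -
  show car: "shift M \<epsilon> \<in> carrier_mat n n" using M by simp
  show lower: "\<epsilon> * nsq n v \<le> Re (cip n (app (shift M \<epsilon>) v) v)" for v
    using psd_nonneg[OF M(2,1), of v] by (simp add: cip_shift[OF M(1)])
  have "hermitian_mat (shift M \<epsilon>)"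
    by (rule hermitianI[OF car], subst cip_commute[of n _ "app _ _"])
      (simp add: cip_shift[OF M(1)] hermitian_cip[OF psd_hermitian[OF M(2)] M(1)] cip_commute[symmetric])
  moreover have "0 \<le> Re (cip n (app (shift M \<epsilon>) v) v)" for v
    using lower[of v] \<open>0 < \<epsilon>\<close> by (meson less_imp_le mult_nonneg_nonneg nsq_nonneg order_trans)
  ultimately show "psd_mat (shift M \<epsilon>)" using psd_mat_iff[OF car] by blast
qed

lemma pos_def_pair_shift: "0 < \<epsilon> \<Longrightarrow> pos_def_pair n (shift S \<epsilon>) (shift T \<epsilon>) \<epsilon>"
  by unfold_locales (use shift_psd[OF S] shift_psd[OF T] in auto)

lemmas G\<^sub>\<epsilon>_carrier = pos_def_pair.G_carrier[OF pos_def_pair_shift]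
lemmas G\<^sub>\<epsilon>_psd = pos_def_pair.G_psd[OF pos_def_pair_shift]
lemmas G\<^sub>\<epsilon>_hermitian = psd_hermitian[OF G\<^sub>\<epsilon>_psd]

lemma block_psd_shift:
  assumes "block_psd n (shift S \<epsilon>) Y (shift T \<epsilon>)" "\<epsilon> \<le> \<epsilon>'"
  shows "block_psd n (shift S \<epsilon>') Y (shift T \<epsilon>')"
  unfolding block_psd_def
proof (intro allI)
  fix v w
  have "\<epsilon> * nsq n v \<le> \<epsilon>' * nsq n v" "\<epsilon> * nsq n w \<le> \<epsilon>' * nsq n w"
    using assms(2) by (simp_all add: mult_right_mono)
  then show "0 \<le> Re (cip n (app (shift S \<epsilon>') v) v) + 2 * Re (cip n (app Y w) v)
      + Re (cip n (app (shift T \<epsilon>') w) w)"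
    using block_psdD[OF assms(1), of v w] by (simp add: cip_shift[OF S(1)] cip_shift[OF T(1)])
qed

lemma block_psd_shift_0:
  assumes "block_psd n S Y T" "0 \<le> \<epsilon>"
  shows "block_psd n (shift S \<epsilon>) Y (shift T \<epsilon>)"
  unfolding block_psd_def
proof (intro allI)
  fix v w
  have "0 \<le> \<epsilon> * nsq n v" "0 \<le> \<epsilon> * nsq n w" using assms(2) by simp_all
  then show "0 \<le> Re (cip n (app (shift S \<epsilon>) v) v) + 2 * Re (cip n (app Y w) v)
      + Re (cip n (app (shift T \<epsilon>) w) w)"
    using block_psdD[OF assms(1), of v w] by (simp add: cip_shift[OF S(1)] cip_shift[OF T(1)])
qed

lemma block_psd_le:
  assumes "block_psd n H Y H"
  shows "Re (cip n (app Y v) v) \<le> Re (cip n (app H v) v)"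
  using block_psdD[OF assms, of v "\<lambda>i. - v i"] by (simp add: app_minus cip_simps)

text \<open>Enlarging the diagonal blocks keeps the block with off-diagonal
  \<open>G\<^sub>\<epsilon> \<epsilon>\<close> positive. As this matrix is Hermitian, both
  conditions of the preceding locale coincide, and the mean at \<epsilon>' dominates it.\<close>

lemma G\<^sub>\<epsilon>_mono:
  assumes "0 < \<epsilon>" "\<epsilon> \<le> \<epsilon>'"
  shows "Re (cip n (app (G\<^sub>\<epsilon> \<epsilon>) v) v) \<le> Re (cip n (app (G\<^sub>\<epsilon> \<epsilon>') v) v)"
proof -
  have "block_psd n (shift S \<epsilon>') (G\<^sub>\<epsilon> \<epsilon>) (shift T \<epsilon>')"
    using pos_def_pair.block_psd_geom_mean[OF pos_def_pair_shift[OF assms(1)]] assms(2)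
    by (rule block_psd_shift)
  moreover have "mat_adjoint (G\<^sub>\<epsilon> \<epsilon>) = G\<^sub>\<epsilon> \<epsilon>"
    using G\<^sub>\<epsilon>_hermitian[OF assms(1)] by (simp add: hermitian_mat_def)
  ultimately have "block_psd n (G\<^sub>\<epsilon> \<epsilon>') (G\<^sub>\<epsilon> \<epsilon>) (G\<^sub>\<epsilon> \<epsilon>')"
    using assms by (intro pos_def_pair.block_psd_geom_mean_of_ppt[OF pos_def_pair_shift G\<^sub>\<epsilon>_carrier]) auto
  then show ?thesis by (rule block_psd_le)
qed

text \<open>Each quadratic form decreases as \<epsilon> decreases and is bounded below by 0;
  polarization gives the sesquilinear form.\<close>

lemma G\<^sub>\<epsilon>_form_converges: "\<exists>L. ((\<lambda>\<epsilon>. cip n (app (G\<^sub>\<epsilon> \<epsilon>) v) w) \<longlongrightarrow> L) (at_right 0)"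
proof -
  let ?q = "\<lambda>\<epsilon> v. Re (cip n (app (G\<^sub>\<epsilon> \<epsilon>) v) v)"
  have "\<forall>v. \<exists>L. ((\<lambda>\<epsilon>. ?q \<epsilon> v) \<longlongrightarrow> L) (at_right 0)"
  proof (rule allI, rule mono_at_right_0_converges[where B = 0])
    fix v
    show "?q x v \<le> ?q y v" if "0 < x" "x \<le> y" for x y
      using that by (rule G\<^sub>\<epsilon>_mono)
    show "0 \<le> ?q x v" if "0 < x" for x
      using that by (intro psd_nonneg G\<^sub>\<epsilon>_psd G\<^sub>\<epsilon>_carrier)
  qed
  from choice[OF this] obtain q where q: "\<forall>v. ((\<lambda>\<epsilon>. ?q \<epsilon> v) \<longlongrightarrow> q v) (at_right 0)" ..
  let ?c = "\<lambda>\<epsilon>. Complex ((?q \<epsilon> (\<lambda>i. w i + v i) - ?q \<epsilon> w - ?q \<epsilon> v) / 2)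
    (- (?q \<epsilon> (\<lambda>i. w i + \<i> * v i) - ?q \<epsilon> w - ?q \<epsilon> v) / 2)"
  have "(?c \<longlongrightarrow> Complex ((q (\<lambda>i. w i + v i) - q w - q v) / 2)
      (- (q (\<lambda>i. w i + \<i> * v i) - q w - q v) / 2)) (at_right 0)"
    by (rule tendsto_polarized[OF spec[OF q, of "\<lambda>i. w i + v i"] spec[OF q, of w] spec[OF q, of v]
          spec[OF q, of "\<lambda>i. w i + \<i> * v i"]])
  moreover have "\<forall>\<^sub>F \<epsilon> in at_right 0. ?c \<epsilon> = cip n (app (G\<^sub>\<epsilon> \<epsilon>) v) w"
    by (rule eventually_mono[OF eventually_at_right_less[of 0]])
      (rule hermitian_polarization[OF G\<^sub>\<epsilon>_carrier G\<^sub>\<epsilon>_hermitian, symmetric])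
  ultimately have "((\<lambda>\<epsilon>. cip n (app (G\<^sub>\<epsilon> \<epsilon>) v) w) \<longlongrightarrow> Complex ((q (\<lambda>i. w i + v i) - q w - q v) / 2)
      (- (q (\<lambda>i. w i + \<i> * v i) - q w - q v) / 2)) (at_right 0)"
    by (rule Lim_transform_eventually)
  then show ?thesis by (rule exI)
qed

lemma G_carrier: "G \<in> carrier_mat n n"
  using S by (simp add: geom_mean_def Let_def)

text \<open>Forms at unit vectors show that each \<open>Lim\<close> in \<open>geom_mean\<close> is
  an actual limit; finite sums over the entries then give every form.\<close>

lemma G\<^sub>\<epsilon>_form_tendsto: "((\<lambda>\<epsilon>. cip n (app (G\<^sub>\<epsilon> \<epsilon>) v) w) \<longlongrightarrow> cip n (app G v) w) (at_right 0)"
proof -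
  have entry: "((\<lambda>\<epsilon>. G\<^sub>\<epsilon> \<epsilon> $$ (i, j)) \<longlongrightarrow> G $$ (i, j)) (at_right 0)" if ij: "i < n" "j < n" for i j
  proof -
    obtain L where L: "((\<lambda>\<epsilon>. cip n (app (G\<^sub>\<epsilon> \<epsilon>) (\<lambda>l. if l = j then 1 else 0))
        (\<lambda>l. if l = i then 1 else 0)) \<longlongrightarrow> L) (at_right 0)"
      using G\<^sub>\<epsilon>_form_converges by blast
    have "((\<lambda>\<epsilon>. G\<^sub>\<epsilon> \<epsilon> $$ (i, j)) \<longlongrightarrow> L) (at_right 0)"
      by (rule Lim_transform_eventually[OF L], rule eventually_mono[OF eventually_at_right_less[of 0]])
        (use ij in \<open>simp add: entry_eq_cip[OF G\<^sub>\<epsilon>_carrier]\<close>)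
    moreover from this have "G $$ (i, j) = L"
      using ij S(1) by (simp add: geom_mean_def Let_def tendsto_Lim trivial_limit_at_right_real)
    ultimately show ?thesis by simp
  qed
  have "((\<lambda>\<epsilon>. \<Sum>i<n. \<Sum>j<n. G\<^sub>\<epsilon> \<epsilon> $$ (i, j) * v j * cnj (w i)) \<longlongrightarrow> cip n (app G v) w) (at_right 0)"
    unfolding cip_app[OF G_carrier] by (intro tendsto_intros entry) auto
  then show ?thesis
    by (rule Lim_transform_eventually)
      (rule eventually_mono[OF eventually_at_right_less[of 0]], simp add: cip_app[OF G\<^sub>\<epsilon>_carrier])
qed

lemma G_psd: "psd_mat G"
proof -
  have "hermitian_mat G"
  proof (rule hermitianI[OF G_carrier])
    fix v w
    have "((\<lambda>\<epsilon>. cnj (cip n (app (G\<^sub>\<epsilon> \<epsilon>) w) v)) \<longlongrightarrow> cnj (cip n (app G w) v)) (at_right 0)"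
      by (intro tendsto_intros G\<^sub>\<epsilon>_form_tendsto)
    then have "((\<lambda>\<epsilon>. cip n (app (G\<^sub>\<epsilon> \<epsilon>) v) w) \<longlongrightarrow> cnj (cip n (app G w) v)) (at_right 0)"
      by (rule Lim_transform_eventually)
        (rule eventually_mono[OF eventually_at_right_less[of 0]],
          simp add: hermitian_cip[OF G\<^sub>\<epsilon>_hermitian G\<^sub>\<epsilon>_carrier] flip: cip_commute)
    then have "cip n (app G v) w = cnj (cip n (app G w) v)"
      by (rule tendsto_unique[OF trivial_limit_at_right_real G\<^sub>\<epsilon>_form_tendsto])
    then show "cip n (app G v) w = cip n v (app G w)" by (simp flip: cip_commute)
  qed
  moreover have "0 \<le> Re (cip n (app G v) v)" for v
  proof (rule tendsto_lowerbound[OF _ _ trivial_limit_at_right_real])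
    show "((\<lambda>\<epsilon>. Re (cip n (app (G\<^sub>\<epsilon> \<epsilon>) v) v)) \<longlongrightarrow> Re (cip n (app G v) v)) (at_right 0)"
      by (intro tendsto_intros G\<^sub>\<epsilon>_form_tendsto)
    show "\<forall>\<^sub>F \<epsilon> in at_right 0. 0 \<le> Re (cip n (app (G\<^sub>\<epsilon> \<epsilon>) v) v)"
      by (rule eventually_mono[OF eventually_at_right_less[of 0]])
        (rule psd_nonneg[OF G\<^sub>\<epsilon>_psd G\<^sub>\<epsilon>_carrier])
  qed
  ultimately show ?thesis using psd_mat_iff[OF G_carrier] by blast
qed

text \<open>Limit of the positive definite case, in which the added terms \<epsilon> |v|^2 and
  \<epsilon> |w|^2 tend to 0.\<close>

lemma block_psd_geom_mean: "block_psd n S G T"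
  unfolding block_psd_def
proof (intro allI)
  fix v w
  show "0 \<le> Re (cip n (app S v) v) + 2 * Re (cip n (app G w) v) + Re (cip n (app T w) w)"
  proof (rule tendsto_lowerbound[OF _ _ trivial_limit_at_right_real])
    have "((\<lambda>\<epsilon>. Re (cip n (app S v) v) + \<epsilon> * nsq n v + 2 * Re (cip n (app (G\<^sub>\<epsilon> \<epsilon>) w) v)
        + (Re (cip n (app T w) w) + \<epsilon> * nsq n w)) \<longlongrightarrow>
        Re (cip n (app S v) v) + 0 * nsq n v + 2 * Re (cip n (app G w) v)
        + (Re (cip n (app T w) w) + 0 * nsq n w)) (at_right 0)"
      by (intro tendsto_intros G\<^sub>\<epsilon>_form_tendsto)
    then show "((\<lambda>\<epsilon>. Re (cip n (app S v) v) + \<epsilon> * nsq n v + 2 * Re (cip n (app (G\<^sub>\<epsilon> \<epsilon>) w) v)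
        + (Re (cip n (app T w) w) + \<epsilon> * nsq n w)) \<longlongrightarrow>
        Re (cip n (app S v) v) + 2 * Re (cip n (app G w) v) + Re (cip n (app T w) w)) (at_right 0)"
      by simp
    show "\<forall>\<^sub>F \<epsilon> in at_right 0. 0 \<le> Re (cip n (app S v) v) + \<epsilon> * nsq n v
        + 2 * Re (cip n (app (G\<^sub>\<epsilon> \<epsilon>) w) v) + (Re (cip n (app T w) w) + \<epsilon> * nsq n w)"
    proof (rule eventually_mono[OF eventually_at_right_less[of 0]])
      fix \<epsilon> :: real assume "0 < \<epsilon>"
      from block_psdD[OF pos_def_pair.block_psd_geom_mean[OF pos_def_pair_shift[OF this]], of v w]
      show "0 \<le> Re (cip n (app S v) v) + \<epsilon> * nsq n v
          + 2 * Re (cip n (app (G\<^sub>\<epsilon> \<epsilon>) w) v) + (Re (cip n (app T w) w) + \<epsilon> * nsq n w)"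
        by (simp add: cip_shift[OF S(1)] cip_shift[OF T(1)])
    qed
  qed
qed

text \<open>The hypotheses persist when \<epsilon> is added on the diagonal, so the positive
  definite case holds for every \<epsilon> > 0 and passes to the limit.\<close>

lemma block_psd_geom_mean_of_ppt:
  assumes Y: "Y \<in> carrier_mat n n" and blk: "block_psd n S Y T" "block_psd n S (mat_adjoint Y) T"
  shows "block_psd n G Y G"
  unfolding block_psd_def
proof (intro allI)
  fix v w
  show "0 \<le> Re (cip n (app G v) v) + 2 * Re (cip n (app Y w) v) + Re (cip n (app G w) w)"
  proof (rule tendsto_lowerbound[OF _ _ trivial_limit_at_right_real])
    show "((\<lambda>\<epsilon>. Re (cip n (app (G\<^sub>\<epsilon> \<epsilon>) v) v) + 2 * Re (cip n (app Y w) v)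
        + Re (cip n (app (G\<^sub>\<epsilon> \<epsilon>) w) w)) \<longlongrightarrow>
        Re (cip n (app G v) v) + 2 * Re (cip n (app Y w) v) + Re (cip n (app G w) w)) (at_right 0)"
      by (intro tendsto_intros G\<^sub>\<epsilon>_form_tendsto)
    show "\<forall>\<^sub>F \<epsilon> in at_right 0. 0 \<le> Re (cip n (app (G\<^sub>\<epsilon> \<epsilon>) v) v) + 2 * Re (cip n (app Y w) v)
        + Re (cip n (app (G\<^sub>\<epsilon> \<epsilon>) w) w)"
    proof (rule eventually_mono[OF eventually_at_right_less[of 0]])
      fix \<epsilon> :: real assume \<epsilon>: "0 < \<epsilon>"
      have "block_psd n (G\<^sub>\<epsilon> \<epsilon>) Y (G\<^sub>\<epsilon> \<epsilon>)"
        using \<epsilon> by (intro pos_def_pair.block_psd_geom_mean_of_ppt[OF pos_def_pair_shift Y] block_psd_shift_0 blk) auto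
      then show "0 \<le> Re (cip n (app (G\<^sub>\<epsilon> \<epsilon>) v) v) + 2 * Re (cip n (app Y w) v)
          + Re (cip n (app (G\<^sub>\<epsilon> \<epsilon>) w) w)" by (rule block_psdD)
    qed
  qed
qed

text \<open>For Hermitian \<open>Y\<close> the two block conditions are the same; the resulting
  block with diagonal \<open>G\<close> is tested at (v, - v).\<close>

lemma geom_mean_maximal:
  assumes "Y \<in> carrier_mat n n" "hermitian_mat Y" "block_psd n S Y T"
  shows "Re (cip n (app Y v) v) \<le> Re (cip n (app G v) v)"
  by (rule block_psd_le, rule block_psd_geom_mean_of_ppt) (use assms in \<open>auto simp: hermitian_mat_def\<close>)

end

section \<open>Inequalities for pairs of vectors\<close>

text \<open>\<open>wedge n a b\<close> is the squared norm of \<open>a \<and> b\<close>, and \<open>tensor_nsq n m a x b y\<close> below is the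
  squared norm of \<open>a \<otimes> x + b \<otimes> y\<close>.\<close>

definition wedge :: "nat \<Rightarrow> (nat \<Rightarrow> complex) \<Rightarrow> (nat \<Rightarrow> complex) \<Rightarrow> real" where
  "wedge n a b = nsq n a * nsq n b - (cmod (cip n a b))\<^sup>2"

text \<open>The weights \<mu> serve twice: as 1 for \<open>wedge\<close> itself and as the
  eigenvalues of P^* P for the image under \<open>P\<close>.\<close>

lemma Lagrange_identity:
  fixes \<mu> :: "nat \<Rightarrow> real" and \<alpha> \<beta> :: "nat \<Rightarrow> complex"
  shows "(\<Sum>i<n. \<Sum>j<n. \<mu> i * \<mu> j * (cmod (\<alpha> i * \<beta> j - \<alpha> j * \<beta> i))\<^sup>2) =
    2 * ((\<Sum>i<n. \<mu> i * (cmod (\<alpha> i))\<^sup>2) * (\<Sum>i<n. \<mu> i * (cmod (\<beta> i))\<^sup>2)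
      - (cmod (\<Sum>i<n. complex_of_real (\<mu> i) * (\<alpha> i * cnj (\<beta> i))))\<^sup>2)"
proof -
  let ?a = "\<lambda>i. \<mu> i * (cmod (\<alpha> i))\<^sup>2" and ?b = "\<lambda>i. \<mu> i * (cmod (\<beta> i))\<^sup>2"
  let ?c = "\<lambda>i. complex_of_real (\<mu> i) * (\<alpha> i * cnj (\<beta> i))"
  have cm: "(cmod z)\<^sup>2 = Re (z * cnj z)" for z
    by (simp add: complex_norm_square[symmetric] del: of_real_power)
  have summand: "\<mu> i * \<mu> j * (cmod (\<alpha> i * \<beta> j - \<alpha> j * \<beta> i))\<^sup>2
      = ?a i * ?b j + ?b i * ?a j - 2 * Re (?c i * cnj (?c j))" for i j
    unfolding cmod_power2 by (simp add: power2_eq_square algebra_simps)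
  have "(\<Sum>i<n. \<Sum>j<n. ?c i * cnj (?c j)) = (\<Sum>i<n. ?c i) * cnj (\<Sum>i<n. ?c i)"
    by (simp add: sum_product)
  then have "(\<Sum>i<n. \<Sum>j<n. Re (?c i * cnj (?c j))) = (cmod (\<Sum>i<n. ?c i))\<^sup>2"
    by (simp only: cm Re_sum[symmetric])
  moreover have "(\<Sum>i<n. \<Sum>j<n. ?a i * ?b j) = (\<Sum>i<n. ?a i) * (\<Sum>i<n. ?b i)"
    "(\<Sum>i<n. \<Sum>j<n. ?b i * ?a j) = (\<Sum>i<n. ?b i) * (\<Sum>i<n. ?a i)"
    by (rule sum_product[symmetric])+
  moreover have "(\<Sum>i<n. \<Sum>j<n. ?a i * ?b j + ?b i * ?a j - 2 * Re (?c i * cnj (?c j)))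
     = (\<Sum>i<n. \<Sum>j<n. ?a i * ?b j) + (\<Sum>i<n. \<Sum>j<n. ?b i * ?a j)
       - 2 * (\<Sum>i<n. \<Sum>j<n. Re (?c i * cnj (?c j)))"
    by (simp only: sum.distrib sum_subtractf sum_distrib_left)
  ultimately show ?thesis unfolding summand by simp
qed

lemma wedge_sum:
  "(\<Sum>i<n. \<Sum>j<n. (cmod (a i * b j - a j * b i))\<^sup>2) = 2 * wedge n a b"
  using Lagrange_identity[of "\<lambda>_. 1" a b n] by (simp add: wedge_def nsq_def cip_def)

lemma wedge_nonneg: "0 \<le> wedge n a b"
  using cip_Cauchy_Schwarz[of n a b] by (simp add: wedge_def)

text \<open>By the Cauchy-Binet formula the determinant is the inner product of f \<and> g and x
  \<and> y, to which Cauchy-Schwarz applies. Summing over all ordered pairs counts everything twice,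
  hence the factors 2.\<close>

lemma cip_det_bound:
  "(cmod (cip n f x * cip n g y - cip n f y * cip n g x))\<^sup>2 \<le> wedge n f g * wedge n x y"
proof -
  let ?I = "{..<n} \<times> {..<n}"
  let ?F = "\<lambda>(i, j). f i * g j - f j * g i" and ?X = "\<lambda>(i, j). x i * y j - x j * y i"
  have "(\<Sum>i<n. \<Sum>j<n. (f i * g j - f j * g i) * cnj (x i * y j - x j * y i))
      = (\<Sum>i<n. \<Sum>j<n. (f i * cnj (x i)) * (g j * cnj (y j)) + (g i * cnj (y i)) * (f j * cnj (x j))
         - ((f i * cnj (y i)) * (g j * cnj (x j)) + (g i * cnj (x i)) * (f j * cnj (y j))))"
    by (intro sum.cong refl) (simp add: algebra_simps)
  also have "\<dots> = 2 * (cip n f x * cip n g y - cip n f y * cip n g x)"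
    by (simp only: sum.distrib sum_subtractf sum_product[symmetric] cip_def) (simp add: algebra_simps)
  finally have "(\<Sum>p\<in>?I. ?F p * cnj (?X p)) = 2 * (cip n f x * cip n g y - cip n f y * cip n g x)"
    by (simp add: sum.cartesian_product split_beta)
  moreover have "(cmod (\<Sum>p\<in>?I. ?F p * cnj (?X p)))\<^sup>2
      \<le> (\<Sum>p\<in>?I. (cmod (?F p))\<^sup>2) * (\<Sum>p\<in>?I. (cmod (?X p))\<^sup>2)"
    by (rule Cauchy_Schwarz_sum)
  moreover have "(\<Sum>p\<in>?I. (cmod (?F p))\<^sup>2) = 2 * wedge n f g" "(\<Sum>p\<in>?I. (cmod (?X p))\<^sup>2) = 2 * wedge n x y"
    by (simp_all add: wedge_sum[symmetric] sum.cartesian_product split_beta)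
  ultimately have "(cmod (2 * (cip n f x * cip n g y - cip n f y * cip n g x)))\<^sup>2
      \<le> (2 * wedge n f g) * (2 * wedge n x y)"
    by (simp only:)
  then show ?thesis by (simp only: norm_mult power_mult_distrib) simp
qed

definition tensor_nsq :: "nat \<Rightarrow> nat \<Rightarrow> (nat \<Rightarrow> complex) \<Rightarrow> (nat \<Rightarrow> complex) \<Rightarrow>
    (nat \<Rightarrow> complex) \<Rightarrow> (nat \<Rightarrow> complex) \<Rightarrow> real" where
  "tensor_nsq n m a x b y =
     nsq n a * nsq m x + nsq n b * nsq m y + 2 * Re (cip n b a * cip m y x)"

text \<open>The squared Frobenius norm of a x^T + b y^T, taken column by column.\<close>

lemma tensor_nsq_eq_sum: "tensor_nsq n m a x b y = (\<Sum>j<m. nsq n (\<lambda>i. x j * a i + y j * b i))"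
proof -
  have "(\<Sum>j<m. nsq n (\<lambda>i. x j * a i + y j * b i))
      = (\<Sum>j<m. (cmod (x j))\<^sup>2 * nsq n a + 2 * Re (cip n a b * (x j * cnj (y j))) + (cmod (y j))\<^sup>2 * nsq n b)"
    by (intro sum.cong refl, simp only: nsq_add nsq_scale cip_scale_left cip_scale_right)
      (simp only: mult_ac)
  also have "\<dots> = nsq m x * nsq n a + 2 * Re (cip n a b * cip m x y) + nsq m y * nsq n b"
    by (simp only: sum.distrib sum_distrib_left[symmetric] sum_distrib_right[symmetric]
        Re_sum[symmetric] nsq_def cip_def[of m])
  also have "Re (cip n a b * cip m x y) = Re (cip n b a * cip m y x)"
    by (subst (1 2) cip_commute) (simp flip: complex_cnj_mult)
  finally show ?thesis by (simp add: tensor_nsq_def)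
qed

text \<open>Conjugation exchanges the arguments of the inner product of x and y. This version arises
  from the block with \<open>X\<close>, the unconjugated one from the block with its
  adjoint.\<close>

lemma tensor_nsq_cnj:
  "tensor_nsq n m a (\<lambda>i. cnj (x i)) b (\<lambda>i. cnj (y i)) =
     nsq n a * nsq m x + nsq n b * nsq m y + 2 * Re (cip n b a * cip m x y)"
  by (simp add: tensor_nsq_def nsq_def cip_def mult.commute)

lemma tensor_nsq_nonneg: "0 \<le> tensor_nsq n m a x b y"
  by (simp add: tensor_nsq_eq_sum sum_nonneg)

lemma Cauchy_Schwarz_2: "(a * c + b * d)\<^sup>2 \<le> (a\<^sup>2 + b\<^sup>2) * (c\<^sup>2 + d\<^sup>2)" for a b c d :: real
  using zero_le_power2[of "a * d - b * c"] by (simp add: power2_eq_square algebra_simps)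

text \<open>Put w^2 + r^2 = |a|^2 |b|^2 and z^2 + s^2 = |x|^2 |y|^2, with w, z the square roots of
  the wedges. Cauchy-Schwarz in the plane and the inequality of the means bound 2 (w z + r s) by the
  first two terms of \<open>tensor_nsq\<close>, and its last term is at least - 2 r s.\<close>

lemma wedge_tensor_nsq: "2 * sqrt (wedge n a b) * sqrt (wedge m x y) \<le> tensor_nsq n m a x b y"
proof -
  define w z where "w = sqrt (wedge n a b)" and "z = sqrt (wedge m x y)"
  define r s where "r = cmod (cip n b a)" and "s = cmod (cip m y x)"
  have r: "r = cmod (cip n a b)" and s: "s = cmod (cip m x y)"
    unfolding r_def s_def by (subst cip_commute, simp)+
  define A B X Y where "A = nsq n a" and "B = nsq n b" and "X = nsq m x" and "Y = nsq m y"
  have w2: "w\<^sup>2 + r\<^sup>2 = A * B" and z2: "z\<^sup>2 + s\<^sup>2 = X * Y"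
    using wedge_nonneg[of n a b] wedge_nonneg[of m x y]
    by (simp_all add: w_def z_def r s wedge_def A_def B_def X_def Y_def)
  have nn: "0 \<le> A" "0 \<le> B" "0 \<le> X" "0 \<le> Y" by (simp_all add: A_def B_def X_def Y_def)
  have "(w * z + r * s)\<^sup>2 \<le> (w\<^sup>2 + r\<^sup>2) * (z\<^sup>2 + s\<^sup>2)"
    by (rule Cauchy_Schwarz_2)
  also have "\<dots> = (A * X) * (B * Y)" by (simp add: w2 z2)
  finally have "4 * (w * z + r * s)\<^sup>2 \<le> 4 * ((A * X) * (B * Y))" by simp
  also have "\<dots> \<le> (A * X + B * Y)\<^sup>2"
    using zero_le_power2[of "A * X - B * Y"] by (simp add: power2_eq_square algebra_simps)
  finally have "(2 * (w * z + r * s))\<^sup>2 \<le> (A * X + B * Y)\<^sup>2"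
    by (simp only: power_mult_distrib) simp
  then have "2 * (w * z + r * s) \<le> A * X + B * Y"
    by (rule power2_le_imp_le) (use nn in simp)
  moreover have "- (r * s) \<le> Re (cip n b a * cip m y x)"
    using abs_Re_le_cmod[of "cip n b a * cip m y x"] by (simp add: norm_mult r_def s_def)
  ultimately show ?thesis
    unfolding tensor_nsq_def by (simp add: w_def z_def A_def B_def X_def Y_def)
qed

section \<open>Bounds by the two largest singular values\<close>

locale top_singular =
  fixes m n :: nat and P :: "complex mat"
  assumes P: "P \<in> carrier_mat m n" and n2: "2 \<le> n"
begin

text \<open>Squared singular values counted from 0, so the two largest are \<open>ev 0\<close> and
  \<open>ev 1\<close>; both exist as eigenvalues because 2 \<le> n.\<close>

definition "ev i = eigval (Suc i) (mat_adjoint P * P)"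

lemma PP: "mat_adjoint P * P \<in> carrier_mat n n" "hermitian_mat (mat_adjoint P * P)"
proof -
  show car: "mat_adjoint P * P \<in> carrier_mat n n"
    by (rule mult_carrier_mat[OF adjoint_carrier[OF P] P])
  have "app (mat_adjoint P * P) v = app (mat_adjoint P) (app P v)" for v
    using app_mult[OF adjoint_carrier[OF P] P] by simp
  then show "hermitian_mat (mat_adjoint P * P)"
    by (intro hermitianI[OF car]) (simp add: cip_adjoint_app[OF P] cip_app_adjoint[OF P])
qed

lemma cip_PP: "cip m (app P v) (app P w) = cip n (app (mat_adjoint P * P) v) w"
  using app_mult[OF adjoint_carrier[OF P] P] by (simp add: cip_adjoint_app[OF P])

definition "e = (SOME e. eigenframe n (mat_adjoint P * P) e ev)"

lemma E: "eigenframe n (mat_adjoint P * P) e ev"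
  unfolding e_def ev_def[abs_def] by (rule someI_ex[OF spectral_theorem[OF PP]])


lemma cip_P: "cip m (app P v) (app P w)
    = (\<Sum>i<n. complex_of_real (ev i) * (cip n v (e i) * cnj (cip n w (e i))))"
  by (simp add: cip_PP eigenframe_form[OF E PP])

lemma nsq_P: "nsq m (app P v) = (\<Sum>i<n. ev i * (cmod (cip n v (e i)))\<^sup>2)"
  using eigenframe_quadratic[OF E PP, of v] by (simp add: cip_PP[symmetric])

lemma ev_nonneg: "i < n \<Longrightarrow> 0 \<le> ev i"
  using eigenframe_value[OF E] by (metis cip_PP Re_cip_self nsq_nonneg)

lemma singval_sq: "(singval 1 P)\<^sup>2 = ev 0" "(singval 2 P)\<^sup>2 = ev 1"
    "singval 1 P * singval 2 P = sqrt (ev 0 * ev 1)"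
  using ev_nonneg[of 0] ev_nonneg[of 1] n2
  by (simp_all add: singval_def ev_def real_sqrt_mult numeral_2_eq_2)

lemma nsq_P_le: "nsq m (app P v) \<le> ev 0 * nsq n v"
  unfolding nsq_P eigenframe_nsq[OF E, of v] sum_distrib_left
  by (intro sum_mono mult_right_mono eigenframeD(3)[OF E]) auto

text \<open>In the eigenbasis the (i, j) coordinate of a \<and> b acquires the weight
  \<open>ev i * ev j\<close>. It is at most \<open>ev 0 * ev 1\<close> for distinct i, j, and the
  coordinates with i = j vanish.\<close>

lemma wedge_P_le: "wedge m (app P a) (app P b) \<le> ev 0 * ev 1 * wedge n a b"
proof -
  let ?\<alpha> = "\<lambda>i. cip n a (e i)" and ?\<beta> = "\<lambda>i. cip n b (e i)"
  let ?d = "\<lambda>i j. (cmod (?\<alpha> i * ?\<beta> j - ?\<alpha> j * ?\<beta> i))\<^sup>2"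
  have le: "ev i * ev j \<le> ev 0 * ev 1" if "i < j" "j < n" for i j
    using that eigenframeD(3)[OF E, of 0 i] eigenframeD(3)[OF E, of 1 j] ev_nonneg[of j] ev_nonneg[of 0]
    by (intro mult_mono) auto
  have "2 * wedge m (app P a) (app P b) = (\<Sum>i<n. \<Sum>j<n. ev i * ev j * ?d i j)"
    unfolding Lagrange_identity wedge_def by (simp add: nsq_P cip_P)
  also have "\<dots> \<le> (\<Sum>i<n. \<Sum>j<n. ev 0 * ev 1 * ?d i j)"
  proof (intro sum_mono)
    fix i j assume "i \<in> {..<n}" "j \<in> {..<n}"
    then show "ev i * ev j * ?d i j \<le> ev 0 * ev 1 * ?d i j"
      using le[of i j] le[of j i]
      by (cases i j rule: linorder_cases) (auto intro!: mult_right_mono simp: mult.commute[of "ev i"])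
  qed
  also have "\<dots> = ev 0 * ev 1 * (2 * wedge n a b)"
    using Lagrange_identity[of "\<lambda>_. 1" ?\<alpha> ?\<beta> n]
    by (simp add: wedge_def eigenframe_nsq[OF E, symmetric] eigenframe_cip[OF E, symmetric]
        flip: sum_distrib_left)
  finally show ?thesis by simp
qed

text \<open>The left side is the trace of P^* P compressed to the plane of a and b. It is a sum of
  the eigenvalues with nonnegative weights of total 2, where the weight of the largest one is at
  most 1.\<close>

lemma Ky_Fan_pair:
  assumes ab: "cip n a b = 0" and pos: "nsq n a > 0" "nsq n b > 0"
  shows "nsq m (app P a) / nsq n a + nsq m (app P b) / nsq n b \<le> ev 0 + ev 1"
proof -
  define A B where "A = nsq n a" and "B = nsq n b"
  define w where "w i = (cmod (cip n a (e i)))\<^sup>2 / A + (cmod (cip n b (e i)))\<^sup>2 / B" for i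
  have AB: "A > 0" "B > 0" using pos by (simp_all add: A_def B_def)
  have w0: "0 \<le> w i" for i using AB by (simp add: w_def)
  have sum_w: "(\<Sum>i<n. w i) = 2"
    using AB by (simp add: w_def sum.distrib A_def B_def eigenframe_nsq[OF E, symmetric]
        flip: sum_divide_distrib)
  have w1: "w 0 \<le> 1"
  proof -
    define u where "u = e 0"
    have u: "nsq n u = 1" using eigenframe_nsq_vector[OF E, of 0] n2 by (simp add: u_def)
    \<comment> \<open>Coefficients of the projection of u onto the plane of a and b; the squared
      distance of u from it being nonnegative is Bessel's inequality.\<close>
    define s t where "s = cip n u a / complex_of_real A" and "t = cip n u b / complex_of_real B"
    have sa: "cip n a u = cnj (cip n u a)" "cip n b u = cnj (cip n u b)" by (rule cip_commute)+
    have "0 \<le> nsq n (\<lambda>i. u i - (s * a i + t * b i))" by simp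
    also have "\<dots> = 1 - 2 * Re (cnj s * cip n u a + cnj t * cip n u b) + ((cmod s)\<^sup>2 * A + (cmod t)\<^sup>2 * B)"
      by (simp add: nsq_diff nsq_add nsq_scale cip_add_right cip_scale_left cip_scale_right u ab A_def B_def)
    also have "cnj s * cip n u a = complex_of_real ((cmod (cip n u a))\<^sup>2 / A)"
      by (simp add: s_def complex_norm_square mult.commute del: of_real_power)
    also have "cnj t * cip n u b = complex_of_real ((cmod (cip n u b))\<^sup>2 / B)"
      by (simp add: t_def complex_norm_square mult.commute del: of_real_power)
    also have "(cmod s)\<^sup>2 * A = (cmod (cip n u a))\<^sup>2 / A"
      using AB by (simp add: s_def norm_divide power_divide power2_eq_square)
    also have "(cmod t)\<^sup>2 * B = (cmod (cip n u b))\<^sup>2 / B"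
      using AB by (simp add: t_def norm_divide power_divide power2_eq_square)
    finally show ?thesis by (simp add: w_def sa flip: u_def of_real_add)
  qed
  have "nsq m (app P a) / A + nsq m (app P b) / B = (\<Sum>i<n. ev i * w i)"
    by (simp add: nsq_P w_def sum.distrib sum_divide_distrib distrib_left)
  also have "\<dots> = (\<Sum>i<n. (ev i - ev 1) * w i) + ev 1 * 2"
    by (simp only: left_diff_distrib sum_subtractf sum_distrib_left[symmetric] sum_w diff_add_cancel)
  \<comment> \<open>After \<open>ev 1\<close> is split off, only index 0 can contribute a positive
    amount.\<close>
  also have "(\<Sum>i<n. (ev i - ev 1) * w i) \<le> (\<Sum>i<n. if i = 0 then ev 0 - ev 1 else 0)"
  proof (rule sum_mono)
    fix i assume "i \<in> {..<n}"
    moreover have "(ev 0 - ev 1) * w 0 \<le> ev 0 - ev 1"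
      using eigenframeD(3)[OF E, of 0 1] n2 w1 by (simp add: mult_left_le)
    moreover have "ev i \<le> ev 1" if "i \<noteq> 0" "i < n"
      using eigenframeD(3)[OF E, of 1 i] that by simp
    ultimately show "(ev i - ev 1) * w i \<le> (if i = 0 then ev 0 - ev 1 else 0)"
      using w0[of i] by (auto simp: mult_nonpos_nonneg)
  qed
  finally show ?thesis using n2 by (simp add: A_def B_def)
qed

text \<open>Cauchy-Schwarz for each inner product, then in the plane, leaves the sum t + s of the
  Rayleigh quotients of P^* P at a and b, which \<open>Ky_Fan_pair\<close> bounds.\<close>

lemma cip_pair_orthogonal:
  assumes ab: "cip n a b = 0"
  shows "(cmod (cip m (app P a) x + cip m (app P b) y))\<^sup>2
    \<le> (ev 0 + ev 1) * (nsq n a * nsq m x + nsq n b * nsq m y)"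
proof -
  define A B X Y where "A = nsq n a" and "B = nsq n b" and "X = nsq m x" and "Y = nsq m y"
  have nn: "0 \<le> A" "0 \<le> B" "0 \<le> X" "0 \<le> Y" by (simp_all add: A_def B_def X_def Y_def)
  have ev01: "0 \<le> ev 0" "0 \<le> ev 1" using ev_nonneg n2 by auto
  \<comment> \<open>A quotient with denominator 0 is 0. The relations \<open>ta\<close> and
    \<open>sb\<close> survive, because \<open>P\<close> sends vectors of norm 0 to vectors of norm
    0.\<close>
  define t s where "t = nsq m (app P a) / A" and "s = nsq m (app P b) / B"
  have Pz: "nsq m (app P v) = 0" if "nsq n v = 0" for v
    using nsq_P_le[of v] nsq_nonneg[of m "app P v"] that by simp
  have ta: "nsq m (app P a) = t * A" and sb: "nsq m (app P b) = s * B"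
    using Pz by (auto simp: t_def s_def A_def B_def)
  have ts0: "0 \<le> t" "0 \<le> s" using nn by (simp_all add: t_def s_def)
  have ts: "t + s \<le> ev 0 + ev 1"
  proof (cases "A = 0 \<or> B = 0")
    case True
    have "nsq m (app P v) / nsq n v \<le> ev 0" for v
      using nsq_P_le[of v] ev01 nsq_nonneg[of n v] by (cases "nsq n v = 0") (auto simp: pos_divide_le_eq less_le)
    from this[of a] this[of b] show ?thesis using True ev01 by (auto simp: t_def s_def A_def B_def)
  next
    case False
    then show ?thesis using Ky_Fan_pair[OF ab] nn by (simp add: t_def s_def A_def B_def less_le)
  qed
  have "cmod (cip m (app P a) x) \<le> sqrt (t * A * X)" "cmod (cip m (app P b) y) \<le> sqrt (s * B * Y)"
    using cip_Cauchy_Schwarz[of m "app P a" x] cip_Cauchy_Schwarz[of m "app P b" y]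
    by (simp_all add: real_le_rsqrt ta sb X_def Y_def)
  then have "cmod (cip m (app P a) x + cip m (app P b) y) \<le> sqrt (t * (A * X)) + sqrt (s * (B * Y))"
    using norm_triangle_ineq[of "cip m (app P a) x" "cip m (app P b) y"] by (simp add: mult.assoc)
  then have "(cmod (cip m (app P a) x + cip m (app P b) y))\<^sup>2 \<le> (sqrt (t * (A * X)) + sqrt (s * (B * Y)))\<^sup>2"
    by (simp add: power_mono)
  also have "\<dots> = (sqrt t * sqrt (A * X) + sqrt s * sqrt (B * Y))\<^sup>2" by (simp add: real_sqrt_mult)
  also have "\<dots> \<le> ((sqrt t)\<^sup>2 + (sqrt s)\<^sup>2) * ((sqrt (A * X))\<^sup>2 + (sqrt (B * Y))\<^sup>2)"
    by (rule Cauchy_Schwarz_2)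
  also have "\<dots> = (t + s) * (A * X + B * Y)" using nn ts0 by simp
  also have "\<dots> \<le> (ev 0 + ev 1) * (A * X + B * Y)" using ts nn by (simp add: mult_right_mono)
  finally show ?thesis by (simp add: A_def B_def X_def Y_def)
qed

text \<open>Orthogonalising \<open>b\<close> against \<open>a\<close> changes neither side when \<open>x\<close> is adjusted accordingly.\<close>

lemma cip_pair_le:
  "(cmod (cip m (app P a) x + cip m (app P b) y))\<^sup>2
    \<le> (ev 0 + ev 1) * tensor_nsq n m a (\<lambda>i. cnj (x i)) b (\<lambda>i. cnj (y i))"
proof (cases "nsq n a = 0")
  case True
  have a0: "a i = 0" if "i < n" for i using True that by (simp add: nsq_eq_0_iff)
  have "app P a = (\<lambda>i. 0)" using a0 P by (auto simp: app_def)
  moreover have "cip n b a = 0" using a0 by (simp add: cip_def)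
  moreover have "(cmod (cip m (app P b) y))\<^sup>2 \<le> (ev 0 + ev 1) * (nsq n b * nsq m y)"
  proof -
    have "(cmod (cip m (app P b) y))\<^sup>2 \<le> nsq m (app P b) * nsq m y" by (rule cip_Cauchy_Schwarz)
    also have "\<dots> \<le> (ev 0 * nsq n b) * nsq m y" by (intro mult_right_mono nsq_P_le) simp
    also have "\<dots> \<le> ((ev 0 + ev 1) * nsq n b) * nsq m y"
      using ev_nonneg[of 1] n2 by (intro mult_right_mono) auto
    finally show ?thesis by (simp add: mult.assoc)
  qed
  ultimately show ?thesis by (simp add: tensor_nsq_cnj True cip_zero_left)
next
  case False
  define A where "A = nsq n a"
  have A: "A > 0" using False nsq_nonneg[of n a] by (simp add: A_def less_le)
  define c where "c = cip n b a / complex_of_real A"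
  have cA: "c * complex_of_real A = cip n b a" using A by (simp add: c_def)
  define b' where "b' = (\<lambda>i. b i - c * a i)"
  define x' where "x' = (\<lambda>i. x i + cnj c * y i)"
  have b'a: "cip n b' a = 0" using cA by (simp add: b'_def cip_simps cip_self flip: A_def)
  then have ab': "cip n a b' = 0" using cip_commute[of n a b'] by simp
  have "cip m (app P a) x + cip m (app P b) y = cip m (app P a) x' + cip m (app P b') y"
    by (simp add: b'_def x'_def app_simps cip_simps)
  then have "(cmod (cip m (app P a) x + cip m (app P b) y))\<^sup>2
      \<le> (ev 0 + ev 1) * (A * nsq m x' + nsq n b' * nsq m y)"
    using cip_pair_orthogonal[OF ab', of x' y] by (simp add: A_def)
  moreover have "A * nsq m x' + nsq n b' * nsq m y = tensor_nsq n m a (\<lambda>i. cnj (x i)) b (\<lambda>i. cnj (y i))"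
  proof -
    have "nsq n b = nsq n (\<lambda>i. b' i + c * a i)" by (simp add: b'_def)
    also have "\<dots> = nsq n b' + (cmod c)\<^sup>2 * A"
      by (simp add: nsq_add nsq_scale cip_simps b'a A_def)
    finally have b: "nsq n b = nsq n b' + (cmod c)\<^sup>2 * A" .
    have "nsq m x' = nsq m x + 2 * Re (c * cip m x y) + (cmod c)\<^sup>2 * nsq m y"
      by (simp add: x'_def nsq_add nsq_scale cip_simps)
    moreover have "Re (cip n b a * cip m x y) = A * Re (c * cip m x y)"
      unfolding cA[symmetric] by (simp add: algebra_simps)
    ultimately show ?thesis
      unfolding tensor_nsq_cnj b A_def[symmetric] by (simp only: distrib_left distrib_right) simp
  qed
  ultimately show ?thesis by simp
qed

text \<open>With the four inner products p, q, u, v, the determinant p q - v u satisfies 2 |p q - v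
  u| \<le> k \<open>tensor_nsq\<close>, by the wedge bounds. The mixed term is at least - 2 |p| |q|
  - 2 |p q - v u|, and 2 |p| |q| is absorbed by the two squares.\<close>

lemma swapped_pair_lower:
  "0 \<le> sqrt (ev 0 * ev 1) * tensor_nsq n m a x b y
     + ((cmod (cip m (app P a) x))\<^sup>2 + (cmod (cip m (app P b) y))\<^sup>2
        + 2 * Re (cnj (cip m (app P a) y) * cip m (app P b) x))"
proof -
  define p q u v where "p = cip m (app P a) x" and "q = cip m (app P b) y"
    and "u = cip m (app P b) x" and "v = cip m (app P a) y"
  define k where "k = sqrt (ev 0 * ev 1)"
  have k0: "0 \<le> k" using ev_nonneg n2 by (simp add: k_def)
  have "(cmod (p * q - v * u))\<^sup>2 \<le> wedge m (app P a) (app P b) * wedge m x y"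
    unfolding p_def q_def u_def v_def by (rule cip_det_bound)
  also have "\<dots> \<le> ev 0 * ev 1 * wedge n a b * wedge m x y"
    by (rule mult_right_mono[OF wedge_P_le wedge_nonneg])
  also have "\<dots> = (k * sqrt (wedge n a b) * sqrt (wedge m x y))\<^sup>2"
    using ev_nonneg n2 by (simp add: k_def power_mult_distrib wedge_nonneg)
  finally have "cmod (p * q - v * u) \<le> k * sqrt (wedge n a b) * sqrt (wedge m x y)"
    by (rule power2_le_imp_le) (use k0 in \<open>simp add: wedge_nonneg\<close>)
  moreover have "k * (2 * sqrt (wedge n a b) * sqrt (wedge m x y)) \<le> k * tensor_nsq n m a x b y"
    by (rule mult_left_mono[OF wedge_tensor_nsq k0])
  ultimately have det: "2 * cmod (p * q - v * u) \<le> k * tensor_nsq n m a x b y" by simp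
  have "cmod (cnj v * u) = cmod (p * q - (p * q - v * u))" by (simp add: norm_mult)
  also have "\<dots> \<le> cmod p * cmod q + cmod (p * q - v * u)"
    using norm_triangle_ineq4[of "p * q" "p * q - v * u"] by (simp add: norm_mult)
  finally have "- (cmod p * cmod q + cmod (p * q - v * u)) \<le> Re (cnj v * u)"
    using abs_Re_le_cmod[of "cnj v * u"] by linarith
  moreover have "2 * (cmod p * cmod q) \<le> (cmod p)\<^sup>2 + (cmod q)\<^sup>2"
    using zero_le_power2[of "cmod p - cmod q"] by (simp add: power2_eq_square algebra_simps)
  ultimately have "0 \<le> k * tensor_nsq n m a x b y + ((cmod p)\<^sup>2 + (cmod q)\<^sup>2 + 2 * Re (cnj v * u))"
    using det by linarith
  then show ?thesis by (simp add: p_def q_def u_def v_def k_def)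
qed

text \<open>For N = (P a) x^T + (P b) y^T the left side is the real part of the Frobenius inner
  product of N with its transpose, hence at most the squared norm of N. The columns of N are images
  under \<open>P\<close> of the columns of a x^T + b y^T.\<close>

lemma swapped_pair_upper:
  "(cmod (cip m (app P a) x))\<^sup>2 + (cmod (cip m (app P b) y))\<^sup>2
      + 2 * Re (cnj (cip m (app P a) y) * cip m (app P b) x)
    \<le> ev 0 * tensor_nsq n m a x b y"
proof -
  let ?a = "app P a" and ?b = "app P b"
  let ?N = "\<lambda>i j. x j * ?a i + y j * ?b i"
  have "(\<Sum>i<m. \<Sum>j<m. ?N i j * cnj (?N j i))
     = (\<Sum>i<m. \<Sum>j<m. (?a i * cnj (x i)) * (x j * cnj (?a j)) + (?b i * cnj (y i)) * (y j * cnj (?b j))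
        + ((?a i * cnj (y i)) * (x j * cnj (?b j)) + (?b i * cnj (x i)) * (y j * cnj (?a j))))"
    by (intro sum.cong refl) (simp add: algebra_simps)
  also have "\<dots> = cip m ?a x * cip m x ?a + cip m ?b y * cip m y ?b
      + (cip m ?a y * cip m x ?b + cip m ?b x * cip m y ?a)"
    by (simp only: sum.distrib sum_product[symmetric] cip_def)
  also have "\<dots> = complex_of_real ((cmod (cip m ?a x))\<^sup>2 + (cmod (cip m ?b y))\<^sup>2)
      + (cnj (cnj (cip m ?a y) * cip m ?b x) + cnj (cip m ?a y) * cip m ?b x)"
    by (simp add: cip_commute[of m x] cip_commute[of m y] complex_norm_square mult.commute del: of_real_power)
  finally have "Re (\<Sum>i<m. \<Sum>j<m. ?N i j * cnj (?N j i)) = (cmod (cip m ?a x))\<^sup>2 + (cmod (cip m ?b y))\<^sup>2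
      + 2 * Re (cnj (cip m ?a y) * cip m ?b x)"
    by (simp del: of_real_power)
  moreover have "Re (\<Sum>i<m. \<Sum>j<m. ?N i j * cnj (?N j i))
      \<le> (\<Sum>i<m. \<Sum>j<m. ((cmod (?N i j))\<^sup>2 + (cmod (?N j i))\<^sup>2) / 2)"
  proof -
    have "Re (z * cnj w) \<le> ((cmod z)\<^sup>2 + (cmod w)\<^sup>2) / 2" for z w
      using zero_le_power2[of "cmod (z - w)"] unfolding cmod_power2
      by (simp add: power2_eq_square algebra_simps)
    then show ?thesis unfolding Re_sum by (intro sum_mono)
  qed
  moreover have "(\<Sum>i<m. \<Sum>j<m. ((cmod (?N i j))\<^sup>2 + (cmod (?N j i))\<^sup>2) / 2) = (\<Sum>i<m. \<Sum>j<m. (cmod (?N i j))\<^sup>2)"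
    using sum.swap[of "\<lambda>i j. (cmod (?N i j))\<^sup>2" "{..<m}" "{..<m}"]
    by (simp add: sum.distrib add_divide_distrib flip: sum_divide_distrib)
  moreover have "\<dots> = (\<Sum>j<m. nsq m (app P (\<lambda>i. x j * a i + y j * b i)))"
    by (subst sum.swap) (simp add: nsq_def app_simps)
  moreover have "\<dots> \<le> (\<Sum>j<m. ev 0 * nsq n (\<lambda>i. x j * a i + y j * b i))"
    by (intro sum_mono nsq_P_le)
  moreover have "\<dots> = ev 0 * tensor_nsq n m a x b y"
    by (simp add: tensor_nsq_eq_sum sum_distrib_left)
  ultimately show ?thesis by linarith
qed

end

section \<open>The maps \<open>\<Phi>\<close> on positive semidefinite block matrices\<close>

definition rank_one_sum :: "nat \<Rightarrow> nat \<Rightarrow> complex mat \<Rightarrow> (nat \<Rightarrow> nat \<Rightarrow> complex) \<Rightarrow> (nat \<Rightarrow> nat \<Rightarrow> complex) \<Rightarrow> bool" where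
  "rank_one_sum n K Y a b \<longleftrightarrow> (\<forall>i<n. \<forall>j<n. Y $$ (i, j) = (\<Sum>k<K. a k i * cnj (b k j)))"

text \<open>With \<open>R\<close> the square root, the matrix is R R^*. Cutting column k of
  \<open>R\<close> into its upper and lower half gives \<open>a k\<close> and
  \<open>b k\<close>.\<close>

lemma psd_four_block_rank_one:
  assumes car: "A \<in> carrier_mat n n" "X \<in> carrier_mat n n" "C \<in> carrier_mat n n"
    and psd: "psd_mat (four_block_mat A X (mat_adjoint X) C)"
  obtains a b where "rank_one_sum n (n + n) A a a" "rank_one_sum n (n + n) X a b"
    "rank_one_sum n (n + n) C b b"
proof -
  let ?M = "four_block_mat A X (mat_adjoint X) C"
  have M: "?M \<in> carrier_mat (n + n) (n + n)" using car by auto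
  define R where "R = mat_sqrt ?M"
  have R: "R \<in> carrier_mat (n + n) (n + n)" "psd_mat R" "R * R = ?M"
    using mat_sqrt[OF M psd] by (simp_all add: R_def)
  have adj: "R $$ (k, l) = cnj (R $$ (l, k))" if "k < n + n" "l < n + n" for k l
    using adjoint_index[of k R l] R(1) that psd_hermitian[OF R(2)] by (simp add: hermitian_mat_def)
  have MR: "?M $$ (i, j) = (\<Sum>k<n + n. R $$ (i, k) * cnj (R $$ (j, k)))" if "i < n + n" "j < n + n" for i j
  proof -
    have "(R * R) $$ (i, j) = (\<Sum>k<n + n. R $$ (i, k) * R $$ (k, j))"
      using R(1) that by (simp add: scalar_prod_def atLeast0LessThan)
    also have "\<dots> = (\<Sum>k<n + n. R $$ (i, k) * cnj (R $$ (j, k)))"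
      by (intro sum.cong refl) (simp add: adj[OF _ that(2)])
    finally show ?thesis by (simp only: R(3))
  qed
  have ent: "A $$ (i, j) = (\<Sum>k<n + n. R $$ (i, k) * cnj (R $$ (j, k)))"
    "X $$ (i, j) = (\<Sum>k<n + n. R $$ (i, k) * cnj (R $$ (n + j, k)))"
    "C $$ (i, j) = (\<Sum>k<n + n. R $$ (n + i, k) * cnj (R $$ (n + j, k)))"
    if "i < n" "j < n" for i j
    using MR[of i j] MR[of i "n + j"] MR[of "n + i" "n + j"] car that by simp_all
  show thesis
  proof (rule that[of "\<lambda>k i. R $$ (i, k)" "\<lambda>k i. R $$ (n + i, k)"])
    show "rank_one_sum n (n + n) A (\<lambda>k i. R $$ (i, k)) (\<lambda>k i. R $$ (i, k))"
      "rank_one_sum n (n + n) X (\<lambda>k i. R $$ (i, k)) (\<lambda>k i. R $$ (n + i, k))"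
      "rank_one_sum n (n + n) C (\<lambda>k i. R $$ (n + i, k)) (\<lambda>k i. R $$ (n + i, k))"
      unfolding rank_one_sum_def using ent by blast+
  qed
qed

lemma
  assumes Y: "Y \<in> carrier_mat n n"
    and rank: "rank_one_sum n K Y a b"
  shows rank_one_sum_form: "cip n (app Y v) w = (\<Sum>k<K. cip n v (b k) * cip n (a k) w)"
    and rank_one_sum_trace: "mat_trace Y = (\<Sum>k<K. cip n (a k) (b k))"
proof -
  have "app Y v i = (\<Sum>k<K. cip n v (b k) * a k i)" if "i < n" for i
  proof -
    have "app Y v i = (\<Sum>j<n. \<Sum>k<K. a k i * cnj (b k j) * v j)"
      using Y that by (simp add: app_def rank[unfolded rank_one_sum_def] sum_distrib_right)
    also have "\<dots> = (\<Sum>k<K. \<Sum>j<n. a k i * cnj (b k j) * v j)" by (rule sum.swap)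
    also have "\<dots> = (\<Sum>k<K. cip n v (b k) * a k i)"
      by (simp add: cip_def sum_distrib_left sum_distrib_right algebra_simps)
    finally show ?thesis .
  qed
  then have "cip n (app Y v) w = cip n (\<lambda>i. \<Sum>k<K. cip n v (b k) * a k i) w"
    by (intro cip_cong) auto
  then show "cip n (app Y v) w = (\<Sum>k<K. cip n v (b k) * cip n (a k) w)"
    by (simp add: cip_sum_left cip_scale_left)
  have "mat_trace Y = (\<Sum>i<n. \<Sum>k<K. a k i * cnj (b k i))"
    using Y by (simp add: mat_trace_def rank[unfolded rank_one_sum_def])
  then show "mat_trace Y = (\<Sum>k<K. cip n (a k) (b k))"
    by (simp add: cip_def) (rule sum.swap)
qed

text \<open>Both signs are handled at once by \<open>s = 1\<close> and \<open>s = - 1\<close>.\<close>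

definition trace_congruence :: "nat \<Rightarrow> nat \<Rightarrow> real \<Rightarrow> real \<Rightarrow> complex mat \<Rightarrow> (complex mat \<Rightarrow> complex mat) \<Rightarrow> bool" where
  "trace_congruence m n \<alpha> s P F \<longleftrightarrow>
     (\<forall>Y \<in> carrier_mat n n. F Y \<in> carrier_mat m m \<and>
       (\<forall>v w. cip m (app (F Y) v) w = complex_of_real \<alpha> * mat_trace Y * cip m v w
          + complex_of_real s * cip n (app Y (app (mat_adjoint P) v)) (app (mat_adjoint P) w)))"

lemma trace_congruenceD:
  assumes "trace_congruence m n \<alpha> s P F" "Y \<in> carrier_mat n n"
  shows "F Y \<in> carrier_mat m m"
    and "cip m (app (F Y) v) w = complex_of_real \<alpha> * mat_trace Y * cip m v w
          + complex_of_real s * cip n (app Y (app (mat_adjoint P) v)) (app (mat_adjoint P) w)"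
  using assms by (auto simp: trace_congruence_def)

lemma app_congruence:
  assumes "P \<in> carrier_mat m n" "Y \<in> carrier_mat n n"
  shows "cip m (app (P * Y * mat_adjoint P) v) w = cip n (app Y (app (mat_adjoint P) v)) (app (mat_adjoint P) w)"
  using assms app_mult[of "P * Y" m n "mat_adjoint P" m v] app_mult[of P m n Y n]
  by (simp add: cip_app_adjoint[OF assms(1)])

lemma cip_scalar_mat: "cip m (app (c \<cdot>\<^sub>m 1\<^sub>m m) v) w = c * cip m v w"
proof -
  have "cip m (app (c \<cdot>\<^sub>m 1\<^sub>m m) v) w = cip m (\<lambda>i. c * v i) w"
    by (rule cip_cong) (simp_all add: app_smult_mat app_one)
  then show ?thesis by (simp add: cip_scale_left)
qed

lemma trace_congruence_Phi_plus:
  assumes P: "P \<in> carrier_mat m n"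
  shows "trace_congruence m n \<alpha> 1 P (Phi_plus \<alpha> P)"
  unfolding trace_congruence_def
proof (intro ballI conjI allI)
  fix Y :: "complex mat" and v w assume Y: "Y \<in> carrier_mat n n"
  have car: "P * Y * mat_adjoint P \<in> carrier_mat m m" using P Y by auto
  then show "Phi_plus \<alpha> P Y \<in> carrier_mat m m" using P by (simp add: Phi_plus_def)
  show "cip m (app (Phi_plus \<alpha> P Y) v) w = complex_of_real \<alpha> * mat_trace Y * cip m v w
      + complex_of_real 1 * cip n (app Y (app (mat_adjoint P) v)) (app (mat_adjoint P) w)"
    using P car
    by (simp add: Phi_plus_def app_mat_add[of _ m m] cip_add_left cip_scalar_mat app_congruence[OF P Y])
qed

lemma trace_congruence_Phi_minus:
  assumes P: "P \<in> carrier_mat m n"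
  shows "trace_congruence m n \<alpha> (- 1) P (Phi_minus \<alpha> P)"
  unfolding trace_congruence_def
proof (intro ballI conjI allI)
  fix Y :: "complex mat" and v w assume Y: "Y \<in> carrier_mat n n"
  have car: "P * Y * mat_adjoint P \<in> carrier_mat m m" using P Y by auto
  then show "Phi_minus \<alpha> P Y \<in> carrier_mat m m"
    unfolding Phi_minus_def by (rule minus_carrier_mat)
  show "cip m (app (Phi_minus \<alpha> P Y) v) w = complex_of_real \<alpha> * mat_trace Y * cip m v w
      + complex_of_real (- 1) * cip n (app Y (app (mat_adjoint P) v)) (app (mat_adjoint P) w)"
    using P car
    by (simp add: Phi_minus_def app_mat_diff[of _ m m] cip_diff_left cip_scalar_mat app_congruence[OF P Y])
qed

lemma mat_trace_adjoint:
  assumes "Y \<in> carrier_mat n n"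
  shows "mat_trace (mat_adjoint Y) = cnj (mat_trace Y)"
  using assms by (simp add: mat_trace_def adjoint_index)

lemma trace_congruence_adjoint:
  assumes F: "trace_congruence m n \<alpha> s P F" and Y: "Y \<in> carrier_mat n n"
  shows "mat_adjoint (F Y) = F (mat_adjoint Y)"
proof (rule adjoint_eqI[of _ m m])
  note adj = adjoint_carrier[OF Y]
  show "F Y \<in> carrier_mat m m" "F (mat_adjoint Y) \<in> carrier_mat m m"
    using trace_congruenceD(1)[OF F] Y adj by auto
  fix v w
  have "cip m v (app (F Y) w) = cnj (cip m (app (F Y) w) v)" by (rule cip_commute)
  also have "\<dots> = complex_of_real \<alpha> * cnj (mat_trace Y) * cip m v w
      + complex_of_real s * cip n (app (mat_adjoint P) v) (app Y (app (mat_adjoint P) w))"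
    by (simp add: trace_congruenceD(2)[OF F Y] cip_commute[symmetric])
  also have "\<dots> = cip m (app (F (mat_adjoint Y)) v) w"
    by (simp add: trace_congruenceD(2)[OF F adj] mat_trace_adjoint[OF Y] cip_adjoint_app[OF Y])
  finally show "cip m (app (F (mat_adjoint Y)) v) w = cip m v (app (F Y) w)" by simp
qed

lemma Re_of_real_mult: "Re (complex_of_real r * z) = r * Re z"
  by simp

text \<open>Together with \<open>sum_block_form\<close> this collects the three terms of a block
  form into one sum over the rank one summands.\<close>

lemma Re_trace_sum:
  "Re (complex_of_real \<alpha> * (\<Sum>k\<in>K. t k) * z + complex_of_real s * (\<Sum>k\<in>K. d k)) =
    (\<Sum>k\<in>K. \<alpha> * Re (t k * z) + s * Re (d k))"
proof -
  have "complex_of_real \<alpha> * (\<Sum>k\<in>K. t k) * z + complex_of_real s * (\<Sum>k\<in>K. d k)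
      = (\<Sum>k\<in>K. complex_of_real \<alpha> * (t k * z) + complex_of_real s * d k)"
    by (simp only: mult.assoc sum_distrib_left sum_distrib_right sum.distrib)
  then show ?thesis by (simp only: Re_sum plus_complex.sel Re_of_real_mult)
qed

lemma sum_block_form:
  "(\<Sum>k\<in>K. f k) + 2 * (\<Sum>k\<in>K. g k) + (\<Sum>k\<in>K. h k) = (\<Sum>k\<in>K. f k + 2 * g k + h k)" for f :: "'a \<Rightarrow> real"
  by (simp add: sum.distrib sum_distrib_left)

section \<open>Positivity of the block of images and of its partial transpose\<close>

locale psd_block_input = top_singular m n P for m n :: nat and P :: "complex mat" +
  fixes \<alpha> s :: real and F :: "complex mat \<Rightarrow> complex mat" and A X C :: "complex mat"
  assumes F: "trace_congruence m n \<alpha> s P F"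
    and A: "A \<in> carrier_mat n n" and X: "X \<in> carrier_mat n n" and C: "C \<in> carrier_mat n n"
    and psd: "psd_mat (four_block_mat A X (mat_adjoint X) C)"
begin

text \<open>By linearity it suffices to treat each rank one summand, where the block form at (x, y)
  is the assumed expression.\<close>

lemma block_psd_imageI:
  assumes "\<And>a b x y. 0 \<le> \<alpha> * tensor_nsq n m a (\<lambda>i. cnj (x i)) b (\<lambda>i. cnj (y i))
      + s * (cmod (cip m (app P a) x + cip m (app P b) y))\<^sup>2"
  shows "block_psd m (F A) (F X) (F C)"
  unfolding block_psd_def
proof (intro allI)
  fix x y
  obtain a b where ab: "rank_one_sum n (n + n) A a a" "rank_one_sum n (n + n) X a b"
    "rank_one_sum n (n + n) C b b"
    using psd_four_block_rank_one[OF A X C psd] by blast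
  note rk = rank_one_sum_form[OF A ab(1)] rank_one_sum_trace[OF A ab(1)]
    rank_one_sum_form[OF X ab(2)] rank_one_sum_trace[OF X ab(2)]
    rank_one_sum_form[OF C ab(3)] rank_one_sum_trace[OF C ab(3)]
  have summand: "\<alpha> * Re (cip n (a k) (a k) * cip m x x)
      + s * Re (cip n (app (mat_adjoint P) x) (a k) * cip n (a k) (app (mat_adjoint P) x))
      + 2 * (\<alpha> * Re (cip n (a k) (b k) * cip m y x)
      + s * Re (cip n (app (mat_adjoint P) y) (b k) * cip n (a k) (app (mat_adjoint P) x)))
      + (\<alpha> * Re (cip n (b k) (b k) * cip m y y)
      + s * Re (cip n (app (mat_adjoint P) y) (b k) * cip n (b k) (app (mat_adjoint P) y)))
    = \<alpha> * tensor_nsq n m (a k) (\<lambda>i. cnj (x i)) (b k) (\<lambda>i. cnj (y i))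
      + s * (cmod (cip m (app P (a k)) x + cip m (app P (b k)) y))\<^sup>2" for k
  proof -
    define p q where "p = cip m (app P (a k)) x" and "q = cip m (app P (b k)) y"
    have p: "cip n (a k) (app (mat_adjoint P) x) = p" "cip n (app (mat_adjoint P) x) (a k) = cnj p"
      and q: "cip n (b k) (app (mat_adjoint P) y) = q" "cip n (app (mat_adjoint P) y) (b k) = cnj q"
      by (simp_all add: p_def q_def cip_app_adjoint[OF P] cip_adjoint_app[OF P] flip: cip_commute)
    have re: "Re (cip n (a k) (b k) * cip m y x) = Re (cip n (b k) (a k) * cip m x y)"
      by (subst (1 2) cip_commute) (simp flip: complex_cnj_mult)
    have "(cmod (p + q))\<^sup>2 = Re (cnj p * p) + 2 * Re (cnj q * p) + Re (cnj q * q)"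
      unfolding cmod_power2 by (simp add: power2_eq_square algebra_simps)
    then show ?thesis
      unfolding p q re p_def[symmetric] q_def[symmetric] tensor_nsq_cnj
      by (simp add: cip_self algebra_simps)
  qed
  have "Re (cip m (app (F A) x) x) + 2 * Re (cip m (app (F X) y) x) + Re (cip m (app (F C) y) y)
     = (\<Sum>k<n + n. \<alpha> * tensor_nsq n m (a k) (\<lambda>i. cnj (x i)) (b k) (\<lambda>i. cnj (y i))
      + s * (cmod (cip m (app P (a k)) x + cip m (app P (b k)) y))\<^sup>2)"
    unfolding trace_congruenceD(2)[OF F A] trace_congruenceD(2)[OF F X] trace_congruenceD(2)[OF F C] rk
      Re_trace_sum summand[symmetric]
    by (rule sum_block_form)
  then show "0 \<le> Re (cip m (app (F A) x) x) + 2 * Re (cip m (app (F X) y) x) + Re (cip m (app (F C) y) y)"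
    by (simp only:) (intro sum_nonneg assms)
qed

text \<open>The adjoint of \<open>X\<close> exchanges \<open>a k\<close> and \<open>b k\<close> in
  the off-diagonal block only. The square of the sum then becomes the mixed expression of the
  swapped inequalities.\<close>

lemma block_psd_adjoint_imageI:
  assumes "\<And>a b x y. 0 \<le> \<alpha> * tensor_nsq n m a x b y
      + s * ((cmod (cip m (app P a) x))\<^sup>2 + (cmod (cip m (app P b) y))\<^sup>2
        + 2 * Re (cnj (cip m (app P a) y) * cip m (app P b) x))"
  shows "block_psd m (F A) (F (mat_adjoint X)) (F C)"
  unfolding block_psd_def
proof (intro allI)
  fix x y
  obtain a b where ab: "rank_one_sum n (n + n) A a a" "rank_one_sum n (n + n) X a b"
    "rank_one_sum n (n + n) C b b"
    using psd_four_block_rank_one[OF A X C psd] by blast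
  note X' = adjoint_carrier[OF X]
  have ab': "rank_one_sum n (n + n) (mat_adjoint X) b a"
    using X ab(2) by (simp add: rank_one_sum_def adjoint_index mult.commute)
  note rk = rank_one_sum_form[OF A ab(1)] rank_one_sum_trace[OF A ab(1)]
    rank_one_sum_form[OF X' ab'] rank_one_sum_trace[OF X' ab']
    rank_one_sum_form[OF C ab(3)] rank_one_sum_trace[OF C ab(3)]
  have summand: "\<alpha> * Re (cip n (a k) (a k) * cip m x x)
      + s * Re (cip n (app (mat_adjoint P) x) (a k) * cip n (a k) (app (mat_adjoint P) x))
      + 2 * (\<alpha> * Re (cip n (b k) (a k) * cip m y x)
      + s * Re (cip n (app (mat_adjoint P) y) (a k) * cip n (b k) (app (mat_adjoint P) x)))
      + (\<alpha> * Re (cip n (b k) (b k) * cip m y y)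
      + s * Re (cip n (app (mat_adjoint P) y) (b k) * cip n (b k) (app (mat_adjoint P) y)))
    = \<alpha> * tensor_nsq n m (a k) x (b k) y
      + s * ((cmod (cip m (app P (a k)) x))\<^sup>2 + (cmod (cip m (app P (b k)) y))\<^sup>2
        + 2 * Re (cnj (cip m (app P (a k)) y) * cip m (app P (b k)) x))" for k
  proof -
    have c: "cip n c (app (mat_adjoint P) z) = cip m (app P c) z"
      "cip n (app (mat_adjoint P) z) c = cnj (cip m (app P c) z)" for c z
      by (simp_all add: cip_app_adjoint[OF P] cip_adjoint_app[OF P] flip: cip_commute)
    have "Re (cnj z * z) = (cmod z)\<^sup>2" for z
      unfolding cmod_power2 by (simp add: power2_eq_square)
    then show ?thesis
      unfolding c tensor_nsq_def by (simp add: cip_self algebra_simps)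
  qed
  have "Re (cip m (app (F A) x) x) + 2 * Re (cip m (app (F (mat_adjoint X)) y) x) + Re (cip m (app (F C) y) y)
     = (\<Sum>k<n + n. \<alpha> * tensor_nsq n m (a k) x (b k) y
      + s * ((cmod (cip m (app P (a k)) x))\<^sup>2 + (cmod (cip m (app P (b k)) y))\<^sup>2
        + 2 * Re (cnj (cip m (app P (a k)) y) * cip m (app P (b k)) x)))"
    unfolding trace_congruenceD(2)[OF F A] trace_congruenceD(2)[OF F X'] trace_congruenceD(2)[OF F C] rk
      Re_trace_sum summand[symmetric]
    by (rule sum_block_form)
  then show "0 \<le> Re (cip m (app (F A) x) x) + 2 * Re (cip m (app (F (mat_adjoint X)) y) x)
      + Re (cip m (app (F C) y) y)"
    by (simp only:) (intro sum_nonneg assms)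
qed

lemma image_psd:
  assumes "block_psd m (F A) (F X) (F C)"
  shows "psd_mat (F A)" "psd_mat (F C)"
proof -
  have "psd_mat (F Y)" if Y: "Y \<in> carrier_mat n n" "hermitian_mat Y"
    and nn: "\<And>v. 0 \<le> Re (cip m (app (F Y) v) v)" for Y
  proof -
    note car = trace_congruenceD(1)[OF F Y(1)]
    have "mat_adjoint (F Y) = F Y"
      using trace_congruence_adjoint[OF F Y(1)] Y(2) by (simp add: hermitian_mat_def)
    then have "hermitian_mat (F Y)" using car by (simp add: hermitian_mat_def)
    then show ?thesis using nn psd_mat_iff[OF car] by blast
  qed
  then show "psd_mat (F A)" "psd_mat (F C)"
    using A C psd_four_blockD[OF A X C psd] block_psd_diag[OF assms] by blast+
qed

text \<open>With the plus sign the original block only requires \<alpha> to be nonnegative; the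
  condition on \<alpha> is used in full for the swapped block, through
  \<open>swapped_pair_lower\<close>.\<close>

lemma ppt_image_plus:
  assumes "s = 1" "singval 1 P * singval 2 P \<le> \<alpha>"
  shows "block_psd m (F A) (F X) (F C)" "block_psd m (F A) (F (mat_adjoint X)) (F C)"
proof -
  have k: "0 \<le> sqrt (ev 0 * ev 1)" "sqrt (ev 0 * ev 1) \<le> \<alpha>"
    using assms(2) ev_nonneg n2 unfolding singval_sq by simp_all
  have "0 \<le> \<alpha>" using k by (rule order_trans)
  then show "block_psd m (F A) (F X) (F C)"
    by (intro block_psd_imageI) (use assms(1) in \<open>simp add: tensor_nsq_nonneg\<close>)
  show "block_psd m (F A) (F (mat_adjoint X)) (F C)"
  proof (rule block_psd_adjoint_imageI)
    fix a b x y
    show "0 \<le> \<alpha> * tensor_nsq n m a x b y + s * ((cmod (cip m (app P a) x))\<^sup>2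
        + (cmod (cip m (app P b) y))\<^sup>2 + 2 * Re (cnj (cip m (app P a) y) * cip m (app P b) x))"
      using swapped_pair_lower[of a x b y] mult_right_mono[OF k(2) tensor_nsq_nonneg, of n m a x b y]
      by (simp add: assms(1))
  qed
qed

text \<open>With the minus sign the original block uses the sum of both squared singular values,
  through \<open>cip_pair_le\<close>; for the swapped block the largest one suffices.\<close>

lemma ppt_image_minus:
  assumes "s = - 1" "(singval 1 P)\<^sup>2 + (singval 2 P)\<^sup>2 \<le> \<alpha>"
  shows "block_psd m (F A) (F X) (F C)" "block_psd m (F A) (F (mat_adjoint X)) (F C)"
proof -
  have k: "ev 0 + ev 1 \<le> \<alpha>" "ev 0 \<le> \<alpha>"
    using assms(2) ev_nonneg[of 1] n2 unfolding singval_sq by simp_all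
  show "block_psd m (F A) (F X) (F C)"
  proof (rule block_psd_imageI)
    fix a b x y
    show "0 \<le> \<alpha> * tensor_nsq n m a (\<lambda>i. cnj (x i)) b (\<lambda>i. cnj (y i))
        + s * (cmod (cip m (app P a) x + cip m (app P b) y))\<^sup>2"
      using cip_pair_le[of a x b y]
        mult_right_mono[OF k(1) tensor_nsq_nonneg, of n m a "\<lambda>i. cnj (x i)" b "\<lambda>i. cnj (y i)"]
      by (simp add: assms(1))
  qed
  show "block_psd m (F A) (F (mat_adjoint X)) (F C)"
  proof (rule block_psd_adjoint_imageI)
    fix a b x y
    show "0 \<le> \<alpha> * tensor_nsq n m a x b y + s * ((cmod (cip m (app P a) x))\<^sup>2
        + (cmod (cip m (app P b) y))\<^sup>2 + 2 * Re (cnj (cip m (app P a) y) * cip m (app P b) x))"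
      using swapped_pair_upper[of a x b y] mult_right_mono[OF k(2) tensor_nsq_nonneg, of n m a x b y]
      by (simp add: assms(1))
  qed
qed

end

section \<open>The singular value inequality\<close>

text \<open>A zero row completes p equations in p + 1 unknowns to a square system. The transpose
  annihilates the last unit vector, so the determinant is 0.\<close>

lemma homogeneous_system_solvable:
  fixes M :: "nat \<Rightarrow> nat \<Rightarrow> complex"
  shows "\<exists>c. (\<exists>i\<le>p. c i \<noteq> 0) \<and> (\<forall>k<p. (\<Sum>i\<le>p. c i * M k i) = 0)"
proof -
  define N where "N = mat (Suc p) (Suc p) (\<lambda>(k, i). if k < p then M k i else 0)"
  have N: "N \<in> carrier_mat (Suc p) (Suc p)" by (simp add: N_def)
  have "transpose_mat N *\<^sub>v unit_vec (Suc p) p = 0\<^sub>v (Suc p)"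
    by (rule eq_vecI) (auto simp: N_def scalar_prod_def intro!: sum.neutral)
  moreover have "unit_vec (Suc p) p \<noteq> (0\<^sub>v (Suc p) :: complex vec)"
    by (simp add: vec_eq_iff)
  ultimately have "det (transpose_mat N) = 0"
    using det_0_iff_vec_prod_zero[of "transpose_mat N" "Suc p"] N unit_vec_carrier[of "Suc p" p]
    by (metis transpose_carrier_mat)
  then have "det N = 0" using det_transpose[OF N] by simp
  then obtain v where v: "v \<in> carrier_vec (Suc p)" "v \<noteq> 0\<^sub>v (Suc p)" "N *\<^sub>v v = 0\<^sub>v (Suc p)"
    using det_0_iff_vec_prod_zero[OF N] by blast
  have "(\<Sum>i\<le>p. v $ i * M k i) = 0" if "k < p" for k
  proof -
    have "(N *\<^sub>v v) $ k = 0" using v that by simp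
    then show ?thesis
      using v(1) that by (simp add: N_def scalar_prod_def atLeast0LessThan lessThan_Suc_atMost mult.commute)
  qed
  moreover have "\<exists>i\<le>p. v $ i \<noteq> 0"
    using v(1,2) by (metis carrier_vecD eq_vecI index_zero_vec less_Suc_eq_le)
  ultimately show ?thesis by blast
qed

lemma block_psd_cross_le:
  assumes "block_psd n G Y H"
  shows "2 * Re (cip n (app Y w) v) \<le> Re (cip n (app G v) v) + Re (cip n (app H w) w)"
  using block_psdD[OF assms, of v "\<lambda>i. - w i"] by (simp add: app_minus cip_simps)

lemma unimodular_phase:
  obtains \<omega> where "cmod \<omega> = 1" "z * \<omega> = complex_of_real (cmod z)"
proof (cases "z = 0")
  case False
  have "z * (cnj z / complex_of_real (cmod z)) = complex_of_real (cmod z)"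
    using False complex_norm_square[of z] by (simp add: power2_eq_square nonzero_divide_eq_eq)
  moreover have "cmod (cnj z / complex_of_real (cmod z)) = 1" using False by (simp add: norm_divide)
  ultimately show ?thesis using that by blast
qed (use that[of 1] in simp)

text \<open>Multiplying one argument by a phase turns the real part into the modulus and leaves the
  form of \<open>G\<close> unchanged.\<close>

lemma block_psd_form_le:
  assumes "block_psd n G Y G"
  shows "cmod (cip n (app Y v) v) \<le> Re (cip n (app G v) v)"
proof -
  obtain \<omega> where \<omega>: "cmod \<omega> = 1" "cip n (app Y v) v * \<omega> = complex_of_real (cmod (cip n (app Y v) v))"
    by (rule unimodular_phase)
  have "\<omega> * cnj \<omega> = 1" using \<omega>(1) by (simp add: complex_norm_square[symmetric] del: of_real_power)
  then have "cip n (app G (\<lambda>i. \<omega> * v i)) (\<lambda>i. \<omega> * v i) = cip n (app G v) v"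
    by (simp add: app_simps cip_scale_left cip_scale_right flip: mult.assoc)
  moreover have "Re (cip n (app Y (\<lambda>i. \<omega> * v i)) v) = cmod (cip n (app Y v) v)"
    using \<omega>(2) by (simp add: app_simps cip_scale_left mult.commute)
  ultimately show ?thesis
    using block_psd_cross_le[OF assms, of "\<lambda>i. \<omega> * v i" v] by simp
qed

abbreviation (input) unit :: "nat \<Rightarrow> nat \<Rightarrow> complex" where
  "unit i \<equiv> (\<lambda>l. if l = i then 1 else 0)"

lemma mat_trace_cip:
  assumes "Y \<in> carrier_mat n n"
  shows "mat_trace Y = (\<Sum>i<n. cip n (app Y (unit i)) (unit i))"
  using assms by (simp add: mat_trace_def entry_eq_cip)

text \<open>The trace is the sum of the eigenvalues; these are nonnegative, so each of them is at
  most the trace.\<close>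

lemma psd_mat_trace:
  assumes G: "G \<in> carrier_mat n n" "psd_mat G"
  shows "mat_trace G = complex_of_real (Re (mat_trace G))" "0 \<le> Re (mat_trace G)"
    "Re (cip n (app G v) v) \<le> Re (mat_trace G) * nsq n v"
proof -
  note herm = psd_hermitian[OF G(2)]
  show "0 \<le> Re (mat_trace G)"
    unfolding mat_trace_cip[OF G(1)] Re_sum by (intro sum_nonneg psd_nonneg[OF G(2,1)])
  have "mat_trace G = cnj (mat_trace G)"
    using mat_trace_adjoint[OF G(1)] herm by (simp add: hermitian_mat_def)
  then show "mat_trace G = complex_of_real (Re (mat_trace G))" by (simp add: complex_eq_iff)
  obtain e where E: "eigenframe n G e (\<lambda>i. eigval (Suc i) G)"
    using spectral_theorem[OF G(1) herm] by blast
  let ?ev = "\<lambda>i. eigval (Suc i) G"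
  have nn: "0 \<le> ?ev i" if "i < n" for i
    using psd_nonneg[OF G(2,1), of "e i"] eigenframe_value[OF E that] by simp
  have unit_cip: "cmod (cip n (unit l) (e i)) = cmod (e i l)" if "l < n" for i l
    using cip_unit_right[OF that, of "e i"] cip_commute[of n "unit l" "e i"] by simp
  have "Re (mat_trace G) = (\<Sum>l<n. \<Sum>i<n. ?ev i * (cmod (e i l))\<^sup>2)"
    unfolding mat_trace_cip[OF G(1)] Re_sum
    by (intro sum.cong refl) (simp add: eigenframe_quadratic[OF E G(1) herm] unit_cip)
  also have "\<dots> = (\<Sum>i<n. ?ev i * nsq n (e i))"
    by (subst sum.swap) (simp add: nsq_def sum_distrib_left)
  also have "\<dots> = (\<Sum>i<n. ?ev i)"
    by (intro sum.cong refl) (simp add: eigenframe_nsq_vector[OF E])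
  finally have tr: "Re (mat_trace G) = (\<Sum>i<n. ?ev i)" .
  show "Re (cip n (app G v) v) \<le> Re (mat_trace G) * nsq n v"
    unfolding eigenframe_quadratic[OF E G(1) herm] eigenframe_nsq[OF E, of v] sum_distrib_left tr
    by (intro sum_mono mult_right_mono member_le_sum) (use nn in auto)
qed

text \<open>The expression is the sum of the block forms at the vectors v_l e_i and w_l e_i, with
  e_i the unit vectors.\<close>

lemma block_psd_trace:
  assumes car: "A \<in> carrier_mat n n" "X \<in> carrier_mat n n" "C \<in> carrier_mat n n"
    and blk: "block_psd n A X C"
  shows "0 \<le> Re (mat_trace A) * nsq m v + 2 * Re (mat_trace X * cip m w v) + Re (mat_trace C) * nsq m w"
proof -
  have "Re (mat_trace A) * nsq m v + 2 * Re (mat_trace X * cip m w v) + Re (mat_trace C) * nsq m w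
     = (\<Sum>i<n. \<Sum>l<m. Re (cip n (app A (\<lambda>k. v l * unit i k)) (\<lambda>k. v l * unit i k))
        + 2 * Re (cip n (app X (\<lambda>k. w l * unit i k)) (\<lambda>k. v l * unit i k))
        + Re (cip n (app C (\<lambda>k. w l * unit i k)) (\<lambda>k. w l * unit i k)))"
  proof -
    have q: "Re (cip n (app M (\<lambda>k. a * unit i k)) (\<lambda>k. a * unit i k))
        = Re (cip n (app M (unit i)) (unit i)) * (cmod a)\<^sup>2" for M a i
    proof -
      have "cip n (app M (\<lambda>k. a * unit i k)) (\<lambda>k. a * unit i k)
          = complex_of_real ((cmod a)\<^sup>2) * cip n (app M (unit i)) (unit i)"
        unfolding complex_norm_square app_scale cip_scale_left cip_scale_right by (simp only: mult_ac)
      then show ?thesis by (simp only: Re_of_real_mult mult.commute)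
    qed
    have x: "cip n (app X (\<lambda>k. a * unit i k)) (\<lambda>k. b * unit i k)
        = cip n (app X (unit i)) (unit i) * (a * cnj b)" for a b i
      by (simp add: app_scale cip_scale_left cip_scale_right)
    have "Re (mat_trace X * cip m w v)
        = (\<Sum>i<n. \<Sum>l<m. Re (cip n (app X (unit i)) (unit i) * (w l * cnj (v l))))"
      unfolding mat_trace_cip[OF car(2)] cip_def[of m] sum_product Re_sum ..
    moreover have "Re (mat_trace M) * nsq m a
        = (\<Sum>i<n. \<Sum>l<m. Re (cip n (app M (unit i)) (unit i)) * (cmod (a l))\<^sup>2)"
      if "M \<in> carrier_mat n n" for M a
      unfolding mat_trace_cip[OF that] nsq_def Re_sum sum_product ..
    ultimately show ?thesis
      unfolding q x using car by (simp only: sum.distrib sum_distrib_left)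
  qed
  also have "\<dots> \<ge> 0" by (intro sum_nonneg block_psdD[OF blk])
  finally show ?thesis .
qed

text \<open>The form is \<beta> times that of the block of traces plus the original form at the
  images under Q^*.\<close>

lemma block_psd_trace_congruence:
  assumes F: "trace_congruence m n \<beta> 1 Q F" and \<beta>: "0 \<le> \<beta>"
    and car: "A \<in> carrier_mat n n" "X \<in> carrier_mat n n" "C \<in> carrier_mat n n"
    and real: "mat_trace A = complex_of_real (Re (mat_trace A))" "mat_trace C = complex_of_real (Re (mat_trace C))"
    and blk: "block_psd n A X C"
  shows "block_psd m (F A) (F X) (F C)"
  unfolding block_psd_def
proof (intro allI)
  fix v w
  have diag: "Re (cip m (app (F M) v) v) = \<beta> * (Re (mat_trace M) * nsq m v)
      + Re (cip n (app M (app (mat_adjoint Q) v)) (app (mat_adjoint Q) v))"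
    if "M \<in> carrier_mat n n" "mat_trace M = complex_of_real (Re (mat_trace M))" for M v
    by (subst trace_congruenceD(2)[OF F that(1)], subst that(2)) (simp add: cip_self)
  have cross: "Re (cip m (app (F X) w) v) = \<beta> * Re (mat_trace X * cip m w v)
      + Re (cip n (app X (app (mat_adjoint Q) w)) (app (mat_adjoint Q) v))"
    by (subst trace_congruenceD(2)[OF F car(2)]) (simp add: algebra_simps)
  show "0 \<le> Re (cip m (app (F A) v) v) + 2 * Re (cip m (app (F X) w) v) + Re (cip m (app (F C) w) w)"
    using mult_left_mono[OF block_psd_trace[OF car blk, of m v w] \<beta>]
      block_psdD[OF blk, of "app (mat_adjoint Q) v" "app (mat_adjoint Q) w"]
    unfolding diag[OF car(1) real(1)] diag[OF car(3) real(2)] cross by (simp add: algebra_simps)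
qed

text \<open>The choice amounts to c + s = sqrt (1 + r) and c - s = sqrt (1 - r).\<close>

lemma rotation_coefficients:
  fixes r :: real
  assumes "0 \<le> r" "r \<le> 1"
  obtains c s :: real where "c\<^sup>2 + s\<^sup>2 = 1" "2 * c * s = r"
proof
  let ?p = "sqrt (1 + r)" and ?q = "sqrt (1 - r)"
  have pq: "?p\<^sup>2 = 1 + r" "?q\<^sup>2 = 1 - r" using assms by simp_all
  show "((?p + ?q) / 2)\<^sup>2 + ((?p - ?q) / 2)\<^sup>2 = 1"
    using pq by (simp add: power_divide power2_sum power2_diff field_simps)
  show "2 * ((?p + ?q) / 2) * ((?p - ?q) / 2) = r"
    using pq by (simp add: power2_eq_square field_simps)
qed

text \<open>This half of the min-max principle holds since z has components only along eigenvectors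
  with eigenvalue at most \<open>ev j\<close>.\<close>

lemma eigenframe_tail_le:
  assumes E: "eigenframe n H e ev" and H: "H \<in> carrier_mat n n" "hermitian_mat H"
    and orth: "\<And>k. k < j \<Longrightarrow> cip n z (e k) = 0"
  shows "Re (cip n (app H z) z) \<le> ev j * nsq n z"
  unfolding eigenframe_quadratic[OF E H] eigenframe_nsq[OF E, of z] sum_distrib_left
proof (rule sum_mono)
  fix i assume "i \<in> {..<n}"
  then show "ev i * (cmod (cip n z (e i)))\<^sup>2 \<le> ev j * (cmod (cip n z (e i)))\<^sup>2"
    using orth[of i] eigenframeD(3)[OF E, of j i]
    by (cases "i < j") (auto intro: mult_right_mono)
qed

text \<open>P^* has the same norm as P: Cauchy-Schwarz for |P^* v|^2, written as the inner product
  of v and P P^* v, followed by cancelling |P^* v|^2.\<close>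

lemma (in top_singular) nsq_adjoint_le: "nsq n (app (mat_adjoint P) v) \<le> ev 0 * nsq m v"
proof -
  let ?w = "app (mat_adjoint P) v"
  have "nsq n ?w = Re (cip m v (app P ?w))"
    by (simp flip: cip_adjoint_app[OF P])
  also have "\<dots> \<le> cmod (cip m v (app P ?w))" by (rule complex_Re_le_cmod)
  finally have "(nsq n ?w)\<^sup>2 \<le> (cmod (cip m v (app P ?w)))\<^sup>2" by (simp add: power_mono)
  also have "\<dots> \<le> nsq m v * nsq m (app P ?w)" by (rule cip_Cauchy_Schwarz)
  also have "\<dots> \<le> nsq m v * (ev 0 * nsq n ?w)" by (intro mult_left_mono nsq_P_le) simp
  finally have "nsq n ?w * nsq n ?w \<le> (ev 0 * nsq m v) * nsq n ?w"
    by (simp add: power2_eq_square algebra_simps)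
  moreover have "0 \<le> ev 0 * nsq m v" using ev_nonneg[of 0] n2 by simp
  ultimately show ?thesis using nsq_nonneg[of n ?w] by (cases "nsq n ?w = 0") (auto simp: less_le)
qed

text \<open>The polar factor enters only through its action on the first j + 1 right singular
  vectors of the image of \<open>Y\<close>. A dimension count selects one combination of them for
  which the rotated vector meets the eigenvalue bound of the geometric mean.\<close>

theorem singval_le_eigval_geom_mean:
  assumes m2: "2 \<le> m" and Q: "Q \<in> carrier_mat m m" and \<beta>: "\<beta> \<ge> 1 / 2 * (singval 1 Q)\<^sup>2"
    and B: "B \<in> carrier_mat m m" "psd_mat B" and D: "D \<in> carrier_mat m m" "psd_mat D"
    and Y: "Y \<in> carrier_mat m m"
    and ppt: "block_psd m B Y D" "block_psd m B (mat_adjoint Y) D"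
    and j: "j < m"
  shows "singval (Suc j) (Phi_plus \<beta> Q Y) \<le> eigval (Suc j) (geom_mean (Phi_plus \<beta> Q B) (Phi_plus \<beta> Q D))"
proof -
  let ?F = "Phi_plus \<beta> Q" and ?q = "app (mat_adjoint Q)"
  have F: "trace_congruence m m \<beta> 1 Q ?F" by (rule trace_congruence_Phi_plus[OF Q])
  note F_car = trace_congruenceD(1)[OF F] and F_form = trace_congruenceD(2)[OF F]
  interpret Q: top_singular m m Q by unfold_locales (use Q m2 in auto)
  have \<beta>ev: "Q.ev 0 \<le> 2 * \<beta>" using \<beta> unfolding Q.singval_sq by simp
  have \<beta>0: "0 \<le> \<beta>" using \<beta>ev Q.ev_nonneg[of 0] m2 by simp
  interpret BD: psd_pair m B D by unfold_locales (use B D in auto)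
  define G where "G = geom_mean B D"
  have G: "G \<in> carrier_mat m m" "psd_mat G" using BD.G_carrier BD.G_psd by (simp_all add: G_def)
  have blkG: "block_psd m B G D" unfolding G_def by (rule BD.block_psd_geom_mean)
  have blkY: "block_psd m G Y G" unfolding G_def by (rule BD.block_psd_geom_mean_of_ppt[OF Y ppt])
  note trB = psd_mat_trace(1)[OF B] and trD = psd_mat_trace(1)[OF D] and trG = psd_mat_trace[OF G]
  have blkF: "block_psd m (?F B) (?F G) (?F D)"
    by (rule block_psd_trace_congruence[OF F \<beta>0 B(1) G(1) D(1) trB trD blkG])
  have F_herm: "hermitian_mat (?F M)" if "M \<in> carrier_mat m m" "psd_mat M" for M
    using trace_congruence_adjoint[OF F that(1)] F_car[OF that(1)] psd_hermitian[OF that(2)]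
    by (simp add: hermitian_mat_def)
  have "psd_mat (?F B)" "psd_mat (?F D)"
    using psd_mat_iff[OF F_car[OF B(1)]] psd_mat_iff[OF F_car[OF D(1)]] F_herm[OF B] F_herm[OF D]
      block_psd_diag[OF blkF] by simp_all
  then interpret FBD: psd_pair m "?F B" "?F D"
    using F_car[OF B(1)] F_car[OF D(1)] by unfold_locales
  define \<Gamma> where "\<Gamma> = geom_mean (?F B) (?F D)"
  have \<Gamma>: "\<Gamma> \<in> carrier_mat m m" "psd_mat \<Gamma>" using FBD.G_carrier FBD.G_psd by (simp_all add: \<Gamma>_def)
  note \<Gamma>_herm = psd_hermitian[OF \<Gamma>(2)]
  obtain g where Eg: "eigenframe m \<Gamma> g (\<lambda>i. eigval (Suc i) \<Gamma>)"
    using spectral_theorem[OF \<Gamma>(1) \<Gamma>_herm] by blast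
  define \<gamma> where "\<gamma> = eigval (Suc j) \<Gamma>"
  define T where "T = Re (mat_trace G)"
  have T0: "0 \<le> T" using trG(2) by (simp add: T_def)
  \<comment> \<open>The form of K = Q G Q^*. The facts below express 0 \<le> K \<le> 2 \<beta> T I,
    and that the image \<beta> T I + K of \<open>G\<close> lies below \<Gamma>.\<close>
  define \<kappa> where "\<kappa> v = Re (cip m (app G (?q v)) (?q v))" for v
  have \<kappa>0: "0 \<le> \<kappa> v" for v unfolding \<kappa>_def by (rule psd_nonneg[OF G(2,1)])
  have \<kappa>_le: "\<kappa> v \<le> 2 * (\<beta> * T) * nsq m v" for v
  proof -
    have "\<kappa> v \<le> T * nsq m (?q v)" unfolding \<kappa>_def T_def by (rule trG(3))
    also have "\<dots> \<le> T * (Q.ev 0 * nsq m v)" by (intro mult_left_mono Q.nsq_adjoint_le T0)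
    also have "\<dots> \<le> T * ((2 * \<beta>) * nsq m v)" using \<beta>ev T0 by (intro mult_left_mono mult_right_mono) auto
    finally show ?thesis by (simp add: mult_ac)
  qed
  have \<Gamma>_ge: "\<beta> * T * nsq m v + \<kappa> v \<le> Re (cip m (app \<Gamma> v) v)" for v
  proof -
    have "Re (cip m (app (?F G) v) v) = \<beta> * T * nsq m v + \<kappa> v"
      by (subst F_form[OF G(1)], subst trG(1)) (simp add: cip_self \<kappa>_def T_def)
    then show ?thesis
      using FBD.geom_mean_maximal[OF F_car[OF G(1)] F_herm[OF G] blkF, of v] by (simp add: \<Gamma>_def)
  qed
  have \<gamma>_ge: "\<beta> * T \<le> \<gamma>"
    using \<Gamma>_ge[of "g j"] \<kappa>0[of "g j"] eigenframe_value[OF Eg j] eigenframe_nsq_vector[OF Eg j]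
    by (simp add: \<gamma>_def)
  define t where "t = mat_trace Y"
  have t_le: "cmod t \<le> T"
  proof -
    have "cmod t \<le> (\<Sum>i<m. cmod (cip m (app Y (unit i)) (unit i)))"
      unfolding t_def mat_trace_cip[OF Y] by (rule norm_sum)
    also have "\<dots> \<le> (\<Sum>i<m. Re (cip m (app G (unit i)) (unit i)))"
      by (intro sum_mono block_psd_form_le[OF blkY])
    finally show ?thesis by (simp add: T_def mat_trace_cip[OF G(1)])
  qed
  \<comment> \<open>If T = 0 then t = 0, and the quotient is 0 by convention, which still satisfies
    the three properties.\<close>
  define r where "r = cmod t / T"
  have r: "0 \<le> r" "r \<le> 1" "cmod t = r * T"
    using t_le T0 by (auto simp: r_def divide_simps)
  obtain c s where cs: "c\<^sup>2 + s\<^sup>2 = 1" "2 * c * s = r" using rotation_coefficients[OF r(1,2)] by blast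
  obtain \<omega> where \<omega>: "cmod \<omega> = 1" "t * \<omega> = complex_of_real (cmod t)" by (rule unimodular_phase)
  define Z where "Z = ?F Y"
  interpret Z: top_singular m m Z by unfold_locales (use F_car[OF Y] m2 in \<open>auto simp: Z_def\<close>)
  have sing: "singval (Suc i) Z = sqrt (Z.ev i)" for i by (simp add: singval_def Z.ev_def)
  show ?thesis
  \<comment> \<open>A vanishing singular value is covered by \<gamma> \<ge> \<beta> T \<ge> 0.
    Otherwise the first j + 1 singular values are positive and the left singular vectors can be
    formed by division.\<close>
  proof (cases "Z.ev j = 0")
    case True
    have "0 \<le> \<beta> * T" using \<beta>0 T0 by simp
    then show ?thesis using \<gamma>_ge True sing[of j] by (simp add: Z_def \<gamma>_def \<Gamma>_def)
  next
    case False
    have evj: "0 < Z.ev j" using Z.ev_nonneg[OF j] False by simp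
    have ev_ge: "Z.ev j \<le> Z.ev i" if "i \<le> j" for i using eigenframeD(3)[OF Z.E that j] .
    define \<sigma> where "\<sigma> i = sqrt (Z.ev i)" for i
    have \<sigma>_pos: "0 < \<sigma> i" if "i \<le> j" for i using evj ev_ge[OF that] by (simp add: \<sigma>_def)
    have \<sigma>_sq: "complex_of_real (Z.ev i) = complex_of_real (\<sigma> i) * complex_of_real (\<sigma> i)" if "i \<le> j" for i
      using evj ev_ge[OF that] by (simp add: \<sigma>_def flip: of_real_mult)
    define x where "x = Z.e"
    define y where "y i = (\<lambda>l. complex_of_real (inverse (\<sigma> i)) * app Z (x i) l)" for i
    have on: "cip m (x i) (x k) = (if i = k then 1 else 0)" if "i \<le> j" "k \<le> j" for i k
      using eigenframeD(1)[OF Z.E, of i k] that j by (simp add: x_def)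
    have ZZ: "cip m (app Z (x i)) (app Z (x k)) = (if i = k then complex_of_real (Z.ev i) else 0)"
      if "i \<le> j" "k \<le> j" for i k
    proof -
      have "cip m (app Z (x i)) (app Z (x k)) = complex_of_real (Z.ev i) * cip m (x i) (x k)"
        unfolding Z.cip_PP x_def using eigenframeD(2)[OF Z.E, of i] that j by (simp add: cip_scale_left)
      then show ?thesis by (simp add: on that)
    qed
    have ony: "cip m (y i) (y k) = (if i = k then 1 else 0)" if "i \<le> j" "k \<le> j" for i k
      using ZZ[OF that] \<sigma>_pos[OF that(1)] \<sigma>_sq[OF that(1)]
      unfolding y_def cip_scale_left cip_scale_right by (cases "i = k") (simp_all add: field_simps)
    have Zy: "cip m (app Z (x i)) (y k) = (if i = k then complex_of_real (\<sigma> i) else 0)"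
      if "i \<le> j" "k \<le> j" for i k
      using ZZ[OF that] \<sigma>_pos[OF that(1)] \<sigma>_sq[OF that(1)]
      unfolding y_def cip_scale_right by (cases "i = k") (simp_all add: field_simps)
    \<comment> \<open>These are j conditions on j + 1 coefficients: the combination of the rotated
      vectors has to be orthogonal to the j leading eigenvectors of \<Gamma>.\<close>
    from homogeneous_system_solvable[of j "\<lambda>k i. cip m (\<lambda>l. c * x i l + s * (\<omega> * y i l)) (g k)"]
    obtain a where "(\<exists>i\<le>j. a i \<noteq> 0) \<and>
        (\<forall>k<j. (\<Sum>i\<le>j. a i * cip m (\<lambda>l. c * x i l + s * (\<omega> * y i l)) (g k)) = 0)" ..
    then have a_nz: "\<exists>i\<le>j. a i \<noteq> 0"
      and a: "\<forall>k<j. (\<Sum>i\<le>j. a i * cip m (\<lambda>l. c * x i l + s * (\<omega> * y i l)) (g k)) = 0"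
      by (rule conjunct1, rule conjunct2)
    define v where "v = (\<lambda>l. \<Sum>i\<le>j. a i * x i l)"
    define w where "w = (\<lambda>l. \<Sum>i\<le>j. a i * y i l)"
    define u where "u = (\<lambda>l. \<omega> * w l)"
    define N where "N = (\<Sum>i\<le>j. (cmod (a i))\<^sup>2)"
    have double: "cip m (\<lambda>l. \<Sum>i\<le>j. a i * p i l) (\<lambda>l. \<Sum>i\<le>j. a i * q i l)
        = (\<Sum>i\<le>j. complex_of_real (\<tau> i) * complex_of_real ((cmod (a i))\<^sup>2))"
      if "\<And>i k. i \<le> j \<Longrightarrow> k \<le> j \<Longrightarrow> cip m (p i) (q k) = (if i = k then complex_of_real (\<tau> i) else 0)"
      for p q :: "nat \<Rightarrow> nat \<Rightarrow> complex" and \<tau>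
    proof -
      have "cip m (\<lambda>l. \<Sum>i\<le>j. a i * p i l) (\<lambda>l. \<Sum>i\<le>j. a i * q i l)
          = (\<Sum>i\<le>j. a i * (\<Sum>k\<le>j. cnj (a k) * cip m (p i) (q k)))"
        by (simp only: cip_sum_left cip_sum_right cip_scale_left cip_scale_right sum_distrib_left)
      also have "\<dots> = (\<Sum>i\<le>j. a i * (\<Sum>k\<le>j. if i = k then cnj (a i) * complex_of_real (\<tau> i) else 0))"
        by (intro sum.cong refl arg_cong[where f = "\<lambda>z. a _ * z"]) (simp add: that)
      also have "\<dots> = (\<Sum>i\<le>j. complex_of_real (\<tau> i) * complex_of_real ((cmod (a i))\<^sup>2))"
        by (simp add: complex_norm_square mult_ac del: of_real_power)
      finally show ?thesis .
    qed
    have nv: "nsq m v = N"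
    proof -
      have "cip m v v = (\<Sum>i\<le>j. complex_of_real 1 * complex_of_real ((cmod (a i))\<^sup>2))"
        unfolding v_def by (rule double) (simp add: on)
      then have "complex_of_real (nsq m v) = complex_of_real N" by (simp add: cip_self N_def)
      then show ?thesis by (simp only: of_real_eq_iff)
    qed
    have nw: "nsq m w = N"
    proof -
      have "cip m w w = (\<Sum>i\<le>j. complex_of_real 1 * complex_of_real ((cmod (a i))\<^sup>2))"
        unfolding w_def by (rule double) (simp add: ony)
      then have "complex_of_real (nsq m w) = complex_of_real N" by (simp add: cip_self N_def)
      then show ?thesis by (simp only: of_real_eq_iff)
    qed
    have nu: "nsq m u = N" by (simp add: u_def nsq_scale \<omega>(1) nw)
    have N_pos: "0 < N"
    proof -
      obtain i where "i \<le> j" "a i \<noteq> 0" using a_nz by blast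
      then show ?thesis unfolding N_def by (intro sum_pos2[of _ i]) auto
    qed
    \<comment> \<open>\<open>Z\<close> maps \<open>x i\<close> to \<sigma> i times
      \<open>y i\<close>, and \<sigma> j is the smallest of these factors.\<close>
    have Zvw: "\<sigma> j * N \<le> Re (cip m (app Z v) w)"
    proof -
      have "cip m (app Z v) w = (\<Sum>i\<le>j. complex_of_real (\<sigma> i) * complex_of_real ((cmod (a i))\<^sup>2))"
        unfolding v_def w_def app_sum app_scale by (rule double) (rule Zy)
      then have "Re (cip m (app Z v) w) = (\<Sum>i\<le>j. \<sigma> i * (cmod (a i))\<^sup>2)"
        by (simp only: of_real_mult[symmetric] of_real_sum[symmetric] Re_complex_of_real)
      moreover have "\<sigma> j * N \<le> (\<Sum>i\<le>j. \<sigma> i * (cmod (a i))\<^sup>2)"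
        unfolding N_def sum_distrib_left
        by (intro sum_mono mult_right_mono) (use ev_ge in \<open>auto simp: \<sigma>_def\<close>)
      ultimately show ?thesis by simp
    qed
    define \<rho> where "\<rho> = Re (cip m v u)"
    have \<rho>: "\<bar>\<rho>\<bar> \<le> N"
    proof -
      have "(cmod (cip m v u))\<^sup>2 \<le> N\<^sup>2"
        using cip_Cauchy_Schwarz[of m v u] by (simp add: nv nu power2_eq_square)
      then have "cmod (cip m v u) \<le> N" using N_pos by (simp add: power2_le_iff_abs_le)
      then show ?thesis using abs_Re_le_cmod[of "cip m v u"] by (simp add: \<rho>_def)
    qed
    have \<kappa>u: "\<kappa> w = \<kappa> u"
    proof -
      have "\<omega> * cnj \<omega> = 1" using \<omega>(1) by (simp add: complex_norm_square[symmetric] del: of_real_power)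
      then show ?thesis
        by (simp add: \<kappa>_def u_def app_scale cip_scale_left cip_scale_right flip: mult.assoc)
    qed
    \<comment> \<open>The phase \<omega> turns t into its modulus r T when w is replaced by u in the
      trace term.\<close>
    have "Re (cip m (app Z v) w) = \<beta> * (r * T) * \<rho> + Re (cip m (app Y (?q v)) (?q w))"
    proof -
      have "t * cip m v w = t * \<omega> * cip m v u"
      proof -
        have "\<omega> * cnj \<omega> = 1" using \<omega>(1) by (simp add: complex_norm_square[symmetric] del: of_real_power)
        then show ?thesis by (simp add: u_def cip_scale_right mult.assoc flip: mult.assoc[of \<omega>])
      qed
      then show ?thesis
        unfolding Z_def F_form[OF Y] t_def[symmetric] \<omega>(2)
        by (simp add: mult.assoc \<rho>_def r(3))
    qed
    moreover have "2 * Re (cip m (app Y (?q v)) (?q w)) \<le> \<kappa> v + \<kappa> u"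
      using block_psd_cross_le[OF blkY, of "?q v" "?q w"] by (simp add: \<kappa>u[symmetric]) (simp add: \<kappa>_def)
    ultimately have main: "2 * (\<sigma> j * N) \<le> 2 * (\<beta> * T * (r * \<rho>)) + (\<kappa> v + \<kappa> u)"
      using Zvw by (simp add: mult_ac)
    \<comment> \<open>An orthogonal rotation of the pair (v, u): it preserves the sum of the values
      of \<kappa> and splits the norms into N + r \<rho> and N - r \<rho>.\<close>
    define z z' where "z = (\<lambda>l. complex_of_real c * v l + complex_of_real s * u l)"
      and "z' = (\<lambda>l. complex_of_real s * v l - complex_of_real c * u l)"
    have nz: "nsq m z = N + r * \<rho>"
    proof -
      have "nsq m z = (c\<^sup>2 + s\<^sup>2) * N + 2 * c * s * \<rho>"
        by (simp add: z_def nsq_add nsq_scale cip_scale_left cip_scale_right nv nu \<rho>_def algebra_simps)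
      then show ?thesis by (simp add: cs)
    qed
    have nz': "nsq m z' = N - r * \<rho>"
    proof -
      have "nsq m z' = (c\<^sup>2 + s\<^sup>2) * N - 2 * c * s * \<rho>"
        by (simp add: z'_def nsq_diff nsq_scale cip_scale_left cip_scale_right nv nu \<rho>_def algebra_simps)
      then show ?thesis by (simp add: cs)
    qed
    have \<kappa>_sum: "\<kappa> v + \<kappa> u = \<kappa> z + \<kappa> z'"
    proof -
      have "\<kappa> z + \<kappa> z' = (c\<^sup>2 + s\<^sup>2) * (\<kappa> v + \<kappa> u)"
        by (simp add: \<kappa>_def z_def z'_def app_simps cip_simps power2_eq_square algebra_simps)
      then show ?thesis by (simp add: cs)
    qed
    have "cip m z (g k) = 0" if "k < j" for k
    proof -
      have "z = (\<lambda>l. \<Sum>i\<le>j. a i * (c * x i l + s * (\<omega> * y i l)))"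
        by (simp add: z_def v_def u_def w_def sum_distrib_left sum.distrib algebra_simps)
      then show ?thesis using a[rule_format, OF that] by (simp add: cip_sum_left cip_scale_left)
    qed
    then have "Re (cip m (app \<Gamma> z) z) \<le> \<gamma> * nsq m z"
      unfolding \<gamma>_def by (rule eigenframe_tail_le[OF Eg \<Gamma>(1) \<Gamma>_herm])
    then have \<kappa>z: "\<kappa> z \<le> (\<gamma> - \<beta> * T) * (N + r * \<rho>)"
      using \<Gamma>_ge[of z] by (simp add: nz algebra_simps)
    have "r * \<rho> \<le> N"
      using mult_mono[OF r(2) \<rho>] r(1) abs_ge_self[of "r * \<rho>"] by (simp add: abs_mult)
    then have "(\<gamma> - \<beta> * T) * (N + r * \<rho>) \<le> (\<gamma> - \<beta> * T) * (2 * N)"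
      using \<gamma>_ge by (intro mult_left_mono) auto
    moreover have "\<kappa> z' \<le> 2 * (\<beta> * T) * (N - r * \<rho>)" using \<kappa>_le[of z'] by (simp add: nz')
    \<comment> \<open>The terms with r \<rho> cancel between the trace part of \<open>main\<close>
      and the bound for z', and so do the remaining multiples of \<beta> T.\<close>
    ultimately have "2 * (\<sigma> j * N) \<le> 2 * (\<gamma> * N)"
      using main \<kappa>z unfolding \<kappa>_sum by (simp add: algebra_simps)
    then have "\<sigma> j \<le> \<gamma>" using N_pos by simp
    then show ?thesis using sing[of j] by (simp add: Z_def \<gamma>_def \<Gamma>_def \<sigma>_def)
  qed
qed

theorem theorem5p5:
  fixes m n :: nat and \<alpha> \<beta> :: real and P Q A X C :: "complex mat"
  assumes "m \<ge> 2" and "n \<ge> 2"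
    and "P \<in> carrier_mat m n" and "Q \<in> carrier_mat m m"
    and "A \<in> carrier_mat n n" and "X \<in> carrier_mat n n" and "C \<in> carrier_mat n n"
    and "psd_mat (four_block_mat A X (mat_adjoint X) C)"
  shows
    "(\<alpha> \<ge> singval 1 P * singval 2 P \<and> \<beta> \<ge> 1 / 2 * (singval 1 Q)\<^sup>2 \<longrightarrow>
        (\<forall>j \<in> {1..m}.
           singval j (Phi_plus \<beta> Q (Phi_plus \<alpha> P X))
             \<le> eigval j (geom_mean (Phi_plus \<beta> Q (Phi_plus \<alpha> P A))
                                   (Phi_plus \<beta> Q (Phi_plus \<alpha> P C)))))
     \<and> (\<alpha> \<ge> (singval 1 P)\<^sup>2 + (singval 2 P)\<^sup>2 \<and> \<beta> \<ge> 1 / 2 * (singval 1 Q)\<^sup>2 \<longrightarrow>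
        (\<forall>j \<in> {1..m}.
           singval j (Phi_plus \<beta> Q (Phi_minus \<alpha> P X))
             \<le> eigval j (geom_mean (Phi_plus \<beta> Q (Phi_minus \<alpha> P A))
                                   (Phi_plus \<beta> Q (Phi_minus \<alpha> P C)))))"
proof -
  \<comment> \<open>Common to both signs, which differ only in how the two block conditions are
    obtained.\<close>
  have conclude: "\<forall>j \<in> {1..m}. singval j (Phi_plus \<beta> Q (F X))
      \<le> eigval j (geom_mean (Phi_plus \<beta> Q (F A)) (Phi_plus \<beta> Q (F C)))"
    if inp: "psd_block_input m n P \<alpha> s F A X C" and \<beta>: "\<beta> \<ge> 1 / 2 * (singval 1 Q)\<^sup>2"
      and blk: "block_psd m (F A) (F X) (F C)" "block_psd m (F A) (F (mat_adjoint X)) (F C)" for F s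
  proof
    fix j assume j: "j \<in> {1..m}"
    have F: "trace_congruence m n \<alpha> s P F" by (rule psd_block_input.F[OF inp])
    note car = trace_congruenceD(1)[OF F]
    \<comment> \<open>The preceding theorem counts from 0, hence the shift of the index.\<close>
    have "singval (Suc (j - 1)) (Phi_plus \<beta> Q (F X))
      \<le> eigval (Suc (j - 1)) (geom_mean (Phi_plus \<beta> Q (F A)) (Phi_plus \<beta> Q (F C)))"
    proof (rule singval_le_eigval_geom_mean[OF assms(1,4) \<beta>])
      show "block_psd m (F A) (mat_adjoint (F X)) (F C)"
        unfolding trace_congruence_adjoint[OF F assms(6)] by (rule blk(2))
      show "j - 1 < m" using j by auto
    qed (intro car assms psd_block_input.image_psd[OF inp blk(1)] blk(1))+
    then show "singval j (Phi_plus \<beta> Q (F X))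
      \<le> eigval j (geom_mean (Phi_plus \<beta> Q (F A)) (Phi_plus \<beta> Q (F C)))" using j by simp
  qed
  have plus: "psd_block_input m n P \<alpha> 1 (Phi_plus \<alpha> P) A X C"
    by unfold_locales (use assms trace_congruence_Phi_plus in auto)
  have minus: "psd_block_input m n P \<alpha> (- 1) (Phi_minus \<alpha> P) A X C"
    by unfold_locales (use assms trace_congruence_Phi_minus in auto)
  show ?thesis
    using conclude[OF plus _ psd_block_input.ppt_image_plus[OF plus refl]]
      conclude[OF minus _ psd_block_input.ppt_image_minus[OF minus refl]] by (intro conjI impI) simp_all
qed

end
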